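(* For all $n\ge1$, $$\sum_{\mu\in\mathrm{WComp}_{n-1}}\dim\mathcal{L}ie(\mu)\mathbf{x}^\mu=\sum_{\Upsilon\in\mathsf{Nor}_n}e_{\lambda^{\mathsf{Lyn}}(\Upsilon)}(\mathbf{x})=\sum_{\theta\in\mathcal{Q}_{n-1}}e_{\lambda^{\mathsf{AA}}(\theta)}(\mathbf{x})=\sum_{\theta\in\mathcal{Q}_{n-1}}e_{\lambda^{\mathsf{TN}}(\theta)}(\mathbf{x})=\sum_{\Upsilon\in\mathsf{Nor}_n}e_{\lambda^{\mathsf{Comb}}(\Upsilon)}(\mathbf{x}).$$
   Context: Fix a field $\mathbf{k}$. $\mathrm{WComp}_{n-1}$: weak compositions with sum $n-1$; $\mathbf{x}^\mu=\prod x_i^{\mu(i)}$; $e_\lambda$ elementary symmetric function. $\mathcal{L}ie(\mu)$ is the subspace of the multilinear component of the free Lie algebra on $[n]$ with compatible Lie brackets $[\cdot,\cdot]_j$, $j\in\mathbb{P}$ (relations: antisymmetry and Jacobi for each bracket, and $[x,[y,z]_j]_i+[z,[x,y]_j]_i+[y,[z,x]_j]_i+[x,[y,z]_i]_j+[z,[x,y]_i]_j+[y,[z,x]_i]_j=0$ for $i\ne j$) spanned by bracketed permutations with exactly $\mu(j)$ brackets of type $j$. $\mathsf{Nor}_n$: planar rooted binary trees with leaves labeled bijectively by $[n]$ such that $v(x)=v(L(x))$ for every internal node $x$ ($L,R$ left/right child, $v(x)$ the smallest leaf label below $x$). A Lyndon node is an internal node $x$ with $L(x)$ a leaf or $v(R(L(x)))>v(R(x))$.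 $\lambda^{\mathsf{Lyn}}(\Upsilon)$ is the partition of block sizes of the finest set partition of internal nodes in which each non-Lyndon $x$ is in the same block as $L(x)$. $\lambda^{\mathsf{Comb}}(\Upsilon)$ is the partition of block sizes of the finest set partition of internal nodes in which each internal node is in the same block as its right child whenever that child is internal. A Stirling permutation of $[m]$ is a permutation of the multiset $\{1,1,2,2,\dots,m,m\}$ such that for each $a$, all letters between the two occurrences of $a$ are larger than $a$; $\mathcal{Q}_m$ is their set ($\mathcal{Q}_0$ contains only the empty word). A pair $(a,b)$ with $a<b$ is an ascending adjacent pair of $\theta$ if the second occurrence of $a$ immediately precedes the first occurrence of $b$; it is a terminally nested pair if the second occurrence of $a$ immediately follows the second occurrence of $b$. An ascending adjacent (resp. terminally nested) sequence is $a_1<\dots<a_r$ with each $(a_i,a_{i+1})$ an ascending adjacent (resp. terminally nested) pair. $\lambda^{\mathsf{AA}}(\theta)$ (resp. $\lambda^{\mathsf{TN}}(\theta)$) is the integer partition of $m$ whose parts are the lengths of the maximal ascending adjacent (resp. terminally nested) sequences, each letter lying in exactly one such maximal sequence (possibly of length $1$). *)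

theory Defs
  imports Complex_Main "HOL-Library.Poly_Mapping" "HOL-Library.Multiset"
begin

text \<open>
  Variables of symmetric functions and types of Lie brackets are indexed by the positive integers
  in the source. Here both are indexed by \<^typ>\<open>nat\<close>, the index \<open>i\<close> standing for \<open>i + 1\<close>.
  A weak composition is an element of \<^typ>\<open>nat \<Rightarrow>\<^sub>0 nat\<close>, and so is the exponent of a monomial.
\<close>

section \<open>Formal power series in the variables \<open>x\<^sub>0, x\<^sub>1, x\<^sub>2, \<dots>\<close>\<close>

definition weight :: "(nat \<Rightarrow>\<^sub>0 nat) \<Rightarrow> nat" where
  "weight \<mu> = (\<Sum>i\<in>Poly_Mapping.keys \<mu>. Poly_Mapping.lookup \<mu> i)"

definition WComp :: "nat \<Rightarrow> (nat \<Rightarrow>\<^sub>0 nat) set" where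
  "WComp m = {\<mu>. weight \<mu> = m}"

definition splits :: "(nat \<Rightarrow>\<^sub>0 nat) \<Rightarrow> ((nat \<Rightarrow>\<^sub>0 nat) \<times> (nat \<Rightarrow>\<^sub>0 nat)) set" where
  "splits \<mu> = {(\<alpha>, \<beta>). \<alpha> + \<beta> = \<mu>}"

lemma finite_splits: "finite (splits \<mu>)"
proof -
  let ?F = "{f. \<forall>i. (i \<in> Poly_Mapping.keys \<mu> \<longrightarrow> f i \<in> {..weight \<mu>}) \<and> (i \<notin> Poly_Mapping.keys \<mu> \<longrightarrow> f i = 0)}"
  have fin: "finite ?F"
    by (rule finite_set_of_finite_funs) auto
  have mem: "Poly_Mapping.lookup \<alpha> \<in> ?F" if "\<alpha> + \<beta> = \<mu>" for \<alpha> \<beta>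
  proof -
    have le: "Poly_Mapping.lookup \<alpha> i \<le> Poly_Mapping.lookup \<mu> i" for i
      using that by (auto simp: lookup_add)
    have "Poly_Mapping.lookup \<mu> i \<le> weight \<mu>" if "i \<in> Poly_Mapping.keys \<mu>" for i
      unfolding weight_def using that by (intro member_le_sum) auto
    with le show ?thesis
      by (auto simp: not_in_keys_iff_lookup_eq_zero intro: order_trans) (metis le le_zero_eq)
  qed
  have "inj_on (\<lambda>(\<alpha>, \<beta>). Poly_Mapping.lookup \<alpha>) (splits \<mu>)"
    unfolding inj_on_def splits_def
    by (auto simp: lookup_inject)
  moreover have "(\<lambda>(\<alpha>, \<beta>). Poly_Mapping.lookup \<alpha>) ` splits \<mu> \<subseteq> ?F"
    using mem by (auto simp: splits_def)
  ultimately show ?thesis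
    using fin by (meson finite_subset inj_on_finite)
qed

typedef 'a mps = "UNIV :: ((nat \<Rightarrow>\<^sub>0 nat) \<Rightarrow> 'a) set"
  morphisms mps_coeff Abs_mps
  by simp

lemma mps_coeff_Abs [simp]: "mps_coeff (Abs_mps f) = f"
  by (simp add: Abs_mps_inverse)

lemma mps_eqI: "(\<And>\<mu>. mps_coeff f \<mu> = mps_coeff g \<mu>) \<Longrightarrow> f = g"
  by (metis ext mps_coeff_inject)

instantiation mps :: (comm_ring_1) comm_ring_1
begin

definition zero_mps :: "'a mps" where
  "0 = Abs_mps (\<lambda>\<mu>. 0)"
definition one_mps :: "'a mps" where
  "1 = Abs_mps (\<lambda>\<mu>. if \<mu> = 0 then 1 else 0)"
definition plus_mps :: "'a mps \<Rightarrow> 'a mps \<Rightarrow> 'a mps" where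
  "f + g = Abs_mps (\<lambda>\<mu>. mps_coeff f \<mu> + mps_coeff g \<mu>)"
definition minus_mps :: "'a mps \<Rightarrow> 'a mps \<Rightarrow> 'a mps" where
  "f - g = Abs_mps (\<lambda>\<mu>. mps_coeff f \<mu> - mps_coeff g \<mu>)"
definition uminus_mps :: "'a mps \<Rightarrow> 'a mps" where
  "- f = Abs_mps (\<lambda>\<mu>. - mps_coeff f \<mu>)"
definition times_mps :: "'a mps \<Rightarrow> 'a mps \<Rightarrow> 'a mps" where
  "f * g = Abs_mps (\<lambda>\<mu>. \<Sum>(\<alpha>, \<beta>)\<in>splits \<mu>. mps_coeff f \<alpha> * mps_coeff g \<beta>)"

lemmas mps_defs = zero_mps_def one_mps_def plus_mps_def minus_mps_def uminus_mps_def times_mps_def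

instance
proof
  fix f g h :: "'a mps"
  show "f * g * h = f * (g * h)"
  proof (rule mps_eqI)
    fix \<mu>
    have "mps_coeff (f * g * h) \<mu> =
        (\<Sum>(\<delta>, \<gamma>)\<in>splits \<mu>. \<Sum>(\<alpha>, \<beta>)\<in>splits \<delta>. mps_coeff f \<alpha> * mps_coeff g \<beta> * mps_coeff h \<gamma>)"
      by (simp add: times_mps_def sum_distrib_right case_prod_beta)
    also have "\<dots> = (\<Sum>((\<delta>, \<gamma>), (\<alpha>, \<beta>))\<in>(SIGMA p:splits \<mu>. splits (fst p)).
        mps_coeff f \<alpha> * mps_coeff g \<beta> * mps_coeff h \<gamma>)"
      by (subst sum.Sigma[symmetric]) (auto simp: finite_splits case_prod_beta)
    also have "\<dots> = (\<Sum>((\<alpha>, \<epsilon>), (\<beta>, \<gamma>))\<in>(SIGMA p:splits \<mu>. splits (snd p)).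
        mps_coeff f \<alpha> * (mps_coeff g \<beta> * mps_coeff h \<gamma>))"
      by (rule sum.reindex_bij_witness[where
            i = "\<lambda>((\<alpha>, \<epsilon>), (\<beta>, \<gamma>)). ((\<alpha> + \<beta>, \<gamma>), (\<alpha>, \<beta>))" and
            j = "\<lambda>((\<delta>, \<gamma>), (\<alpha>, \<beta>)). ((\<alpha>, \<beta> + \<gamma>), (\<beta>, \<gamma>))"])
        (auto simp: splits_def add.assoc mult.assoc)
    also have "\<dots> = (\<Sum>(\<alpha>, \<epsilon>)\<in>splits \<mu>. \<Sum>(\<beta>, \<gamma>)\<in>splits \<epsilon>.
        mps_coeff f \<alpha> * (mps_coeff g \<beta> * mps_coeff h \<gamma>))"
      by (subst sum.Sigma[symmetric]) (auto simp: finite_splits case_prod_beta)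
    also have "\<dots> = mps_coeff (f * (g * h)) \<mu>"
      by (simp add: times_mps_def sum_distrib_left case_prod_beta)
    finally show "mps_coeff (f * g * h) \<mu> = mps_coeff (f * (g * h)) \<mu>" .
  qed
  show "f * g = g * f"
  proof (rule mps_eqI)
    fix \<mu>
    show "mps_coeff (f * g) \<mu> = mps_coeff (g * f) \<mu>"
      unfolding times_mps_def mps_coeff_Abs
      by (rule sum.reindex_bij_witness[where i = prod.swap and j = prod.swap])
        (auto simp: splits_def add.commute mult.commute)
  qed
  show "1 * f = f"
  proof (rule mps_eqI)
    fix \<mu>
    have "mps_coeff (1 * f) \<mu> = (\<Sum>p\<in>splits \<mu>. if p = (0, \<mu>) then mps_coeff f \<mu> else 0)"
      unfolding times_mps_def one_mps_def mps_coeff_Abs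
      by (rule sum.cong) (auto simp: splits_def split: if_splits)
    also have "\<dots> = mps_coeff f \<mu>"
      by (simp add: finite_splits) (simp add: splits_def)
    finally show "mps_coeff (1 * f) \<mu> = mps_coeff f \<mu>" .
  qed
  show "(f + g) * h = f * h + g * h"
    by (simp add: times_mps_def plus_mps_def distrib_right case_prod_beta sum.distrib)
  show "(0::'a mps) \<noteq> 1"
    by (auto simp: zero_mps_def one_mps_def dest!: arg_cong[where f = "\<lambda>f. mps_coeff f 0"])
qed (auto intro!: mps_eqI simp: mps_defs)

end

text \<open>
  Sum of a possibly infinite family of power series; meaningful for families such that each
  monomial occurs in only finitely many members, as is the case for those below.
\<close>

definition formal_sum :: "'b set \<Rightarrow> ('b \<Rightarrow> 'a::comm_ring_1 mps) \<Rightarrow> 'a mps" where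
  "formal_sum A f =
     Abs_mps (\<lambda>\<mu>. \<Sum>a | a \<in> A \<and> mps_coeff (f a) \<mu> \<noteq> 0. mps_coeff (f a) \<mu>)"

definition mvar :: "nat \<Rightarrow> 'a::comm_ring_1 mps" where
  "mvar i = Abs_mps (\<lambda>\<mu>. if \<mu> = Poly_Mapping.single i 1 then 1 else 0)"

definition mmonom :: "(nat \<Rightarrow>\<^sub>0 nat) \<Rightarrow> 'a::comm_ring_1 mps" where
  "mmonom \<mu> = (\<Prod>i\<in>Poly_Mapping.keys \<mu>. mvar i ^ Poly_Mapping.lookup \<mu> i)"

definition elem_sym :: "nat \<Rightarrow> 'a::comm_ring_1 mps" where
  "elem_sym k = formal_sum {S. finite S \<and> card S = k} (\<lambda>S. \<Prod>i\<in>S. mvar i)"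

text \<open>Integer partitions are multisets of positive parts.\<close>

definition elem_sym_part :: "nat multiset \<Rightarrow> 'a::comm_ring_1 mps" where
  "elem_sym_part \<nu> = (\<Prod>k\<in>#\<nu>. elem_sym k)"


section \<open>Formal linear combinations and quotients\<close>

definition lin_scale :: "'k::field \<Rightarrow> ('w \<Rightarrow>\<^sub>0 'k) \<Rightarrow> ('w \<Rightarrow>\<^sub>0 'k)" where
  "lin_scale c p = Poly_Mapping.map ((*) c) p"

lemma lookup_lin_scale [simp]: "Poly_Mapping.lookup (lin_scale c p) w = c * Poly_Mapping.lookup p w"
  by (simp add: lin_scale_def Poly_Mapping.map.rep_eq when_def)

global_interpretation lin: vector_space "lin_scale :: 'k::field \<Rightarrow> ('w \<Rightarrow>\<^sub>0 'k) \<Rightarrow> ('w \<Rightarrow>\<^sub>0 'k)"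
  by unfold_locales (auto intro!: poly_mapping_eqI simp: lookup_add algebra_simps)

definition coset :: "('w \<Rightarrow>\<^sub>0 'k::field) set \<Rightarrow> ('w \<Rightarrow>\<^sub>0 'k) \<Rightarrow> ('w \<Rightarrow>\<^sub>0 'k) set" where
  "coset W v = (\<lambda>w. v + w) ` W"

text \<open>\<open>b\<close> is mapped injectively onto a linearly independent subset of the quotient by \<open>W\<close>.\<close>

definition independent_mod ::
    "('w \<Rightarrow>\<^sub>0 'k::field) set \<Rightarrow> ('w \<Rightarrow>\<^sub>0 'k) set \<Rightarrow> bool" where
  "independent_mod W b \<longleftrightarrow>
     (\<forall>t u. finite t \<longrightarrow> t \<subseteq> b \<longrightarrow> (\<Sum>v\<in>t. lin_scale (u v) v) \<in> W \<longrightarrow> (\<forall>v\<in>t. u v = 0))"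

text \<open>
  The dimension of a subspace \<open>Q\<close> of the quotient by \<open>W\<close>, where \<open>Q\<close> is given as a set of cosets
  and a basis of \<open>Q\<close> by a set \<open>b\<close> of representatives. As for \<^const>\<open>lin.dim\<close>, it is \<open>0\<close> if
  there is no finite basis.
\<close>

definition quotient_dim ::
    "('w \<Rightarrow>\<^sub>0 'k::field) set \<Rightarrow> ('w \<Rightarrow>\<^sub>0 'k) set set \<Rightarrow> nat" where
  "quotient_dim W Q =
     (if \<exists>b. independent_mod W b \<and> coset W ` lin.span b = Q
      then card (SOME b. independent_mod W b \<and> coset W ` lin.span b = Q) else 0)"


section \<open>Free Lie algebras with compatible brackets\<close>

text \<open>\<open>Brk j s t\<close> is the bracket of type \<open>j\<close> of \<open>s\<close> and \<open>t\<close>.\<close>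

datatype lie_word = Gen nat | Brk nat lie_word lie_word

primrec letters :: "lie_word \<Rightarrow> nat list" where
  "letters (Gen a) = [a]"
| "letters (Brk j s t) = letters s @ letters t"

primrec bracket_type :: "lie_word \<Rightarrow> (nat \<Rightarrow>\<^sub>0 nat)" where
  "bracket_type (Gen a) = 0"
| "bracket_type (Brk j s t) = Poly_Mapping.single j 1 + bracket_type s + bracket_type t"

text \<open>
  The nonassociative algebra with one bilinear product for each bracket type that is free on the
  generators \<open>1, \<dots>, n\<close>: linear combinations of bracketed words in these generators.
\<close>

definition free_alg :: "nat \<Rightarrow> (lie_word \<Rightarrow>\<^sub>0 'k::field) set" where
  "free_alg n = {p. \<forall>w\<in>Poly_Mapping.keys p. set (letters w) \<subseteq> {1..n}}"

text \<open>Bilinear extension of the products on words.\<close>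

definition bracket ::
    "nat \<Rightarrow> (lie_word \<Rightarrow>\<^sub>0 'k::field) \<Rightarrow> (lie_word \<Rightarrow>\<^sub>0 'k) \<Rightarrow> (lie_word \<Rightarrow>\<^sub>0 'k)" where
  "bracket j p q =
     (\<Sum>s\<in>Poly_Mapping.keys p. \<Sum>t\<in>Poly_Mapping.keys q.
        Poly_Mapping.single (Brk j s t) (Poly_Mapping.lookup p s * Poly_Mapping.lookup q t))"

text \<open>
  The free Lie algebra on \<open>1, \<dots>, n\<close> with compatible brackets is the quotient of \<^const>\<open>free_alg\<close>
  by the ideal, with respect to all the products, that is generated by the defining relations.
\<close>

inductive_set lie_ideal :: "nat \<Rightarrow> (lie_word \<Rightarrow>\<^sub>0 'k::field) set" for n where
  zero: "0 \<in> lie_ideal n"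
| add: "p \<in> lie_ideal n \<Longrightarrow> q \<in> lie_ideal n \<Longrightarrow> p + q \<in> lie_ideal n"
| scale: "p \<in> lie_ideal n \<Longrightarrow> lin_scale c p \<in> lie_ideal n"
| bracket_left: "p \<in> lie_ideal n \<Longrightarrow> x \<in> free_alg n \<Longrightarrow> bracket j p x \<in> lie_ideal n"
| bracket_right: "p \<in> lie_ideal n \<Longrightarrow> x \<in> free_alg n \<Longrightarrow> bracket j x p \<in> lie_ideal n"
| antisym: "x \<in> free_alg n \<Longrightarrow> y \<in> free_alg n \<Longrightarrow>
    bracket j x y + bracket j y x \<in> lie_ideal n"
| jacobi: "x \<in> free_alg n \<Longrightarrow> y \<in> free_alg n \<Longrightarrow> z \<in> free_alg n \<Longrightarrow>
    bracket j x (bracket j y z) + bracket j z (bracket j x y) + bracket j y (bracket j z x)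
      \<in> lie_ideal n"
| compatible: "i \<noteq> j \<Longrightarrow> x \<in> free_alg n \<Longrightarrow> y \<in> free_alg n \<Longrightarrow> z \<in> free_alg n \<Longrightarrow>
    bracket i x (bracket j y z) + bracket i z (bracket j x y) + bracket i y (bracket j z x) +
    bracket j x (bracket i y z) + bracket j z (bracket i x y) + bracket j y (bracket i z x)
      \<in> lie_ideal n"

definition bracketed_perms :: "nat \<Rightarrow> (nat \<Rightarrow>\<^sub>0 nat) \<Rightarrow> lie_word set" where
  "bracketed_perms n \<mu> =
     {w. distinct (letters w) \<and> set (letters w) = {1..n} \<and> bracket_type w = \<mu>}"

text \<open>
  The subspace of the free Lie algebra with compatible brackets that is spanned by the bracketed
  permutations of type \<open>\<mu>\<close>, as a set of cosets.
\<close>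

definition Lie :: "nat \<Rightarrow> (nat \<Rightarrow>\<^sub>0 nat) \<Rightarrow> (lie_word \<Rightarrow>\<^sub>0 'k::field) set set" where
  "Lie n \<mu> =
     coset (lie_ideal n) ` lin.span ((\<lambda>w. Poly_Mapping.single w 1) ` bracketed_perms n \<mu>)"

definition dim_Lie :: "'k::field itself \<Rightarrow> nat \<Rightarrow> (nat \<Rightarrow>\<^sub>0 nat) \<Rightarrow> nat" where
  "dim_Lie _ n \<mu> = quotient_dim (lie_ideal n) (Lie n \<mu> :: (lie_word \<Rightarrow>\<^sub>0 'k) set set)"


section \<open>Normalized binary trees\<close>

datatype btree = Leaf nat | Node btree btree

primrec leaf_labels :: "btree \<Rightarrow> nat list" where
  "leaf_labels (Leaf a) = [a]"
| "leaf_labels (Node l r) = leaf_labels l @ leaf_labels r"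

definition vmin :: "btree \<Rightarrow> nat" where
  "vmin t = Min (set (leaf_labels t))"

text \<open>Nodes of a tree are represented by the paths leading to them from the root.\<close>

datatype dir = GoL | GoR

fun subtree :: "btree \<Rightarrow> dir list \<Rightarrow> btree option" where
  "subtree t [] = Some t"
| "subtree (Node l r) (GoL # p) = subtree l p"
| "subtree (Node l r) (GoR # p) = subtree r p"
| "subtree (Leaf a) (d # p) = None"

definition internal_nodes :: "btree \<Rightarrow> dir list set" where
  "internal_nodes t = {p. \<exists>l r. subtree t p = Some (Node l r)}"

definition Nor :: "nat \<Rightarrow> btree set" where
  "Nor n = {t. distinct (leaf_labels t) \<and> set (leaf_labels t) = {1..n} \<and>
     (\<forall>p l r. subtree t p = Some (Node l r) \<longrightarrow> vmin (Node l r) = vmin l)}"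

definition lyndon_node :: "btree \<Rightarrow> dir list \<Rightarrow> bool" where
  "lyndon_node t p \<longleftrightarrow> (\<exists>l r. subtree t p = Some (Node l r) \<and>
     ((\<exists>a. l = Leaf a) \<or> (\<exists>ll lr. l = Node ll lr \<and> vmin lr > vmin r)))"

text \<open>
  Block sizes of the finest set partition of \<open>A\<close> (assumed finite) in which any two elements of
  \<open>A\<close> related by \<open>R\<close> are in the same block.
\<close>

definition block_sizes :: "'a set \<Rightarrow> ('a \<Rightarrow> 'a \<Rightarrow> bool) \<Rightarrow> nat multiset" where
  "block_sizes A R = image_mset card (mset_set
     (A // {(x, y). equivclp (\<lambda>x y. x \<in> A \<and> y \<in> A \<and> R x y) x y}))"

definition lambda_Lyn :: "btree \<Rightarrow> nat multiset" where
  "lambda_Lyn t =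
     block_sizes (internal_nodes t) (\<lambda>p q. \<not> lyndon_node t p \<and> q = p @ [GoL])"

definition lambda_Comb :: "btree \<Rightarrow> nat multiset" where
  "lambda_Comb t = block_sizes (internal_nodes t) (\<lambda>p q. q = p @ [GoR])"


section \<open>Stirling permutations\<close>

definition Stirling_perms :: "nat \<Rightarrow> nat list set" where
  "Stirling_perms m = {\<theta>. mset \<theta> = mset_set {1..m} + mset_set {1..m} \<and>
     (\<forall>i j k. i < k \<and> k < j \<and> j < length \<theta> \<and> \<theta> ! i = \<theta> ! j \<longrightarrow> \<theta> ! k > \<theta> ! i)}"

text \<open>For letters that occur exactly twice in \<open>\<theta>\<close>, the last occurrence is the second one.\<close>

definition first_occ :: "nat list \<Rightarrow> nat \<Rightarrow> nat" where
  "first_occ \<theta> a = Min {i. i < length \<theta> \<and> \<theta> ! i = a}"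

definition second_occ :: "nat list \<Rightarrow> nat \<Rightarrow> nat" where
  "second_occ \<theta> a = Max {i. i < length \<theta> \<and> \<theta> ! i = a}"

definition asc_adj_pair :: "nat list \<Rightarrow> nat \<Rightarrow> nat \<Rightarrow> bool" where
  "asc_adj_pair \<theta> a b \<longleftrightarrow>
     a \<in> set \<theta> \<and> b \<in> set \<theta> \<and> a < b \<and> first_occ \<theta> b = Suc (second_occ \<theta> a)"

definition term_nested_pair :: "nat list \<Rightarrow> nat \<Rightarrow> nat \<Rightarrow> bool" where
  "term_nested_pair \<theta> a b \<longleftrightarrow>
     a \<in> set \<theta> \<and> b \<in> set \<theta> \<and> a < b \<and> second_occ \<theta> a = Suc (second_occ \<theta> b)"

definition pair_seq :: "(nat list \<Rightarrow> nat \<Rightarrow> nat \<Rightarrow> bool) \<Rightarrow> nat list \<Rightarrow> nat list \<Rightarrow> bool" where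
  "pair_seq P \<theta> as \<longleftrightarrow> as \<noteq> [] \<and> set as \<subseteq> set \<theta> \<and> successively (P \<theta>) as"

definition max_pair_seq :: "(nat list \<Rightarrow> nat \<Rightarrow> nat \<Rightarrow> bool) \<Rightarrow> nat list \<Rightarrow> nat list \<Rightarrow> bool" where
  "max_pair_seq P \<theta> as \<longleftrightarrow>
     pair_seq P \<theta> as \<and> (\<forall>bs. pair_seq P \<theta> bs \<and> set as \<subseteq> set bs \<longrightarrow> bs = as)"

definition lambda_AA :: "nat list \<Rightarrow> nat multiset" where
  "lambda_AA \<theta> = image_mset length (mset_set {as. max_pair_seq asc_adj_pair \<theta> as})"

definition lambda_TN :: "nat list \<Rightarrow> nat multiset" where
  "lambda_TN \<theta> = image_mset length (mset_set {as. max_pair_seq term_nested_pair \<theta> as})"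

end

theory Submission
  imports Defs
begin

text \<open>
  Call a bracketed word a comb if in each bracket \<open>[s, t]\<^sub>j\<close> the minimum of \<open>s\<close> is smaller than that of
  \<open>t\<close> and the outermost bracket of \<open>t\<close>, if any, has a type smaller than \<open>j\<close>. The combs form a basis of the
  multilinear component. The Jacobi and compatibility relations rewrite \<open>[s, [t, u]\<^sub>k]\<^sub>j\<close> for \<open>j \<le> k\<close> and
  \<open>min s < min t < min u\<close>, and this terminates with combs, so combs span. The normal form of words
  induces brackets on the span of the combs. These satisfy the defining relations, whence
  combs are independent: the only ambiguities are \<open>[x, [y, [z, w]\<^sub>k]\<^sub>j]\<^sub>i\<close> with \<open>i \<le> j \<le> k\<close>, and the relation
  in question is reduced to smaller ones by the identity that expresses \<open>d\<^sup>2 = 0\<close> in the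
  Chevalley-Eilenberg complex. Types strictly decrease along the right chains of a comb, so the combs
  of shape \<open>\<Upsilon>\<close> are enumerated by the elementary symmetric function of \<open>lambda_Comb \<Upsilon>\<close>.

  Labelling each internal node of a normalized tree by the minimum of its right subtree and
  walking around the tree yields a Stirling permutation; this bijection turns the Lyndon type into the
  ascending adjacent type and the comb type into the terminally nested type.

  Finally, to compare the Lyndon and the comb type, let \<open>N\<^sub>s\<close> be the sum of the weights of the trees
  on a given set of labels for which the block of the root has size \<open>s\<close>, the factor \<open>e\<^sub>s\<close> of that block being omitted.
  For either type, the sum of \<open>e\<^sub>s\<^sub>-\<^sub>r N\<^sub>s\<close> over \<open>s \<ge> r\<close> is the sum over all partitions of the labels into
  \<open>r + 1\<close> blocks of the product of the total weights of the blocks. By induction on the number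
  of labels this determines \<open>N\<^sub>s\<close> for \<open>s \<ge> 1\<close>, starting with the greatest \<open>s\<close>, and hence the total weight.
\<close>

section \<open>Linear maps between spaces of formal linear combinations\<close>

text \<open>The ideal contains relations between arbitrary elements, over any field, whereas only
  multilinear words matter. Words with a repeated letter therefore get normal form 0: the relations
  hold trivially on them, and the normal form kills the whole ideal without any splitting by
  multidegree. The rewriting has integer coefficients, and Jacobi (equal types) is kept apart from
  compatibility (distinct types), since a common polarized form would cost a factor 2.

  Both tree types lead to the same sums over set partitions because of a cut: removing the first
  \<open>r\<close> nodes of a root chain of size \<open>s\<close> leaves \<open>r\<close> side trees
  and a bottom tree. The latter counts with its full weight: either the chain continues into it and
  \<open>e_(s-r)\<close> is the factor of its root block, or \<open>s = r\<close> and
  \<open>e_0 = 1\<close>. On a right chain normalization makes the minima of the side trees increase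
  downwards; on a left chain, being linked means precisely that they decrease. So the
  \<open>r + 1\<close> trees can be reassembled in one order only. No direct bijection between the
  two types is involved.\<close>

abbreviation word_vec :: "lie_word \<Rightarrow> (lie_word \<Rightarrow>\<^sub>0 'k::field)" where
  "word_vec w \<equiv> Poly_Mapping.single w 1"

abbreviation lin_map :: "(('v \<Rightarrow>\<^sub>0 'k::field) \<Rightarrow> ('w \<Rightarrow>\<^sub>0 'k)) \<Rightarrow> bool" where
  "lin_map \<equiv> Vector_Spaces.linear lin_scale lin_scale"

lemma lin_mapI:
  assumes "\<And>p q. f (p + q) = f p + f q" "\<And>c p. f (lin_scale c p) = lin_scale c (f p)"
  shows "lin_map f"
  by unfold_locales (use assms in \<open>auto simp: lin.scale_right_distrib lin.scale_left_distrib\<close>)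

lemma lin_map_add: "lin_map f \<Longrightarrow> f (p + q) = f p + f q"
  and lin_map_scale: "lin_map f \<Longrightarrow> f (lin_scale c p) = lin_scale c (f p)"
  by (simp_all add: Vector_Spaces.linear_iff)

lemma lin_map_hom: "lin_map f \<Longrightarrow> module_hom lin_scale lin_scale f"
  by (simp add: Vector_Spaces.linear_def)

lemmas lin_map_sum = module_hom.sum[OF lin_map_hom]
  and lin_map_0 = module_hom.zero[OF lin_map_hom]
  and lin_map_diff = module_hom.diff[OF lin_map_hom]

lemma lin_scale_single: "lin_scale c (Poly_Mapping.single w a) = Poly_Mapping.single w (c * a)"
  by (rule poly_mapping_eqI) (simp add: lookup_single when_def)

lemma lin_scale_minus_one: "lin_scale (- 1) p = - p"
  using lin.scale_minus_left[of 1 p] by simp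

lemma expand_on:
  fixes p :: "'w \<Rightarrow>\<^sub>0 'k::field"
  assumes "finite A" "Poly_Mapping.keys p \<subseteq> A"
  shows "p = (\<Sum>w\<in>A. lin_scale (Poly_Mapping.lookup p w) (Poly_Mapping.single w 1))"
proof (rule poly_mapping_eqI)
  fix v
  have "(\<Sum>w\<in>A. Poly_Mapping.lookup (lin_scale (Poly_Mapping.lookup p w) (Poly_Mapping.single w 1)) v)
      = (\<Sum>w\<in>A. if w = v then Poly_Mapping.lookup p v else 0)"
    by (rule sum.cong) (auto simp: lookup_single when_def)
  also have "\<dots> = Poly_Mapping.lookup p v"
    using assms by (auto simp: not_in_keys_iff_lookup_eq_zero subset_iff)
  finally show "Poly_Mapping.lookup p v
      = Poly_Mapping.lookup (\<Sum>w\<in>A. lin_scale (Poly_Mapping.lookup p w) (Poly_Mapping.single w 1)) v"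
    by (simp add: lookup_sum)
qed

lemmas expand = expand_on[OF finite_keys subset_refl]

lemma lin_map_eqI:
  fixes p :: "'w \<Rightarrow>\<^sub>0 'k::field"
  assumes "lin_map f" "lin_map g"
    and "\<And>w. w \<in> Poly_Mapping.keys p \<Longrightarrow> f (Poly_Mapping.single w 1) = g (Poly_Mapping.single w 1)"
  shows "f p = g p"
  by (subst (1 2) expand) (simp add: lin_map_sum lin_map_scale assms)

lemma lin_subspace_induct:
  fixes p :: "'w \<Rightarrow>\<^sub>0 'k::field"
  assumes "lin.subspace V" "\<And>w. w \<in> Poly_Mapping.keys p \<Longrightarrow> Poly_Mapping.single w 1 \<in> V"
  shows "p \<in> V"
  by (subst expand) (auto intro!: lin.subspace_sum lin.subspace_scale assms)

definition lin_ext :: "('v \<Rightarrow> ('w \<Rightarrow>\<^sub>0 'k::field)) \<Rightarrow> ('v \<Rightarrow>\<^sub>0 'k) \<Rightarrow> ('w \<Rightarrow>\<^sub>0 'k)" where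
  "lin_ext f p = (\<Sum>w\<in>Poly_Mapping.keys p. lin_scale (Poly_Mapping.lookup p w) (f w))"

text \<open>Cancellation may shrink the keys of a sum, so linearity is checked over a common finite
  superset of the keys.\<close>

lemma lin_ext_on:
  fixes p :: "'w \<Rightarrow>\<^sub>0 'k::field"
  assumes "finite A" "Poly_Mapping.keys p \<subseteq> A"
  shows "lin_ext f p = (\<Sum>w\<in>A. lin_scale (Poly_Mapping.lookup p w) (f w))"
  unfolding lin_ext_def using assms
  by (intro sum.mono_neutral_left) (auto simp: not_in_keys_iff_lookup_eq_zero)

lemma lin_map_lin_ext: "lin_map (lin_ext (f :: 'v \<Rightarrow> 'w \<Rightarrow>\<^sub>0 'k::field))"
proof (rule lin_mapI)
  fix p q :: "'v \<Rightarrow>\<^sub>0 'k" and c :: 'k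
  let ?A = "Poly_Mapping.keys p \<union> Poly_Mapping.keys q"
  have "Poly_Mapping.keys (p + q) \<subseteq> ?A"
    by (rule Poly_Mapping.keys_add)
  then show "lin_ext f (p + q) = lin_ext f p + lin_ext f q"
    by (simp add: lin_ext_on[of ?A] lookup_add lin.scale_left_distrib sum.distrib)
  have "Poly_Mapping.keys (lin_scale c p) \<subseteq> Poly_Mapping.keys p"
    by (auto simp: in_keys_iff)
  then show "lin_ext f (lin_scale c p) = lin_scale c (lin_ext f p)"
    by (simp add: lin_ext_on[of "Poly_Mapping.keys p"] lin.scale_sum_right)
qed

lemma lin_ext_single: "lin_ext f (Poly_Mapping.single w a) = lin_scale a (f w)"
  by (subst lin_ext_on[of "{w}"]) auto

lemma bracket_on:
  assumes "finite A" "finite C" "Poly_Mapping.keys p \<subseteq> A" "Poly_Mapping.keys q \<subseteq> C"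
  shows "bracket j p q = (\<Sum>s\<in>A. \<Sum>t\<in>C.
    Poly_Mapping.single (Brk j s t) (Poly_Mapping.lookup p s * Poly_Mapping.lookup q t))"
proof -
  have "bracket j p q = (\<Sum>s\<in>Poly_Mapping.keys p. \<Sum>t\<in>C.
    Poly_Mapping.single (Brk j s t) (Poly_Mapping.lookup p s * Poly_Mapping.lookup q t))"
    unfolding bracket_def using assms
    by (intro sum.cong sum.mono_neutral_left) (auto simp: not_in_keys_iff_lookup_eq_zero)
  also have "\<dots> = (\<Sum>s\<in>A. \<Sum>t\<in>C.
    Poly_Mapping.single (Brk j s t) (Poly_Mapping.lookup p s * Poly_Mapping.lookup q t))"
    using assms
    by (intro sum.mono_neutral_left) (auto simp: not_in_keys_iff_lookup_eq_zero)
  finally show ?thesis .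
qed

lemma lin_map_bracket_right: "lin_map (bracket j p)"
proof (rule lin_mapI)
  fix q r :: "lie_word \<Rightarrow>\<^sub>0 'a" and c :: 'a
  let ?A = "Poly_Mapping.keys q \<union> Poly_Mapping.keys r"
  have "Poly_Mapping.keys (q + r) \<subseteq> ?A"
    by (rule Poly_Mapping.keys_add)
  then show "bracket j p (q + r) = bracket j p q + bracket j p r"
    by (simp add: bracket_on[of "Poly_Mapping.keys p" ?A] lookup_add single_add ring_distribs sum.distrib)
  have "Poly_Mapping.keys (lin_scale c q) \<subseteq> Poly_Mapping.keys q"
    by (auto simp: in_keys_iff)
  then show "bracket j p (lin_scale c q) = lin_scale c (bracket j p q)"
    by (simp add: bracket_on[of "Poly_Mapping.keys p" "Poly_Mapping.keys q"] lin.scale_sum_right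
        lin_scale_single mult.left_commute)
qed

lemma lin_map_bracket_left: "lin_map (\<lambda>p. bracket j p q)"
proof (rule lin_mapI)
  fix p r :: "lie_word \<Rightarrow>\<^sub>0 'a" and c :: 'a
  let ?A = "Poly_Mapping.keys p \<union> Poly_Mapping.keys r"
  have "Poly_Mapping.keys (p + r) \<subseteq> ?A"
    by (rule Poly_Mapping.keys_add)
  then show "bracket j (p + r) q = bracket j p q + bracket j r q"
    by (simp add: bracket_on[of ?A "Poly_Mapping.keys q"] lookup_add single_add ring_distribs sum.distrib)
  have "Poly_Mapping.keys (lin_scale c p) \<subseteq> Poly_Mapping.keys p"
    by (auto simp: in_keys_iff)
  then show "bracket j (lin_scale c p) q = lin_scale c (bracket j p q)"
    by (simp add: bracket_on[of "Poly_Mapping.keys p" "Poly_Mapping.keys q"] lin.scale_sum_right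
        lin_scale_single mult.assoc)
qed

lemma bracket_single:
  "bracket j (Poly_Mapping.single s a) (Poly_Mapping.single t b) = Poly_Mapping.single (Brk j s t) (a * b)"
  by (subst bracket_on[of "{s}" "{t}"]) auto


section \<open>Combs and the normal form of a bracketed word\<close>

definition wmin :: "lie_word \<Rightarrow> nat" where
  "wmin w = Min (set (letters w))"

lemma letters_ne [simp]: "letters w \<noteq> []"
  by (induction w) auto

lemma wmin_Gen [simp]: "wmin (Gen a) = a"
  by (simp add: wmin_def)

lemma wmin_Brk [simp]: "wmin (Brk j s t) = min (wmin s) (wmin t)"
  by (simp add: wmin_def Min_Un)

lemma wmin_cong: "set (letters s) = set (letters t) \<Longrightarrow> wmin s = wmin t"
  by (simp add: wmin_def)

lemma wmin_in: "wmin w \<in> set (letters w)"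
  by (simp add: wmin_def)

lemma wmin_neq: "set (letters s) \<inter> set (letters t) = {} \<Longrightarrow> wmin s \<noteq> wmin t"
  by (metis disjoint_iff wmin_in)

fun root_below :: "nat \<Rightarrow> lie_word \<Rightarrow> bool" where
  "root_below j (Gen a) \<longleftrightarrow> True"
| "root_below j (Brk k s t) \<longleftrightarrow> k < j"

primrec comb :: "lie_word \<Rightarrow> bool" where
  "comb (Gen a) \<longleftrightarrow> True"
| "comb (Brk j s t) \<longleftrightarrow> comb s \<and> comb t \<and> set (letters s) \<inter> set (letters t) = {} \<and>
     wmin s < wmin t \<and> root_below j t"

text \<open>
  The relation for the types \<open>j \<le> k\<close>, solved for \<open>[s, [t, u]\<^sub>k]\<^sub>j\<close> and with the minima of its terms
  arranged by antisymmetry.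
\<close>

fun resolve :: "nat \<Rightarrow> lie_word \<Rightarrow> lie_word \<Rightarrow> (int \<times> lie_word) list" where
  "resolve j s (Gen b) = []"
| "resolve j s (Brk k t u) =
    (if j = k then [(1, Brk j (Brk j s t) u), (-1, Brk j (Brk j s u) t)]
     else [(-1, Brk k s (Brk j t u)), (1, Brk k (Brk j s t) u), (1, Brk j (Brk k s t) u),
           (-1, Brk k (Brk j s u) t), (-1, Brk j (Brk k s u) t)])"

text \<open>A fixed strategy, arguments before the root. The list stands for an integer combination,
  so one rewriting serves every field; the empty list for overlapping letters stands for 0.\<close>

primrec step :: "lie_word \<Rightarrow> (int \<times> lie_word) list" where
  "step (Gen a) = []"
| "step (Brk j s t) =
    (if \<not> comb s then map (\<lambda>(c, x). (c, Brk j x t)) (step s)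
     else if \<not> comb t then map (\<lambda>(c, x). (c, Brk j s x)) (step t)
     else if set (letters s) \<inter> set (letters t) \<noteq> {} then []
     else if wmin t < wmin s then [(-1, Brk j t s)]
     else resolve j s t)"

section \<open>Termination of the rewriting\<close>

primrec colsum :: "lie_word \<Rightarrow> nat" where
  "colsum (Gen a) = 0"
| "colsum (Brk j s t) = j + colsum s + colsum t"

primrec misordered :: "lie_word \<Rightarrow> nat" where
  "misordered (Gen a) = 0"
| "misordered (Brk j s t) = (if wmin t < wmin s then 1 else 0) + misordered s + misordered t"

primrec right_size :: "lie_word \<Rightarrow> nat" where
  "right_size (Gen a) = 0"
| "right_size (Brk j s t) = length (letters t) + right_size s + right_size t"

text \<open>Each node contributes its type times its depth, as \<open>colsum s + colsum t\<close>
  adds the type of a node once for every proper ancestor.\<close>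

primrec depth_sum :: "lie_word \<Rightarrow> nat" where
  "depth_sum (Gen a) = 0"
| "depth_sum (Brk j s t) = depth_sum s + depth_sum t + colsum s + colsum t"

lemma comb_distinct: "comb w \<Longrightarrow> distinct (letters w)"
  by (induction w) auto

lemma comb_misordered: "comb w \<Longrightarrow> misordered w = 0"
  by (induction w) auto

text \<open>The swap removes a misordered node, whatever it does to the sizes. Passing from
  \<open>[s, [t, u]]\<close> to \<open>[[s, t], u]\<close> or \<open>[[s, u], t]\<close> lowers
  \<open>right_size\<close> by the length of \<open>u\<close>. The remaining term
  \<open>[s, [t, u]_j]_k\<close> with \<open>j < k\<close> keeps the sizes, but lifts the larger
  type to the root.\<close>

definition smaller :: "lie_word \<Rightarrow> lie_word \<Rightarrow> bool" where
  "smaller x w \<longleftrightarrow> misordered x < misordered w \<or> misordered x = misordered w \<and>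
     (right_size x < right_size w \<or> right_size x = right_size w \<and> depth_sum x < depth_sum w)"

lemma resolve_props:
  assumes "(c, x) \<in> set (resolve j s t)" "comb s" "comb t" "wmin s < wmin t" "\<not> root_below j t"
  shows "mset (letters x) = mset (letters s) + mset (letters t)"
    "bracket_type x = bracket_type (Brk j s t)"
    "colsum x = colsum (Brk j s t)" "smaller x (Brk j s t)"
proof -
  obtain k t1 t2 where t: "t = Brk k t1 t2"
    using assms by (cases t) auto
  have "wmin s < wmin t1" "wmin t1 < wmin t2"
    using assms t by auto
  moreover have "misordered s = 0" "misordered t1 = 0" "misordered t2 = 0"
    using assms t by (auto simp: comb_misordered)
  moreover have "length (letters t1) > 0" "length (letters t2) > 0"
    by auto
  ultimately show "mset (letters x) = mset (letters s) + mset (letters t)"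
    "bracket_type x = bracket_type (Brk j s t)"
    "colsum x = colsum (Brk j s t)" "smaller x (Brk j s t)"
    using assms(1,5) unfolding t
    by (auto simp: smaller_def ac_simps split: if_splits)
qed

text \<open>The surroundings of a rewritten subword see only its minimum, its number of letters and
  its \<open>colsum\<close>. These being invariant, the decrease carries over to the whole
  word.\<close>

lemma step_props:
  assumes "(c, x) \<in> set (step w)" "\<not> comb w"
  shows "mset (letters x) = mset (letters w)" "bracket_type x = bracket_type w"
    "colsum x = colsum w" "smaller x w"
proof -
  have "mset (letters x) = mset (letters w) \<and> bracket_type x = bracket_type w \<and>
    colsum x = colsum w \<and> smaller x w" using assms
  proof (induction w arbitrary: x)
    case (Brk j s t)
    consider (left) "\<not> comb s" | (right) "comb s" "\<not> comb t"
      | (ov) "comb s" "comb t" "set (letters s) \<inter> set (letters t) \<noteq> {}"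
      | (swap) "comb s" "comb t" "set (letters s) \<inter> set (letters t) = {}" "wmin t < wmin s"
      | (res) "comb s" "comb t" "set (letters s) \<inter> set (letters t) = {}" "\<not> wmin t < wmin s"
      by blast
    then show ?case
    proof cases
      case left
      then obtain y where y: "x = Brk j y t" "(c, y) \<in> set (step s)"
        using Brk.prems by auto
      from Brk.IH(1)[OF y(2) left]
      have *: "mset (letters y) = mset (letters s)" "bracket_type y = bracket_type s"
        "colsum y = colsum s" "smaller y s" by auto
      have "set (letters y) = set (letters s)" "length (letters y) = length (letters s)"
        using *(1) by (metis mset_eq_setD, metis mset_eq_length)
      with * wmin_cong[OF this(1)] show ?thesis unfolding y(1) by (auto simp: smaller_def)
    next
      case right
      then obtain y where y: "x = Brk j s y" "(c, y) \<in> set (step t)"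
        using Brk.prems by auto
      from Brk.IH(2)[OF y(2) right(2)]
      have *: "mset (letters y) = mset (letters t)" "bracket_type y = bracket_type t"
        "colsum y = colsum t" "smaller y t" by auto
      have "set (letters y) = set (letters t)" "length (letters y) = length (letters t)"
        using *(1) by (metis mset_eq_setD, metis mset_eq_length)
      with * wmin_cong[OF this(1)] show ?thesis unfolding y(1) by (auto simp: smaller_def)
    next
      case ov
      then show ?thesis using Brk.prems by auto
    next
      case swap
      then show ?thesis using Brk.prems by (auto simp: smaller_def comb_misordered ac_simps)
    next
      case res
      have "wmin s \<noteq> wmin t"
        using res(3) by (rule wmin_neq)
      with res have lt: "wmin s < wmin t" by auto
      with res Brk.prems have "\<not> root_below j t" by auto
      moreover have "(c, x) \<in> set (resolve j s t)" using res Brk.prems by auto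
      ultimately show ?thesis
        using resolve_props[of c x j s t] res lt by simp
    qed
  qed auto
  then show "mset (letters x) = mset (letters w)" "bracket_type x = bracket_type w"
    "colsum x = colsum w" "smaller x w" by auto
qed

lemma wf_smaller: "wf {(x, w). smaller x w}"
proof -
  have "{(x, w). smaller x w} = inv_image (less_than <*lex*> less_than <*lex*> less_than)
    (\<lambda>w. (misordered w, right_size w, depth_sum w))"
    by (auto simp: smaller_def)
  then show ?thesis by (simp add: wf_inv_image wf_lex_prod)
qed

text \<open>As \<open>step\<close> fixes the strategy, the definition presupposes no confluence;
  what confluence would provide comes later from \<open>comb_jacobi\<close>.\<close>

function nf :: "lie_word \<Rightarrow> (lie_word \<Rightarrow>\<^sub>0 'k::field)" where
  "nf w = (if comb w then Poly_Mapping.single w 1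
           else (\<Sum>(c, x)\<leftarrow>step w. lin_scale (of_int c) (nf x)))"
  by auto
termination
  by (relation "{(x, w). smaller x w}") (auto simp: wf_smaller step_props(4))

declare nf.simps [simp del]

lemma nf_comb: "comb w \<Longrightarrow> nf w = Poly_Mapping.single w 1"
  by (simp add: nf.simps)

lemma nf_step: "\<not> comb w \<Longrightarrow> nf w = (\<Sum>(c, x)\<leftarrow>step w. lin_scale (of_int c) (nf x))"
  by (subst nf.simps) simp

lemma keys_lin_ext: "v \<in> Poly_Mapping.keys (lin_ext f p) \<Longrightarrow> \<exists>w\<in>Poly_Mapping.keys p. v \<in> Poly_Mapping.keys (f w)"
  unfolding lin_ext_def
  by (rule ccontr) (auto simp: in_keys_iff lookup_sum)

lemma nf_keys:
  assumes "v \<in> Poly_Mapping.keys (nf w :: lie_word \<Rightarrow>\<^sub>0 'k::field)"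
  shows "comb v" "mset (letters v) = mset (letters w)" "bracket_type v = bracket_type w" "colsum v = colsum w"
proof -
  let ?P = "\<lambda>v w. comb v \<and> mset (letters v) = mset (letters w) \<and>
    bracket_type v = bracket_type w \<and> colsum v = colsum w"
  have "\<forall>v\<in>Poly_Mapping.keys (nf w :: lie_word \<Rightarrow>\<^sub>0 'k). ?P v w"
  proof (induction w rule: wf_induct_rule[OF wf_smaller])
    case (1 w)
    show ?case
    proof (cases "comb w")
      case False
      have sub: "v \<in> Poly_Mapping.keys (\<Sum>(c, x)\<leftarrow>xs. lin_scale (of_int c) (nf x :: lie_word \<Rightarrow>\<^sub>0 'k)) \<Longrightarrow>
        \<exists>(c, x)\<in>set xs. v \<in> Poly_Mapping.keys (nf x :: lie_word \<Rightarrow>\<^sub>0 'k)" for v xs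
        by (induction xs) (auto simp: in_keys_iff lookup_add)
      show ?thesis
      proof
        fix v assume "v \<in> Poly_Mapping.keys (nf w :: lie_word \<Rightarrow>\<^sub>0 'k)"
        then obtain c x where cx: "(c, x) \<in> set (step w)" "v \<in> Poly_Mapping.keys (nf x :: lie_word \<Rightarrow>\<^sub>0 'k)"
          using sub[of v "step w"] nf_step[OF False, where 'a='k] by auto
        with 1 step_props[OF cx(1) False] show "?P v w" by auto
      qed
    qed (simp add: nf_comb)
  qed
  with assms show "comb v" "mset (letters v) = mset (letters w)" "bracket_type v = bracket_type w"
    "colsum v = colsum w" by auto
qed

text \<open>Steps preserve the multiset of letters, and the letters of a comb are distinct, so no
  comb can occur.\<close>

lemma nf_0: "\<not> distinct (letters w) \<Longrightarrow> nf w = 0"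
  using comb_distinct nf_keys(1,2)[of _ w] mset_eq_imp_distinct_iff
  by (metis ex_in_conv keys_eq_empty)

section \<open>Brackets on the span of the combs\<close>

definition nfl :: "(lie_word \<Rightarrow>\<^sub>0 'k::field) \<Rightarrow> (lie_word \<Rightarrow>\<^sub>0 'k)" where
  "nfl = lin_ext nf"

definition cbr :: "nat \<Rightarrow> (lie_word \<Rightarrow>\<^sub>0 'k::field) \<Rightarrow> (lie_word \<Rightarrow>\<^sub>0 'k) \<Rightarrow> (lie_word \<Rightarrow>\<^sub>0 'k)" where
  "cbr j p q = nfl (bracket j p q)"

lemma lin_map_nfl: "lin_map nfl"
  by (simp add: nfl_def lin_map_lin_ext)

lemma nfl_word [simp]: "nfl (word_vec w) = nf w"
  by (simp add: nfl_def lin_ext_single)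

lemma lin_map_cbr_right: "lin_map (cbr j p)"
  by (rule lin_mapI) (simp_all add: cbr_def lin_map_add[OF lin_map_bracket_right] lin_map_scale[OF lin_map_bracket_right]
      lin_map_add[OF lin_map_nfl] lin_map_scale[OF lin_map_nfl])

lemma lin_map_cbr_left: "lin_map (\<lambda>p. cbr j p q)"
  by (rule lin_mapI) (simp_all add: cbr_def lin_map_add[OF lin_map_bracket_left] lin_map_scale[OF lin_map_bracket_left]
      lin_map_add[OF lin_map_nfl] lin_map_scale[OF lin_map_nfl])

lemma cbr_word: "cbr j (word_vec s) (word_vec t) = nf (Brk j s t)"
  by (simp add: cbr_def bracket_single)

lemma lin_map_sum_list:
  assumes "lin_map f"
  shows "f (\<Sum>(c, x)\<leftarrow>xs. lin_scale (g c) (h x)) = (\<Sum>(c, x)\<leftarrow>xs. lin_scale (g c) (f (h x)))"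
  by (induction xs) (auto simp: lin_map_0[OF assms] lin_map_add[OF assms] lin_map_scale[OF assms])

text \<open>\<open>step\<close> exhausts the left argument, then the right one, before it touches
  the root, so the reduction of a bracket passes through the reductions of its arguments.\<close>

lemma nf_Brk: "(nf (Brk j s t) :: lie_word \<Rightarrow>\<^sub>0 'k::field) = cbr j (nf s) (nf t)"
proof -
  have "\<forall>j s t. w = Brk j s t \<longrightarrow> (nf w :: lie_word \<Rightarrow>\<^sub>0 'k) = cbr j (nf s) (nf t)" for w
  proof (induction w rule: wf_induct_rule[OF wf_smaller])
    case (1 w)
    have IH: "(nf (Brk j s t) :: lie_word \<Rightarrow>\<^sub>0 'k) = cbr j (nf s) (nf t)" if "smaller (Brk j s t) w" for j s t
      using 1 that by auto
    show ?case
    proof (intro allI impI)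
      fix j s t assume w: "w = Brk j s t"
      consider "comb s" "comb t" | "\<not> comb s" | "comb s" "\<not> comb t" by blast
      then show "(nf w :: lie_word \<Rightarrow>\<^sub>0 'k) = cbr j (nf s) (nf t)"
      proof cases
        case 1
        then show ?thesis by (simp add: w nf_comb cbr_word)
      next
        case 2
        have "(nf w :: lie_word \<Rightarrow>\<^sub>0 'k) = (\<Sum>(c, x)\<leftarrow>step s. lin_scale (of_int c) (nf (Brk j x t)))"
          using 2 by (simp add: w nf_step[of "Brk j s t"] comp_def case_prod_unfold)
        also have "\<dots> = (\<Sum>(c, x)\<leftarrow>step s. lin_scale (of_int c) (cbr j (nf x) (nf t)))"
        proof -
          have "(nf (Brk j x t) :: lie_word \<Rightarrow>\<^sub>0 'k) = cbr j (nf x) (nf t)" if "(c, x) \<in> set (step s)" for c x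
            using 2 that by (intro IH) (auto simp: w intro!: step_props(4))
          then show ?thesis by (intro arg_cong[where f = sum_list] map_cong) auto
        qed
        also have "\<dots> = cbr j (nf s) (nf t)"
          by (subst nf_step[OF 2]) (rule lin_map_sum_list[OF lin_map_cbr_left, symmetric])
        finally show ?thesis .
      next
        case 3
        have "(nf w :: lie_word \<Rightarrow>\<^sub>0 'k) = (\<Sum>(c, x)\<leftarrow>step t. lin_scale (of_int c) (nf (Brk j s x)))"
          using 3 by (simp add: w nf_step[of "Brk j s t"] comp_def case_prod_unfold)
        also have "\<dots> = (\<Sum>(c, x)\<leftarrow>step t. lin_scale (of_int c) (cbr j (nf s) (nf x)))"
        proof -
          have "(nf (Brk j s x) :: lie_word \<Rightarrow>\<^sub>0 'k) = cbr j (nf s) (nf x)" if "(c, x) \<in> set (step t)" for c x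
            using 3 that by (intro IH) (auto simp: w intro!: step_props(4))
          then show ?thesis by (intro arg_cong[where f = sum_list] map_cong) auto
        qed
        also have "\<dots> = cbr j (nf s) (nf t)"
          by (subst nf_step[OF 3(2)]) (rule lin_map_sum_list[OF lin_map_cbr_right, symmetric])
        finally show ?thesis .
      qed
    qed
  qed
  then show ?thesis by auto
qed

lemma nfl_bracket: "nfl (bracket j p q) = cbr j (nfl p) (nfl q)"
proof -
  have 1: "lin_map (\<lambda>p. nfl (bracket j p q))" for q
    using lin_map_cbr_left unfolding cbr_def .
  have 2: "lin_map (\<lambda>q. nfl (bracket j p q))" for p
    using lin_map_cbr_right unfolding cbr_def .
  have 3: "lin_map (\<lambda>p. cbr j (nfl p) q)" for q
    by (rule lin_mapI) (simp_all add: lin_map_add[OF lin_map_nfl] lin_map_scale[OF lin_map_nfl]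
        lin_map_add[OF lin_map_cbr_left] lin_map_scale[OF lin_map_cbr_left])
  have 4: "lin_map (\<lambda>q. cbr j p (nfl q))" for p
    by (rule lin_mapI) (simp_all add: lin_map_add[OF lin_map_nfl] lin_map_scale[OF lin_map_nfl]
        lin_map_add[OF lin_map_cbr_right] lin_map_scale[OF lin_map_cbr_right])
  show ?thesis
  proof (rule lin_map_eqI[OF 1 3])
    fix s
    show "nfl (bracket j (word_vec s) q) = cbr j (nfl (word_vec s)) (nfl q)"
      by (rule lin_map_eqI[OF 2 4]) (simp add: bracket_single nf_Brk)
  qed
qed

text \<open>With a common letter both sides are 0 by \<open>nf_0\<close>. Otherwise exactly one of
  the two words is misordered at its root, and its first step is the swap with coefficient
  -1.\<close>

lemma nf_comb_antisym:
  assumes "comb s" "comb t"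
  shows "(nf (Brk j s t) :: lie_word \<Rightarrow>\<^sub>0 'k::field) = - nf (Brk j t s)"
proof -
  have *: "(nf (Brk j t s) :: lie_word \<Rightarrow>\<^sub>0 'k) = - nf (Brk j s t)"
    if "comb s" "comb t" "wmin s < wmin t" "set (letters s) \<inter> set (letters t) = {}" for s t
    using that by (subst nf_step) (auto simp: lin_scale_minus_one)
  show ?thesis
  proof (cases "set (letters s) \<inter> set (letters t) = {}")
    case True
    then show ?thesis
      using assms *[of s t] *[of t s] wmin_neq[OF True] by (cases "wmin s < wmin t") (auto simp: Int_commute)
  qed (auto simp: nf_0 Int_commute)
qed

lemma cbr_antisym: "cbr j p q = - cbr j q (p :: lie_word \<Rightarrow>\<^sub>0 'k::field)"
proof -
  have n1: "lin_map (\<lambda>p. - cbr j q p)" for q :: "lie_word \<Rightarrow>\<^sub>0 'k"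
    by (rule lin_mapI) (simp_all add: lin_map_add[OF lin_map_cbr_right] lin_map_scale[OF lin_map_cbr_right])
  have n2: "lin_map (\<lambda>q. - cbr j q p)" for p :: "lie_word \<Rightarrow>\<^sub>0 'k"
    by (rule lin_mapI) (simp_all add: lin_map_add[OF lin_map_cbr_left] lin_map_scale[OF lin_map_cbr_left])
  have *: "(nf (Brk j s t) :: lie_word \<Rightarrow>\<^sub>0 'k) = - nf (Brk j t s)" for s t
    unfolding nf_Brk
  proof (rule lin_map_eqI[OF lin_map_cbr_left n1])
    fix v assume v: "v \<in> Poly_Mapping.keys (nf s :: lie_word \<Rightarrow>\<^sub>0 'k)"
    show "cbr j (word_vec v) (nf t) = - cbr j (nf t :: lie_word \<Rightarrow>\<^sub>0 'k) (word_vec v)"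
      by (rule lin_map_eqI[OF lin_map_cbr_right n2], unfold cbr_word, rule nf_comb_antisym)
        (use v nf_keys(1) in blast)+
  qed
  show ?thesis
    by (rule lin_map_eqI[OF lin_map_cbr_left n1], rule lin_map_eqI[OF lin_map_cbr_right n2])
       (simp only: cbr_word, rule *)
qed

section \<open>The Jacobi and compatibility identities for combs\<close>

locale antisym_brackets =
  fixes b :: "nat \<Rightarrow> 'v::ab_group_add \<Rightarrow> 'v \<Rightarrow> 'v"
  assumes add_left: "b j (x + y) z = b j x z + b j y z"
    and add_right: "b j x (y + z) = b j x y + b j x z"
    and antisym: "b j x y = - b j y x"
begin

definition cyc :: "nat \<Rightarrow> nat \<Rightarrow> 'v \<Rightarrow> 'v \<Rightarrow> 'v \<Rightarrow> 'v" where
  "cyc p q x y z = b p x (b q y z) + b p y (b q z x) + b p z (b q x y)"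

text \<open>The relation for the types \<open>p\<close>, \<open>q\<close>. For \<open>p = q\<close>
  the second formula would be twice \<open>cyc p p\<close>, which says nothing in characteristic
  2.\<close>

definition jac :: "nat \<Rightarrow> nat \<Rightarrow> 'v \<Rightarrow> 'v \<Rightarrow> 'v \<Rightarrow> 'v" where
  "jac p q x y z = (if p = q then cyc p p x y z else cyc p q x y z + cyc q p x y z)"

lemma zero_right [simp]: "b j x 0 = 0"
  using add_right[of j x 0 0] by simp

lemma zero_left [simp]: "b j 0 x = 0"
  using add_left[of j 0 0 x] by simp

lemma neg_right: "b j x (- y) = - b j x y"
  using add_right[of j x y "- y"] minus_unique[of "b j x y" "b j x (- y)"] by simp

lemma diff_right: "b j x (y - z) = b j x y - b j x z"
  using add_right[of j x y "- z"] by (simp add: neg_right)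

lemma cyc_rot: "cyc p q y z x = cyc p q x y z"
  unfolding cyc_def by (simp only: ac_simps)

lemma cyc_swap: "cyc p q y x z = - cyc p q x y z"
  by (simp add: cyc_def neg_right antisym[of q x z] antisym[of q z y] antisym[of q y x])

lemma jac_rot: "jac p q y z x = jac p q x y z"
  by (simp add: jac_def cyc_def ac_simps)

lemma jac_swap: "jac p q y x z = - jac p q x y z"
  by (simp add: jac_def cyc_swap[of _ _ y x z])

lemma jac_sym: "jac p q x y z = jac q p x y z"
  by (simp add: jac_def add.commute)

text \<open>
  The identity that corresponds to \<open>d\<^sup>2 = 0\<close> in the Chevalley-Eilenberg complex of \<open>x \<and> y \<and> z \<and> w\<close>,
  polarized in the types of the brackets. Brackets \<open>[[\<cdot>, \<cdot>], [\<cdot>, \<cdot>]]\<close> do not cancel for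
  fixed \<open>p\<close>, \<open>q\<close>, \<open>r\<close>, but only after exchanging \<open>q\<close> and \<open>r\<close>.
\<close>

definition ce :: "nat \<Rightarrow> nat \<Rightarrow> nat \<Rightarrow> 'v \<Rightarrow> 'v \<Rightarrow> 'v \<Rightarrow> 'v \<Rightarrow> 'v" where
  "ce p q r x y z w =
     cyc p q (b r x y) z w - cyc p q (b r x z) y w + cyc p q (b r x w) y z +
     cyc p q (b r y z) x w - cyc p q (b r y w) x z + cyc p q (b r z w) x y -
     (b p x (cyc q r y z w) - b p y (cyc q r x z w) + b p z (cyc q r x y w) - b p w (cyc q r x y z))"

lemma ce_expand:
  "ce p q r x y z w =
     (b p (b r x y) (b q z w) - b p (b r x z) (b q y w) + b p (b r x w) (b q y z)) +
     (b p (b r y z) (b q x w) - b p (b r y w) (b q x z) + b p (b r z w) (b q x y))"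
proof -
  have n: "b q s t = - b q t s" "b r w y = - b r y w" "b r z x = - b r x z" "b r w x = - b r x w"
    for s t q
    by (rule antisym)+
  note a = n(1)[of q "b r x y"] n(1)[of q "b r x z"] n(1)[of q "b r x w"] n(1)[of q "b r y z"]
    n(1)[of q "b r y w"] n(1)[of q "b r z w"]
  show ?thesis
    unfolding ce_def cyc_def by (simp add: add_right neg_right diff_right a n(2-) algebra_simps)
qed

lemma ce_antisym: "ce p q r x y z w + ce p r q x y z w = 0"
  unfolding ce_expand
  by (simp add: antisym[of p "b r x y" "b q z w"] antisym[of p "b r x z" "b q y w"]
      antisym[of p "b r x w" "b q y z"] antisym[of p "b r y z" "b q x w"]
      antisym[of p "b r y w" "b q x z"] antisym[of p "b r z w" "b q x y"])

text \<open>\<open>ce_antisym\<close> gives only twice this identity. For equal inner types the six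
  terms already cancel in complementary pairs.\<close>

lemma ce_same: "ce p q q x y z w = 0"
  unfolding ce_expand
  by (simp add: antisym[of p "b q x y" "b q z w"] antisym[of p "b q x z" "b q y w"] antisym[of p "b q x w" "b q y z"])

lemma jac_zero_iff: "jac p q x y z = 0 \<longleftrightarrow> (if p = q then cyc p p x y z = 0 else cyc p q x y z = - cyc q p x y z)"
  by (simp add: jac_def eq_neg_iff_add_eq_0)

text \<open>
  In the identity for the types \<open>i \<le> j \<le> k\<close>, only the terms with an inner bracket \<open>[z, w]\<close>
  remain, and those in which its type is smaller than \<open>k\<close> vanish as well.
\<close>

lemma jac_critical:
  assumes "i \<le> j" "j \<le> k"
    and f: "\<And>p q r. jac p q (b r x y) z w = 0" "\<And>p q r. jac p q (b r x z) y w = 0"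
      "\<And>p q r. jac p q (b r x w) y z = 0" "\<And>p q r. jac p q x (b r y z) w = 0"
      "\<And>p q r. jac p q x (b r y w) z = 0"
    and g: "\<And>p q. jac p q y z w = 0" "\<And>p q. jac p q x z w = 0" "\<And>p q. jac p q x y w = 0"
      "\<And>p q. jac p q x y z = 0"
    and low: "\<And>p q r. r < k \<Longrightarrow> jac p q x y (b r z w) = 0"
  shows "jac i j x y (b k z w) = 0"
proof -
  \<comment> \<open>\<open>Z\<close> holds the terms of interest, \<open>F\<close> and
    \<open>H\<close> the rest of \<open>ce\<close>. By the assumed instances \<open>F\<close> is
    antisymmetric in \<open>p\<close>, \<open>q\<close> and \<open>H\<close> in \<open>q\<close>,
    \<open>r\<close>; as \<open>ce\<close> is antisymmetric in \<open>q\<close>, \<open>r\<close>,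
    so is \<open>Z + F\<close>.\<close>
  define Z where "Z p q r = cyc p q x y (b r z w)" for p q r
  define F where "F p q r = cyc p q (b r x y) z w - cyc p q (b r x z) y w + cyc p q (b r x w) y z -
     cyc p q x (b r y z) w + cyc p q x (b r y w) z" for p q r
  define H where "H p q r = b p x (cyc q r y z w) - b p y (cyc q r x z w) + b p z (cyc q r x y w) -
     b p w (cyc q r x y z)" for p q r
  note f' = f[unfolded jac_zero_iff] and g' = g[unfolded jac_zero_iff]
  have ce: "ce p q r x y z w = Z p q r + F p q r - H p q r" for p q r
    using cyc_rot[of p q "b r z w" x y] cyc_rot[of p q y "b r z w" x] cyc_swap[of p q x "b r y z" w] cyc_swap[of p q x "b r y w" z]
    by (simp add: ce_def Z_def F_def H_def)
  have F: "F p q r = - F q p r" if "p \<noteq> q" for p q r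
    using f'(1)[of p q r] f'(2)[of p q r] f'(3)[of p q r] f'(4)[of p q r] f'(5)[of p q r] that
    by (simp add: F_def)
  have F0: "F p p r = 0" for p r
    using f'(1)[of p p r] f'(2)[of p p r] f'(3)[of p p r] f'(4)[of p p r] f'(5)[of p p r]
    by (simp add: F_def)
  have H: "H p q r = - H p r q" if "q \<noteq> r" for p q r
    using g'(1)[of q r] g'(2)[of q r] g'(3)[of q r] g'(4)[of q r] that
    by (simp add: H_def neg_right)
  have H0: "H p q q = 0" for p q
    using g'(1)[of q q] g'(2)[of q q] g'(3)[of q q] g'(4)[of q q]
    by (simp add: H_def)
  have Z: "(Z p q r + F p q r) + (Z p r q + F p r q) = 0" if "q \<noteq> r" for p q r
    using ce_antisym[of p q r x y z w] H[OF that, of p] by (simp add: ce algebra_simps)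
  have Z0: "Z p q q + F p q q = 0" for p q
    using ce_same[of p q x y z w] H0[of p q] by (simp add: ce)
  have low': "Z p q r = - Z q p r" if "r < k" "p \<noteq> q" for p q r
    using low[OF that(1), of p q] that(2) by (simp add: Z_def jac_zero_iff)
  have low0: "Z p p r = 0" if "r < k" for p r
    using low[OF that(1), of p p] by (simp add: Z_def jac_zero_iff)
  \<comment> \<open>For three distinct types the relations for the three unordered pairs
    \<open>q\<close>, \<open>r\<close> are added: \<open>F\<close> cancels in pairs, and so does
    \<open>Z\<close> with last type \<open>i\<close> or \<open>j\<close>, which leaves
    \<open>Z i j k + Z j i k\<close>. With repeated types this sum would count terms twice, so
    \<open>Z0\<close>, \<open>F0\<close> and \<open>low0\<close> take over.\<close>
  consider "i = j" "j = k" | "i = j" "j < k" | "i < j" "j = k" | "i < j" "j < k"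
    using assms(1,2) by linarith
  then show ?thesis
  proof cases
    case 1
    then show ?thesis using Z0[of i i] F0[of i i] by (simp add: jac_def Z_def)
  next
    case 2
    have "Z k i i = - F k i i"
      using Z0[of k i] by (simp add: eq_neg_iff_add_eq_0)
    then have "Z i i k = 0"
      using Z[of i k i] F0[of i k] F[of i k i] low'[of i i k] 2 by simp
    then show ?thesis using 2 by (simp add: jac_def Z_def)
  next
    case 3
    have "Z i k k = - F i k k"
      using Z0[of i k] by (simp add: eq_neg_iff_add_eq_0)
    then have "Z i k k + Z k i k = 0"
      using Z[of i k k] F0[of k i] F[of k i k] low0[of i k] 3 by simp
    then show ?thesis using 3 by (simp add: jac_def Z_def)
  next
    case 4
    have "((Z i j k + F i j k) + (Z i k j + F i k j)) + ((Z j i k + F j i k) + (Z j k i + F j k i)) +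
        ((Z k i j + F k i j) + (Z k j i + F k j i)) = 0"
      using Z[of j k i] Z[of i k j] Z[of i j k] 4 by simp
    then show ?thesis
      using F[of j i k] F[of k i j] F[of k j i] low'[of j k i] low'[of i k j] 4
      by (simp add: jac_def Z_def[of i j k] Z_def[of j i k])
  qed
qed

end

global_interpretation cb: antisym_brackets "cbr :: nat \<Rightarrow> (lie_word \<Rightarrow>\<^sub>0 'k::field) \<Rightarrow> _"
  by unfold_locales (simp_all add: lin_map_add[OF lin_map_cbr_left] lin_map_add[OF lin_map_cbr_right], rule cbr_antisym)

lemma jac_lift:
  fixes p q r :: "lie_word \<Rightarrow>\<^sub>0 'k::field"
  assumes "\<And>s t u. s \<in> Poly_Mapping.keys p \<Longrightarrow> t \<in> Poly_Mapping.keys q \<Longrightarrow> u \<in> Poly_Mapping.keys r \<Longrightarrow>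
    cb.jac i j (word_vec s) (word_vec t) (word_vec u) = (0 :: lie_word \<Rightarrow>\<^sub>0 'k)"
  shows "cb.jac i j p q r = 0"
proof -
  note scale = lin_map_scale[OF lin_map_cbr_left] lin_map_scale[OF lin_map_cbr_right]
  have "lin.subspace {p. cb.jac i j p q r = 0}" "lin.subspace {q. cb.jac i j p q r = 0}"
    "lin.subspace {r. cb.jac i j p q r = 0}" for p q r :: "lie_word \<Rightarrow>\<^sub>0 'k"
  proof -
    have 1: "cb.jac i j (p + p') q r = cb.jac i j p q r + cb.jac i j p' q r"
      "cb.jac i j p (q + q') r = cb.jac i j p q r + cb.jac i j p q' r"
      "cb.jac i j p q (r + r') = cb.jac i j p q r + cb.jac i j p q r'" for p q r p' q' r' :: "lie_word \<Rightarrow>\<^sub>0 'k"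
      by (simp_all add: cb.jac_def cb.cyc_def cb.add_left cb.add_right ac_simps)
    have 2: "cb.jac i j (lin_scale c p) q r = lin_scale c (cb.jac i j p q r)"
      "cb.jac i j p (lin_scale c q) r = lin_scale c (cb.jac i j p q r)"
      "cb.jac i j p q (lin_scale c r) = lin_scale c (cb.jac i j p q r)" for c and p q r :: "lie_word \<Rightarrow>\<^sub>0 'k"
      by (simp_all add: cb.jac_def cb.cyc_def scale lin.scale_right_distrib)
    have 3: "cb.jac i j 0 q r = 0" "cb.jac i j p 0 r = 0" "cb.jac i j p q 0 = 0" for p q r :: "lie_word \<Rightarrow>\<^sub>0 'k"
      by (simp_all add: cb.jac_def cb.cyc_def)
    show "lin.subspace {p. cb.jac i j p q r = 0}" "lin.subspace {q. cb.jac i j p q r = 0}"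
      "lin.subspace {r. cb.jac i j p q r = 0}"
      by (auto simp: lin.subspace_def 1 2 3)
  qed
  note sub = this
  have "cb.jac i j (word_vec s) (word_vec t) r = 0" if "s \<in> Poly_Mapping.keys p" "t \<in> Poly_Mapping.keys q" for s t
    using lin_subspace_induct[OF sub(3), of r "word_vec s" "word_vec t"] assms that by auto
  then have "cb.jac i j (word_vec s) q r = 0" if "s \<in> Poly_Mapping.keys p" for s
    using lin_subspace_induct[OF sub(2), of q "word_vec s" r] that by auto
  then show ?thesis
    using lin_subspace_induct[OF sub(1), of p q r] by auto
qed

text \<open>Here \<open>[t, u]_j\<close> is a comb, so \<open>[s, [t, u]_j]_i\<close> is reducible
  only at its root, and the step made there is the relation itself, solved for this term.\<close>

lemma comb_jacobi_resolved:
  fixes s t u :: lie_word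
  assumes "comb s" "comb (Brk j t u)" "set (letters s) \<inter> set (letters (Brk j t u)) = {}" "wmin s < wmin t"
    and "i \<le> j"
  shows "cb.jac i j (word_vec s) (word_vec t) (word_vec u) = (0 :: lie_word \<Rightarrow>\<^sub>0 'k::field)"
proof -
  have c: "comb t" "comb u" "wmin s < min (wmin t) (wmin u)" "\<not> min (wmin t) (wmin u) < wmin s"
    using assms by auto
  have n: "nf (Brk j t u) = (word_vec (Brk j t u) :: lie_word \<Rightarrow>\<^sub>0 'k)"
    using assms by (simp add: nf_comb)
  have B: "nf (Brk p (Brk q x y) z) = cbr p (cbr q (word_vec x) (word_vec y)) (word_vec z :: lie_word \<Rightarrow>\<^sub>0 'k)"
    "nf (Brk p z (Brk q x y)) = cbr p (word_vec z) (cbr q (word_vec x) (word_vec y) :: lie_word \<Rightarrow>\<^sub>0 'k)"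
    if "comb x" "comb y" "comb z" for p q x y z
    using that by (simp_all add: nf_Brk nf_comb)
  have cyc: "cb.cyc p q (word_vec s) (word_vec t) (word_vec u) =
      cbr p (word_vec s) (cbr q (word_vec t) (word_vec u)) + cbr p (cbr q (word_vec s) (word_vec u)) (word_vec t) -
      cbr p (cbr q (word_vec s) (word_vec t)) (word_vec u :: lie_word \<Rightarrow>\<^sub>0 'k)" for p q
    using cb.antisym[of q "word_vec u" "word_vec s :: lie_word \<Rightarrow>\<^sub>0 'k"]
      cb.antisym[of p "word_vec t" "cbr q (word_vec s) (word_vec u) :: lie_word \<Rightarrow>\<^sub>0 'k"]
      cb.antisym[of p "word_vec u" "cbr q (word_vec s) (word_vec t) :: lie_word \<Rightarrow>\<^sub>0 'k"]
    by (simp add: cb.cyc_def cb.neg_right)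
  have "cbr i (word_vec s) (cbr j (word_vec t) (word_vec u)) = (nf (Brk i s (Brk j t u)) :: lie_word \<Rightarrow>\<^sub>0 'k)"
    using c assms B by simp
  also have "\<dots> = (\<Sum>(c, x)\<leftarrow>resolve i s (Brk j t u). lin_scale (of_int c) (nf x))"
    using c assms by (subst nf_step) auto
  finally show ?thesis
    using c assms(1,5) by (auto simp: cb.jac_def cyc B lin_scale_minus_one split: if_splits)
qed

text \<open>By symmetry \<open>i \<le> j\<close>. If \<open>[t, u]_j\<close> fails to be a comb,
  then \<open>u = [u1, u2]_k\<close> with \<open>j \<le> k\<close>, and \<open>jac_critical\<close>
  for \<open>s, t, u1, u2\<close> reduces the relation to smaller instances.\<close>

lemma comb_jacobi_sorted:
  assumes "comb s" "comb t" "comb u" "distinct (letters s @ letters t @ letters u)"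
    "wmin s < wmin t" "wmin t < wmin u"
  shows "cb.jac i j (word_vec s) (word_vec t) (word_vec u) = (0 :: lie_word \<Rightarrow>\<^sub>0 'k::field)"
proof -
  \<comment> \<open>In \<open>jac_critical\<close>, instances on three of the four arguments have
    fewer letters, those ending in \<open>u1\<close> or \<open>u2\<close> have a shorter last
    argument, and those ending in \<open>[u1, u2]_r\<close> with \<open>r < k\<close> have a smaller
    \<open>colsum\<close>. Normalizing an argument changes neither lengths nor
    \<open>colsum\<close>.\<close>
  define R where "R = inv_image (less_than <*lex*> less_than <*lex*> less_than)
    (\<lambda>(s, t, u). (length (letters s @ letters t @ letters u), length (letters u), colsum u))"
  define P where "P = (\<lambda>(s, t, u). comb s \<and> comb t \<and> comb u \<and> distinct (letters s @ letters t @ letters u) \<and>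
    wmin s < wmin t \<and> wmin t < wmin u \<longrightarrow>
    (\<forall>i j. cb.jac i j (word_vec s) (word_vec t) (word_vec u) = (0 :: lie_word \<Rightarrow>\<^sub>0 'k)))"
  have "wf R"
    unfolding R_def by (intro wf_inv_image wf_lex_prod wf_less_than)
  then have "P stu" for stu
  proof (induction stu rule: wf_induct_rule)
    case (less stu)
    obtain s t u where stu: "stu = (s, t, u)" by (cases stu) auto
    have IH: "cb.jac i j (word_vec x) (word_vec y) (word_vec z) = (0 :: lie_word \<Rightarrow>\<^sub>0 'k)"
      if "length (letters x @ letters y @ letters z) < length (letters s @ letters t @ letters u) \<or>
          length (letters x @ letters y @ letters z) = length (letters s @ letters t @ letters u) \<and>
           (length (letters z) < length (letters u) \<or> length (letters z) = length (letters u) \<and> colsum z < colsum u)"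
        "comb x" "comb y" "comb z" "distinct (letters x @ letters y @ letters z)" "wmin x < wmin y" "wmin y < wmin z"
      for i j x y z
      using less[of "(x, y, z)"] that unfolding stu by (auto simp: R_def P_def)
    have "cb.jac i j (word_vec s) (word_vec t) (word_vec u) = (0 :: lie_word \<Rightarrow>\<^sub>0 'k)"
      if c: "comb s" "comb t" "comb u" and d: "distinct (letters s @ letters t @ letters u)"
        and m: "wmin s < wmin t" "wmin t < wmin u" and le: "i \<le> j" for i j
    proof (cases "root_below j u")
      case True
      then show ?thesis
        using c d m le by (intro comb_jacobi_resolved) auto
    next
      case False
      then obtain k u1 u2 where u: "u = Brk k u1 u2" and jk: "j \<le> k"
        by (cases u) auto
      have u12: "comb u1" "comb u2" "wmin u1 < wmin u2" using c u by auto
      have w: "word_vec u = (cbr k (word_vec u1) (word_vec u2) :: lie_word \<Rightarrow>\<^sub>0 'k)"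
        using c(3) by (simp add: u cbr_word nf_comb)
      have m': "wmin s < wmin t" "wmin t < wmin u1" "wmin u1 < wmin u2" using m u12 u by auto
      have key: "comb v" "mset (letters v) = mset (letters x) + mset (letters y)" "set (letters v) = set (letters x) \<union> set (letters y)"
         "length (letters v) = length (letters x) + length (letters y)"
         "colsum v = r + colsum x + colsum y" "wmin v = min (wmin x) (wmin y)"
        if "v \<in> Poly_Mapping.keys (nf (Brk r x y) :: lie_word \<Rightarrow>\<^sub>0 'k)" for v r x y
      proof -
        note n = nf_keys[OF that]
        show "comb v" "mset (letters v) = mset (letters x) + mset (letters y)" "colsum v = r + colsum x + colsum y"
          using n by auto
        show *: "set (letters v) = set (letters x) \<union> set (letters y)"
          using mset_eq_setD[OF n(2)] by simp
        show "length (letters v) = length (letters x) + length (letters y)"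
          using mset_eq_length[OF n(2)] by simp
        show "wmin v = min (wmin x) (wmin y)"
          using wmin_cong[of v "Brk r x y"] * by simp
      qed
      note dv = comb_distinct
      have lift: "cb.jac p q (cbr r (word_vec x) (word_vec y)) (word_vec z) (word_vec z') = (0 :: lie_word \<Rightarrow>\<^sub>0 'k)"
        if "\<And>v. v \<in> Poly_Mapping.keys (nf (Brk r x y) :: lie_word \<Rightarrow>\<^sub>0 'k) \<Longrightarrow>
          cb.jac p q (word_vec v) (word_vec z) (word_vec z') = (0 :: lie_word \<Rightarrow>\<^sub>0 'k)" for p q r x y z z'
        unfolding cbr_word by (rule jac_lift) (use that in auto)
      have lift': "cb.jac p q (word_vec z) (cbr r (word_vec x) (word_vec y)) (word_vec z') = (0 :: lie_word \<Rightarrow>\<^sub>0 'k)"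
        if "\<And>v. v \<in> Poly_Mapping.keys (nf (Brk r x y) :: lie_word \<Rightarrow>\<^sub>0 'k) \<Longrightarrow>
          cb.jac p q (word_vec z) (word_vec v) (word_vec z') = (0 :: lie_word \<Rightarrow>\<^sub>0 'k)" for p q r x y z z'
        unfolding cbr_word by (rule jac_lift) (use that in auto)
      have lift'': "cb.jac p q (word_vec z) (word_vec z') (cbr r (word_vec x) (word_vec y)) = (0 :: lie_word \<Rightarrow>\<^sub>0 'k)"
        if "\<And>v. v \<in> Poly_Mapping.keys (nf (Brk r x y) :: lie_word \<Rightarrow>\<^sub>0 'k) \<Longrightarrow>
          cb.jac p q (word_vec z) (word_vec z') (word_vec v) = (0 :: lie_word \<Rightarrow>\<^sub>0 'k)" for p q r x y z z'
        unfolding cbr_word by (rule jac_lift) (use that in auto)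
      show ?thesis unfolding w
      proof (rule cb.jac_critical[OF le jk])
        fix p q r
        show "cb.jac p q (cbr r (word_vec s) (word_vec t)) (word_vec u1) (word_vec u2) = (0 :: lie_word \<Rightarrow>\<^sub>0 'k)"
          by (rule lift, frule key(1), frule key(3), frule key(4), frule key(5), drule key(6), rule IH)
            (use c d m' u12 u in \<open>auto simp: dv\<close>)
        show "cb.jac p q (cbr r (word_vec s) (word_vec u1)) (word_vec t) (word_vec u2) = (0 :: lie_word \<Rightarrow>\<^sub>0 'k)"
          by (rule lift, frule key(1), frule key(3), frule key(4), frule key(5), drule key(6), rule IH)
            (use c d m' u12 u in \<open>auto simp: dv\<close>)
        show "cb.jac p q (cbr r (word_vec s) (word_vec u2)) (word_vec t) (word_vec u1) = (0 :: lie_word \<Rightarrow>\<^sub>0 'k)"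
          by (rule lift, frule key(1), frule key(3), frule key(4), frule key(5), drule key(6), rule IH)
            (use c d m' u12 u in \<open>auto simp: dv\<close>)
        show "cb.jac p q (word_vec s) (cbr r (word_vec t) (word_vec u1)) (word_vec u2) = (0 :: lie_word \<Rightarrow>\<^sub>0 'k)"
          by (rule lift', frule key(1), frule key(3), frule key(4), frule key(5), drule key(6), rule IH)
            (use c d m' u12 u in \<open>auto simp: dv\<close>)
        show "cb.jac p q (word_vec s) (cbr r (word_vec t) (word_vec u2)) (word_vec u1) = (0 :: lie_word \<Rightarrow>\<^sub>0 'k)"
          by (rule lift', frule key(1), frule key(3), frule key(4), frule key(5), drule key(6), rule IH)
            (use c d m' u12 u in \<open>auto simp: dv\<close>)
        show "cb.jac p q (word_vec s) (word_vec t) (cbr r (word_vec u1) (word_vec u2)) = (0 :: lie_word \<Rightarrow>\<^sub>0 'k)" if "r < k"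
          by (rule lift'', frule key(1), frule key(3), frule key(4), frule key(5), drule key(6), rule IH)
            (use c d m' u12 u that in \<open>auto simp: dv\<close>)
      qed (rule IH; use c d m' u12 u in \<open>auto\<close>)+
    qed
    then have "cb.jac i j (word_vec s) (word_vec t) (word_vec u) = (0 :: lie_word \<Rightarrow>\<^sub>0 'k)"
      if "comb s" "comb t" "comb u" "distinct (letters s @ letters t @ letters u)"
        "wmin s < wmin t" "wmin t < wmin u" for i j
      using that cb.jac_sym[of i j] nat_le_linear[of i j] by metis
    then show ?case by (auto simp: P_def stu)
  qed
  from this[of "(s, t, u)"] assms show ?thesis by (auto simp: P_def)
qed

text \<open>A repeated letter makes every term 0. Otherwise \<open>jac\<close> only changes sign
  under permutations of its arguments, which can thus be sorted by their minima.\<close>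

lemma comb_jacobi:
  assumes "comb s" "comb t" "comb u"
  shows "cb.jac i j (word_vec s) (word_vec t) (word_vec u) = (0 :: lie_word \<Rightarrow>\<^sub>0 'k::field)"
proof (cases "distinct (letters s @ letters t @ letters u)")
  case False
  have B: "cbr p (word_vec z) (cbr q (word_vec x) (word_vec y)) = (nf (Brk p z (Brk q x y)) :: lie_word \<Rightarrow>\<^sub>0 'k)"
    if "comb x" "comb y" "comb z" for p q x y z
    using that by (simp add: nf_Brk nf_comb)
  have "nf (Brk p s (Brk q t u)) = (0 :: lie_word \<Rightarrow>\<^sub>0 'k)" "nf (Brk p t (Brk q u s)) = (0 :: lie_word \<Rightarrow>\<^sub>0 'k)"
    "nf (Brk p u (Brk q s t)) = (0 :: lie_word \<Rightarrow>\<^sub>0 'k)" for p q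
    by (rule nf_0; use False in auto)+
  then show ?thesis
    unfolding cb.jac_def cb.cyc_def by (simp add: B assms)
next
  case True
  then have ne: "wmin s \<noteq> wmin t" "wmin t \<noteq> wmin u" "wmin u \<noteq> wmin s"
    by (auto intro!: wmin_neq)
  let ?J = "\<lambda>x y z. cb.jac i j (word_vec x) (word_vec y) (word_vec z :: lie_word \<Rightarrow>\<^sub>0 'k)"
  have rot: "?J x y z = ?J y z x" and swap: "?J x y z = 0 \<longleftrightarrow> ?J y x z = 0" for x y z
    using cb.jac_rot[of i j "word_vec y" "word_vec z" "word_vec x :: lie_word \<Rightarrow>\<^sub>0 'k"]
      cb.jac_swap[of i j "word_vec x" "word_vec y" "word_vec z :: lie_word \<Rightarrow>\<^sub>0 'k"] by auto
  consider "wmin s < wmin t" "wmin t < wmin u" | "wmin t < wmin u" "wmin u < wmin s"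
    | "wmin u < wmin s" "wmin s < wmin t" | "wmin t < wmin s" "wmin s < wmin u"
    | "wmin s < wmin u" "wmin u < wmin t" | "wmin u < wmin t" "wmin t < wmin s"
    using ne by linarith
  then show ?thesis
  proof cases
    case 1 then show ?thesis using True assms by (intro comb_jacobi_sorted) auto
  next
    case 2 then show ?thesis using True assms unfolding rot[of s t u] by (intro comb_jacobi_sorted) auto
  next
    case 3 then show ?thesis using True assms unfolding rot[of s t u] rot[of t u s]
      by (intro comb_jacobi_sorted) auto
  next
    case 4 then show ?thesis using True assms unfolding swap[of s t u] by (intro comb_jacobi_sorted) auto
  next
    case 5 then show ?thesis using True assms unfolding swap[of s t u] rot[of t s u]
      by (intro comb_jacobi_sorted) auto
  next
    case 6 then show ?thesis using True assms unfolding swap[of s t u] rot[of t s u] rot[of s u t]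
      by (intro comb_jacobi_sorted) auto
  qed
qed

section \<open>Normal forms modulo the ideal\<close>

lemma nfl_jacobi: "cb.jac i j (nfl p) (nfl q) (nfl r) = (0 :: lie_word \<Rightarrow>\<^sub>0 'k::field)"
proof -
  have "comb v" if "v \<in> Poly_Mapping.keys (nfl p)" for v and p :: "lie_word \<Rightarrow>\<^sub>0 'k"
    using keys_lin_ext[OF that[unfolded nfl_def]] nf_keys(1) by auto
  then show ?thesis
    by (intro jac_lift[OF comb_jacobi])
qed

text \<open>\<open>nfl\<close> turns \<open>bracket\<close> into \<open>cbr\<close>, which satisfies
  the relations on normal forms, so the kernel of \<open>nfl\<close> is closed under all rules that
  generate the ideal.\<close>

lemma nfl_lie_ideal:
  assumes "p \<in> lie_ideal n"
  shows "nfl p = (0 :: lie_word \<Rightarrow>\<^sub>0 'k::field)"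
  using assms
proof induction
  case zero show ?case by (rule lin_map_0[OF lin_map_nfl])
next
  case (antisym x y j)
  show ?case
    using cb.antisym[of j "nfl x" "nfl y"] by (simp add: lin_map_add[OF lin_map_nfl] nfl_bracket)
next
  case (jacobi x y z j)
  show ?case
    using nfl_jacobi[of j j x y z] by (simp add: lin_map_add[OF lin_map_nfl] nfl_bracket cb.jac_def cb.cyc_def ac_simps)
next
  case (compatible i j x y z)
  then show ?case
    using nfl_jacobi[of i j x y z] by (simp add: lin_map_add[OF lin_map_nfl] nfl_bracket cb.jac_def cb.cyc_def ac_simps)
qed (simp_all add: lin_map_add[OF lin_map_nfl] lin_map_scale[OF lin_map_nfl] nfl_bracket)

lemma subspace_lie_ideal: "lin.subspace (lie_ideal n)"
  by (auto simp: lin.subspace_def intro: lie_ideal.zero lie_ideal.add lie_ideal.scale)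

lemma lie_ideal_diff: "p \<in> lie_ideal n \<Longrightarrow> q \<in> lie_ideal n \<Longrightarrow> p - q \<in> lie_ideal n"
  by (rule lin.subspace_diff[OF subspace_lie_ideal])

lemma word_vec_free_alg: "set (letters w) \<subseteq> {1..n} \<Longrightarrow> word_vec w \<in> free_alg n"
  by (simp add: free_alg_def)

lemma resolve_lie_ideal:
  assumes "set (letters s) \<subseteq> {1..n}" "set (letters t) \<subseteq> {1..n}" "\<not> root_below j t"
  shows "word_vec (Brk j s t) - (\<Sum>(c, x)\<leftarrow>resolve j s t. lin_scale (of_int c) (word_vec x))
    \<in> (lie_ideal n :: (lie_word \<Rightarrow>\<^sub>0 'k::field) set)"
proof -
  obtain k t1 t2 where t: "t = Brk k t1 t2"
    using assms by (cases t) auto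
  let ?I = "lie_ideal n :: (lie_word \<Rightarrow>\<^sub>0 'k::field) set"
  have fa: "word_vec s \<in> free_alg n" "word_vec t1 \<in> free_alg n" "word_vec t2 \<in> free_alg n"
    "word_vec (Brk q s t1) \<in> free_alg n" "word_vec (Brk q s t2) \<in> free_alg n" for q
    using assms t by (simp_all add: word_vec_free_alg)
  define C where "C p q = bracket p (word_vec s) (bracket q (word_vec t1) (word_vec t2)) +
      bracket p (word_vec t2) (bracket q (word_vec s) (word_vec t1)) +
      bracket p (word_vec t1) (bracket q (word_vec t2) (word_vec s) :: lie_word \<Rightarrow>\<^sub>0 'k)" for p q
  \<comment> \<open>\<open>D\<close> is \<open>C\<close> with its last two terms turned round by
    antisymmetry, as they appear in \<open>resolve\<close>.\<close>
  define D where "D p q = word_vec (Brk p s (Brk q t1 t2)) - word_vec (Brk p (Brk q s t1) t2) +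
      (word_vec (Brk p (Brk q s t2) t1) :: lie_word \<Rightarrow>\<^sub>0 'k)" for p q
  have CD: "D p q - C p q \<in> ?I" for p q
  proof -
    have "bracket p (word_vec (Brk q s t1)) (word_vec t2) + bracket p (word_vec t2) (word_vec (Brk q s t1)) \<in> ?I"
      "bracket p (word_vec (Brk q s t2)) (word_vec t1) + bracket p (word_vec t1) (word_vec (Brk q s t2)) \<in> ?I"
      "bracket p (word_vec t1) (bracket q (word_vec s) (word_vec t2) + bracket q (word_vec t2) (word_vec s)) \<in> ?I"
      using fa by (auto intro!: lie_ideal.antisym lie_ideal.bracket_right)
    then have "(bracket p (word_vec (Brk q s t2)) (word_vec t1) + bracket p (word_vec t1) (word_vec (Brk q s t2)))
       - bracket p (word_vec t1) (bracket q (word_vec s) (word_vec t2) + bracket q (word_vec t2) (word_vec s))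
       - (bracket p (word_vec (Brk q s t1)) (word_vec t2) + bracket p (word_vec t2) (word_vec (Brk q s t1))) \<in> ?I"
      by (intro lie_ideal_diff)
    then show ?thesis
      by (simp add: C_def D_def bracket_single lin_map_add[OF lin_map_bracket_right] algebra_simps)
  qed
  show ?thesis
  proof (cases "j = k")
    case True
    have "C j j \<in> ?I"
      unfolding C_def using fa by (intro lie_ideal.jacobi)
    from lie_ideal.add[OF this CD[of j j]] show ?thesis
      by (simp add: t True D_def lin_scale_minus_one algebra_simps)
  next
    case False
    then have "C j k + C k j \<in> ?I"
      unfolding C_def using fa lie_ideal.compatible[of j k "word_vec s" n "word_vec t1" "word_vec t2"]
      by (simp add: ac_simps)
    from lie_ideal.add[OF lie_ideal.add[OF this CD[of j k]] CD[of k j]] show ?thesis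
      using False by (simp add: t D_def lin_scale_minus_one algebra_simps)
  qed
qed

text \<open>Distinct letters exclude the clause that sends overlapping brackets to 0, the only
  clause of \<open>step\<close> that does not follow from the relations.\<close>

lemma step_lie_ideal:
  assumes "\<not> comb w" "distinct (letters w)" "set (letters w) \<subseteq> {1..n}"
  shows "word_vec w - (\<Sum>(c, x)\<leftarrow>step w. lin_scale (of_int c) (word_vec x))
    \<in> (lie_ideal n :: (lie_word \<Rightarrow>\<^sub>0 'k::field) set)"
  using assms
proof (induction w)
  case (Brk j s t)
  have fa: "word_vec s \<in> (free_alg n :: (lie_word \<Rightarrow>\<^sub>0 'k) set)" "word_vec t \<in> (free_alg n :: (lie_word \<Rightarrow>\<^sub>0 'k) set)"
    using Brk.prems by (auto intro!: word_vec_free_alg)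
  have word: "word_vec (Brk j x y) = bracket j (word_vec x) (word_vec y :: lie_word \<Rightarrow>\<^sub>0 'k)" for x y
    by (simp add: bracket_single)
  consider (left) "\<not> comb s" | (right) "comb s" "\<not> comb t"
    | (swap) "comb s" "comb t" "wmin t < wmin s"
    | (res) "comb s" "comb t" "\<not> wmin t < wmin s"
    by blast
  then show ?case
  proof cases
    case left
    have "bracket j (word_vec s - (\<Sum>(c, x)\<leftarrow>step s. lin_scale (of_int c) (word_vec x))) (word_vec t :: lie_word \<Rightarrow>\<^sub>0 'k) \<in> lie_ideal n"
      using Brk left fa by (intro lie_ideal.bracket_left) auto
    then show ?thesis
      using left lin_map_sum_list[OF lin_map_bracket_left, where g = of_int and h = "\<lambda>w. word_vec w :: lie_word \<Rightarrow>\<^sub>0 'k" and xs = "step s"]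
      by (simp add: word lin_map_diff[OF lin_map_bracket_left] comp_def case_prod_unfold)
  next
    case right
    have "bracket j (word_vec s :: lie_word \<Rightarrow>\<^sub>0 'k) (word_vec t - (\<Sum>(c, x)\<leftarrow>step t. lin_scale (of_int c) (word_vec x))) \<in> lie_ideal n"
      using Brk right fa by (intro lie_ideal.bracket_right) auto
    then show ?thesis
      using right lin_map_sum_list[OF lin_map_bracket_right, where g = of_int and h = "\<lambda>w. word_vec w :: lie_word \<Rightarrow>\<^sub>0 'k" and xs = "step t"]
      by (simp add: word lin_map_diff[OF lin_map_bracket_right] comp_def case_prod_unfold)
  next
    case swap
    then show ?thesis
      using Brk.prems lie_ideal.antisym[OF fa, of j] by (auto simp: lin_scale_minus_one word)
  next
    case res
    have d: "set (letters s) \<inter> set (letters t) = {}" using Brk.prems by auto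
    with res wmin_neq[OF d] Brk.prems have "\<not> root_below j t" by auto
    with res d Brk.prems show ?thesis
      using resolve_lie_ideal[of s n t j, where 'k='k] by simp
  qed
qed simp

lemma word_minus_nf:
  assumes "distinct (letters w)" "set (letters w) \<subseteq> {1..n}"
  shows "word_vec w - nf w \<in> (lie_ideal n :: (lie_word \<Rightarrow>\<^sub>0 'k::field) set)"
  using assms
proof (induction w rule: wf_induct_rule[OF wf_smaller])
  case (1 w)
  show ?case
  proof (cases "comb w")
    case True
    then show ?thesis by (simp add: nf_comb lie_ideal.zero)
  next
    case False
    have IH: "word_vec x - nf x \<in> (lie_ideal n :: (lie_word \<Rightarrow>\<^sub>0 'k) set)" if "(c, x) \<in> set (step w)" for c x
      using 1 step_props(4)[OF that False] mset_eq_imp_distinct_iff[OF step_props(1)[OF that False]]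
        mset_eq_setD[OF step_props(1)[OF that False]] by auto
    have S: "(\<Sum>(c, x)\<leftarrow>xs. lin_scale (of_int c) (word_vec x)) - (\<Sum>(c, x)\<leftarrow>xs. lin_scale (of_int c) (nf x))
      \<in> (lie_ideal n :: (lie_word \<Rightarrow>\<^sub>0 'k) set)" if "set xs \<subseteq> set (step w)" for xs
      using that
    proof (induction xs)
      case (Cons a xs)
      obtain c x where a: "a = (c, x)" by (cases a)
      have "lin_scale (of_int c) (word_vec x - nf x) + ((\<Sum>(c, x)\<leftarrow>xs. lin_scale (of_int c) (word_vec x)) - (\<Sum>(c, x)\<leftarrow>xs. lin_scale (of_int c) (nf x)))
        \<in> (lie_ideal n :: (lie_word \<Rightarrow>\<^sub>0 'k) set)"
        using Cons a by (intro lie_ideal.add lie_ideal.scale IH[of c]) auto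
      then show ?case by (simp add: a lin.scale_right_diff_distrib algebra_simps)
    qed (simp add: lie_ideal.zero)
    from lie_ideal.add[OF step_lie_ideal[OF False 1(2,3)] S[of "step w"]] show ?thesis
      by (subst nf_step[OF False]) simp
  qed
qed

section \<open>The dimension of the multilinear components\<close>

lemma word_vec_eq_iff [simp]: "(word_vec v :: lie_word \<Rightarrow>\<^sub>0 'k::field) = word_vec w \<longleftrightarrow> v = w"
proof
  assume "(word_vec v :: lie_word \<Rightarrow>\<^sub>0 'k) = word_vec w"
  then have "Poly_Mapping.keys (word_vec v :: lie_word \<Rightarrow>\<^sub>0 'k) = Poly_Mapping.keys (word_vec w :: lie_word \<Rightarrow>\<^sub>0 'k)"
    by (rule arg_cong)
  then show "v = w" by simp
qed simp

lemma independent_word_vec: "\<not> lin.dependent (word_vec ` A :: (lie_word \<Rightarrow>\<^sub>0 'k::field) set)"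
proof -
  have "u v = 0"
    if t: "finite t" "t \<subseteq> word_vec ` A" "(\<Sum>v\<in>t. lin_scale (u v) v) = 0" "v \<in> t" for t u and v :: "lie_word \<Rightarrow>\<^sub>0 'k"
  proof -
    obtain w where w: "v = word_vec w" using t by auto
    have "0 = Poly_Mapping.lookup (\<Sum>v\<in>t. lin_scale (u v) v) w" by (simp add: t)
    also have "\<dots> = (\<Sum>x\<in>t. u x * Poly_Mapping.lookup x w)"
      by (simp add: lookup_sum)
    also have "\<dots> = (\<Sum>x\<in>t. if x = v then u v else 0)"
      by (rule sum.cong) (use t w in \<open>auto simp: lookup_single when_def\<close>)
    finally show ?thesis using t by simp
  qed
  then show ?thesis unfolding lin.dependent_explicit by auto
qed

definition combs :: "nat \<Rightarrow> (nat \<Rightarrow>\<^sub>0 nat) \<Rightarrow> lie_word set" where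
  "combs n \<mu> = {w. comb w \<and> set (letters w) = {1..n} \<and> bracket_type w = \<mu>}"

text \<open>By \<open>word_minus_nf\<close> and \<open>nfl_lie_ideal\<close>, \<open>nfl\<close>
  induces an isomorphism from the component onto the span of the combs.\<close>

lemma dim_Lie_combs: "dim_Lie TYPE('k::field) n \<mu> = card (combs n \<mu>)"
proof -
  let ?W = "lie_ideal n :: (lie_word \<Rightarrow>\<^sub>0 'k) set"
  define P where "P = (word_vec ` bracketed_perms n \<mu> :: (lie_word \<Rightarrow>\<^sub>0 'k) set)"
  define C where "C = (word_vec ` combs n \<mu> :: (lie_word \<Rightarrow>\<^sub>0 'k) set)"
  have comb_sub: "combs n \<mu> \<subseteq> bracketed_perms n \<mu>"
    by (auto simp: combs_def bracketed_perms_def comb_distinct)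
  have CP: "C \<subseteq> P" using comb_sub by (auto simp: C_def P_def)
  have Q: "Lie n \<mu> = coset ?W ` lin.span P"
    by (simp add: Lie_def P_def)
  have coset_eq: "coset ?W x = coset ?W y \<longleftrightarrow> x - y \<in> ?W" for x y
  proof
    assume "coset ?W x = coset ?W y"
    moreover have "x \<in> coset ?W x" by (force simp: coset_def intro: lie_ideal.zero)
    ultimately show "x - y \<in> ?W" by (auto simp: coset_def)
  next
    have *: "coset ?W x \<subseteq> coset ?W y" if xy: "x - y \<in> ?W" for x y
    proof
      fix z assume "z \<in> coset ?W x"
      then obtain w where "z = x + w" "w \<in> ?W" by (auto simp: coset_def)
      then show "z \<in> coset ?W y"
        using lie_ideal.add[OF xy] unfolding coset_def by (intro image_eqI[where x = "(x - y) + w"]) auto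
    qed
    assume "x - y \<in> ?W"
    moreover from this have "y - x \<in> ?W"
      using lin.subspace_neg[OF subspace_lie_ideal] by fastforce
    ultimately show "coset ?W x = coset ?W y" using * by blast
  qed
  have nfl_W: "nfl x = nfl y" if "x - y \<in> ?W" for x y
    using nfl_lie_ideal[OF that] by (simp add: lin_map_diff[OF lin_map_nfl])
  have nfl_P: "x - nfl x \<in> ?W \<and> nfl x \<in> lin.span C" if "x \<in> lin.span P" for x
    using that
  proof (induction rule: lin.span_induct)
    case base
    have s: "lin.subspace {x. x - nfl x \<in> ?W}"
      unfolding lin.subspace_def
      by (auto simp: lin_map_0[OF lin_map_nfl] lin_map_add[OF lin_map_nfl] lin_map_scale[OF lin_map_nfl]
        lie_ideal.zero add_diff_add lin.scale_right_diff_distrib[symmetric] intro: lie_ideal.add lie_ideal.scale)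
    have s': "lin.subspace {x. nfl x \<in> lin.span C}"
      unfolding lin.subspace_def
      by (auto simp: lin_map_0[OF lin_map_nfl] lin_map_add[OF lin_map_nfl] lin_map_scale[OF lin_map_nfl]
        intro: lin.span_zero lin.span_add lin.span_scale)
    show ?case
      using lin.subspace_inter[OF s s'] by (simp add: Collect_conj_eq)
  next
    case (step x)
    then obtain w where w: "x = word_vec w" "w \<in> bracketed_perms n \<mu>" by (auto simp: P_def)
    have "nf w \<in> lin.span C"
    proof (rule lin_subspace_induct)
      fix v assume "v \<in> Poly_Mapping.keys (nf w :: lie_word \<Rightarrow>\<^sub>0 'k)"
      from nf_keys[OF this] have "v \<in> combs n \<mu>"
        using w(2) mset_eq_setD[of "letters v" "letters w"] by (auto simp: combs_def bracketed_perms_def)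
      then show "word_vec v \<in> lin.span C" by (intro lin.span_base) (auto simp: C_def)
    qed (rule lin.subspace_span)
    moreover have "word_vec w - nf w \<in> ?W"
      using w(2) by (intro word_minus_nf) (auto simp: bracketed_perms_def)
    ultimately show ?case by (simp add: w)
  qed
  have nfl_C: "nfl x = x" if "x \<in> lin.span C" for x
    using that
  proof (induction rule: lin.span_induct)
    case base
    show ?case unfolding lin.subspace_def
      by (auto simp: lin_map_0[OF lin_map_nfl] lin_map_add[OF lin_map_nfl] lin_map_scale[OF lin_map_nfl])
  qed (auto simp: C_def combs_def nf_comb)
  have card_C: "card C = card (combs n \<mu>)"
    unfolding C_def by (rule card_image) (auto simp: inj_on_def)
  have "independent_mod ?W C \<and> coset ?W ` lin.span C = Lie n \<mu>"
  proof
    show "independent_mod ?W C"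
      unfolding independent_mod_def
    proof (intro allI impI)
      fix t u assume t: "finite t" "t \<subseteq> C" "(\<Sum>v\<in>t. lin_scale (u v) v) \<in> ?W"
      have "(\<Sum>v\<in>t. lin_scale (u v) v) \<in> lin.span C"
        using t by (auto intro!: lin.span_sum lin.span_scale intro: lin.span_base)
      with t(3) have "(\<Sum>v\<in>t. lin_scale (u v) v) = 0"
        using nfl_C nfl_lie_ideal by metis
      with t independent_word_vec[of "combs n \<mu>", where 'k='k] show "\<forall>v\<in>t. u v = 0"
        unfolding C_def lin.dependent_explicit by blast
    qed
    have "coset ?W x \<in> coset ?W ` lin.span C" if "x \<in> lin.span P" for x
      using nfl_P[OF that] coset_eq[of x "nfl x"] by auto
    then show "coset ?W ` lin.span C = Lie n \<mu>"
      using lin.span_mono[OF CP] unfolding Q by auto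
  qed
  then have ex: "\<exists>b. independent_mod ?W b \<and> coset ?W ` lin.span b = Lie n \<mu>" by blast
  \<comment> \<open>\<open>quotient_dim\<close> chooses an unspecified set of representatives, so
    each admissible one is compared with \<open>C\<close>.\<close>
  have "card b = card C" if b: "independent_mod ?W b" "coset ?W ` lin.span b = Lie n \<mu>" for b
  proof -
    \<comment> \<open>Members of \<open>b\<close> may lie outside the span of \<open>P\<close>; only
      their cosets are known to come from it.\<close>
    have toP: "\<exists>p\<in>lin.span P. x - p \<in> ?W" if "x \<in> lin.span b" for x
      using that b(2) coset_eq unfolding Q by (metis (no_types, lifting) image_iff)
    have zero: "u v = 0" if t: "finite t" "t \<subseteq> b" "(\<Sum>v\<in>t. lin_scale (u v) (nfl v)) = 0" "v \<in> t" for t u v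
    proof -
      let ?x = "\<Sum>v\<in>t. lin_scale (u v) v"
      have "?x \<in> lin.span b"
        using t by (auto intro!: lin.span_sum lin.span_scale intro: lin.span_base)
      then obtain p where p: "p \<in> lin.span P" "?x - p \<in> ?W" using toP by blast
      have "nfl ?x = 0"
        using t(3) by (simp add: lin_map_sum[OF lin_map_nfl] lin_map_scale[OF lin_map_nfl])
      with nfl_W[OF p(2)] nfl_P[OF p(1)] have "p \<in> ?W" by simp
      from lie_ideal.add[OF p(2) this] have "?x \<in> ?W" by simp
      with b(1) t show ?thesis unfolding independent_mod_def by blast
    qed
    have inj: "inj_on nfl b"
    proof (rule inj_onI, rule ccontr)
      fix x y assume xy: "x \<in> b" "y \<in> b" "nfl x = nfl y" "x \<noteq> y"
      have "(\<Sum>v\<in>{x, y}. lin_scale (if v = x then 1 else - 1) (nfl v)) = 0"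
        using xy by (simp add: lin_scale_minus_one)
      from zero[OF _ _ this, of x] xy show False by simp
    qed
    have "\<not> lin.dependent (nfl ` b)"
    proof
      assume "lin.dependent (nfl ` b)"
      then obtain t u v where t: "finite t" "t \<subseteq> nfl ` b" "(\<Sum>v\<in>t. lin_scale (u v) v) = 0" "v \<in> t" "u v \<noteq> 0"
        unfolding lin.dependent_explicit by blast
      from t(1,2) obtain t' where t': "t' \<subseteq> b" "finite t'" "t = nfl ` t'"
        by (meson finite_subset_image)
      have "inj_on nfl t'" using inj t'(1) by (rule inj_on_subset)
      then have "(\<Sum>v\<in>t'. lin_scale (u (nfl v)) (nfl v)) = 0"
        using t(3) t'(3) by (simp add: sum.reindex)
      moreover obtain v' where "v' \<in> t'" "v = nfl v'" using t t' by auto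
      ultimately show False using zero[of t' "\<lambda>v. u (nfl v)" v'] t' t by auto
    qed
    then have "card (nfl ` b) = lin.dim (lin.span (nfl ` b))"
      by (simp add: lin.dim_eq_card_independent lin.dim_span)
    also have "lin.span (nfl ` b) = nfl ` lin.span b"
      by (rule module_hom.span_image[OF lin_map_hom[OF lin_map_nfl]])
    also have "\<dots> = lin.span C"
    proof
      show "nfl ` lin.span b \<subseteq> lin.span C"
        using toP nfl_W nfl_P by (metis image_subsetI)
      show "lin.span C \<subseteq> nfl ` lin.span b"
      proof
        fix c assume c: "c \<in> lin.span C"
        then have "coset ?W c \<in> coset ?W ` lin.span b"
          using lin.span_mono[OF CP] unfolding b(2) Q by auto
        then obtain v where "v \<in> lin.span b" "c - v \<in> ?W" using coset_eq by auto
        with nfl_W nfl_C[OF c] show "c \<in> nfl ` lin.span b" by (metis image_eqI)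
      qed
    qed
    also have "lin.dim (lin.span C) = card C"
      using independent_word_vec[of "combs n \<mu>", where 'k='k]
      by (simp add: lin.dim_eq_card_independent lin.dim_span C_def)
    finally show ?thesis by (simp add: card_image[OF inj])
  qed
  then have "card (SOME b. independent_mod ?W b \<and> coset ?W ` lin.span b = Lie n \<mu>) = card C"
    using someI_ex[OF ex] by blast
  then show ?thesis
    using ex by (simp add: dim_Lie_def quotient_dim_def card_C)
qed

section \<open>Normalized trees\<close>

lemma leaf_labels_ne [simp]: "leaf_labels t \<noteq> []"
  by (induction t) auto

lemma vmin_Leaf [simp]: "vmin (Leaf a) = a"
  by (simp add: vmin_def)

lemma vmin_Node: "vmin (Node l r) = min (vmin l) (vmin r)"
  by (simp add: vmin_def Min_Un)

lemma vmin_in: "vmin t \<in> set (leaf_labels t)"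
  by (simp add: vmin_def)

lemma vmin_le: "x \<in> set (leaf_labels t) \<Longrightarrow> vmin t \<le> x"
  by (simp add: vmin_def)

primrec nor :: "btree \<Rightarrow> bool" where
  "nor (Leaf a) \<longleftrightarrow> True"
| "nor (Node l r) \<longleftrightarrow> nor l \<and> nor r \<and> set (leaf_labels l) \<inter> set (leaf_labels r) = {} \<and> vmin l < vmin r"

lemma subtree_Leaf: "subtree (Leaf a) p = Some s \<longleftrightarrow> p = [] \<and> s = Leaf a"
  by (cases p) auto

lemma subtree_Node:
  "subtree (Node l r) p = Some s \<longleftrightarrow> p = [] \<and> s = Node l r \<or>
     (\<exists>q. p = GoL # q \<and> subtree l q = Some s) \<or> (\<exists>q. p = GoR # q \<and> subtree r q = Some s)"
proof (cases p)
  case (Cons d q)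
  then show ?thesis by (cases d) auto
qed auto

lemma nor_iff:
  "nor t \<longleftrightarrow> distinct (leaf_labels t) \<and>
     (\<forall>p l r. subtree t p = Some (Node l r) \<longrightarrow> vmin (Node l r) = vmin l)"
proof (induction t)
  case (Node l r)
  have "(\<forall>p l' r'. subtree (Node l r) p = Some (Node l' r') \<longrightarrow> vmin (Node l' r') = vmin l') \<longleftrightarrow>
     vmin (Node l r) = vmin l \<and>
     (\<forall>p l' r'. subtree l p = Some (Node l' r') \<longrightarrow> vmin (Node l' r') = vmin l') \<and>
     (\<forall>p l' r'. subtree r p = Some (Node l' r') \<longrightarrow> vmin (Node l' r') = vmin l')"
    (is "?A \<longleftrightarrow> ?B \<and> ?C \<and> ?D")
  proof (intro iffI conjI)
    assume A: ?A
    show ?B using A[rule_format, of "[]"] by simp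
    show ?C using A[rule_format, of "GoL # _"] by simp
    show ?D using A[rule_format, of "GoR # _"] by simp
  next
    assume "?B \<and> ?C \<and> ?D"
    then show ?A by (auto simp: subtree_Node)
  qed
  moreover have "vmin l \<noteq> vmin r" if "set (leaf_labels l) \<inter> set (leaf_labels r) = {}"
    using that vmin_in by (metis disjoint_iff)
  ultimately show ?case
    using Node by (auto simp: vmin_Node min_def)
qed (auto simp: subtree_Leaf)

lemma Nor_eq: "Nor n = {t. nor t \<and> set (leaf_labels t) = {1..n}}"
  by (auto simp: Nor_def nor_iff)

lemma nor_vmin: "nor (Node l r) \<Longrightarrow> vmin (Node l r) = vmin l"
  by (simp add: vmin_Node)

lemma internal_nodes_Leaf [simp]: "internal_nodes (Leaf a) = {}"
  by (auto simp: internal_nodes_def subtree_Leaf)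

lemma internal_nodes_Node:
  "internal_nodes (Node l r) = insert [] ((#) GoL ` internal_nodes l \<union> (#) GoR ` internal_nodes r)"
  by (auto simp: internal_nodes_def subtree_Node)


section \<open>Chains of linked internal nodes\<close>

text \<open>
  The internal nodes of a tree are partitioned into chains, where a node whose subtree satisfies
  \<open>L\<close> (resp. \<open>R\<close>) is linked to its left (resp. right) child, if internal. The parameters \<open>nm\<close> and
  \<open>sh\<close> determine how nodes are named: \<open>nm\<close> is the name of the root and \<open>sh\<close> turns the name of
  a node of a child into its name in the whole tree. Nodes are named by paths and by letters.
\<close>

definition nonempty :: "'n list \<Rightarrow> 'n list list" where
  "nonempty xs = (if xs = [] then [] else [xs])"

context
  fixes L R :: "btree \<Rightarrow> bool" and nm :: "btree \<Rightarrow> 'n" and sh :: "dir \<Rightarrow> 'n \<Rightarrow> 'n"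
begin

primrec root_chain :: "btree \<Rightarrow> 'n list" where
  "root_chain (Leaf a) = []"
| "root_chain (Node l r) = nm (Node l r) #
    ((if L (Node l r) then map (sh GoL) (root_chain l) else []) @
     (if R (Node l r) then map (sh GoR) (root_chain r) else []))"

primrec other_chains :: "btree \<Rightarrow> 'n list list" where
  "other_chains (Leaf a) = []"
| "other_chains (Node l r) =
    (if L (Node l r) then [] else nonempty (map (sh GoL) (root_chain l))) @
    map (map (sh GoL)) (other_chains l) @
    (if R (Node l r) then [] else nonempty (map (sh GoR) (root_chain r))) @
    map (map (sh GoR)) (other_chains r)"

definition chains :: "btree \<Rightarrow> 'n list list" where
  "chains t = nonempty (root_chain t) @ other_chains t"

primrec linked :: "btree \<Rightarrow> 'n \<Rightarrow> 'n \<Rightarrow> bool" where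
  "linked (Leaf a) x y \<longleftrightarrow> False"
| "linked (Node l r) x y \<longleftrightarrow>
    (\<exists>x' y'. x = sh GoL x' \<and> y = sh GoL y' \<and> linked l x' y') \<or>
    (\<exists>x' y'. x = sh GoR x' \<and> y = sh GoR y' \<and> linked r x' y') \<or>
    x = nm (Node l r) \<and> (L (Node l r) \<and> root_chain l \<noteq> [] \<and> y = sh GoL (hd (root_chain l)) \<or>
                         R (Node l r) \<and> root_chain r \<noteq> [] \<and> y = sh GoR (hd (root_chain r)))"

lemma chains_nonempty: "[] \<notin> set (chains t)"
proof -
  have "[] \<notin> set (other_chains t)"
    by (induction t) (auto simp: nonempty_def)
  then show ?thesis by (auto simp: chains_def nonempty_def)
qed

text \<open>Since no node is linked to both children, at most one of the two appended halves of
  \<open>root_chain\<close> is present, and consecutive entries are parent and child.\<close>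

lemma chains_linked:
  assumes "\<And>t. \<not> (L t \<and> R t)"
  shows "b \<in> set (chains t) \<Longrightarrow> successively (linked t) b"
proof (induction t arbitrary: b)
  case (Node l r)
  have left: "successively (linked (Node l r)) (map (sh GoL) b)" if "b \<in> set (chains l)" for b
    using Node.IH(1)[OF that] unfolding successively_map by (rule successively_mono) auto
  have right: "successively (linked (Node l r)) (map (sh GoR) b)" if "b \<in> set (chains r)" for b
    using Node.IH(2)[OF that] unfolding successively_map by (rule successively_mono) auto
  have rl: "successively (linked (Node l r)) (map (sh GoL) (root_chain l))"
    using left[of "root_chain l"] by (cases "root_chain l = []") (auto simp: chains_def nonempty_def)
  have rr: "successively (linked (Node l r)) (map (sh GoR) (root_chain r))"
    using right[of "root_chain r"] by (cases "root_chain r = []") (auto simp: chains_def nonempty_def)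
  from Node.prems consider "b = root_chain (Node l r)" | "b = map (sh GoL) (root_chain l)"
    | b' where "b = map (sh GoL) b'" "b' \<in> set (chains l)"
    | "b = map (sh GoR) (root_chain r)" | b' where "b = map (sh GoR) b'" "b' \<in> set (chains r)"
    by (auto simp: chains_def nonempty_def split: if_splits)
  then show ?case
  proof cases
    case 1
    then show ?thesis
      using rl rr assms[of "Node l r"]
      by (cases "root_chain l"; cases "root_chain r") auto
  qed (use rl rr left right in auto)
qed (simp add: chains_def nonempty_def)

lemma linked_chains:
  "linked t x y \<Longrightarrow> \<exists>b\<in>set (chains t). x \<in> set b \<and> y \<in> set b"
proof (induction t arbitrary: x y)
  case (Node l r)
  have lift: "\<exists>b\<in>set (chains (Node l r)). sh GoL x \<in> set b \<and> sh GoL y \<in> set b"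
    if ex: "\<exists>b\<in>set (chains l). x \<in> set b \<and> y \<in> set b" for x y
  proof -
    obtain b where "b \<in> set (chains l)" "x \<in> set b" "y \<in> set b" using ex by auto
    then consider "b = root_chain l" "L (Node l r)" | "b = root_chain l" "\<not> L (Node l r)" "b \<noteq> []"
      | "b \<in> set (other_chains l)"
      by (auto simp: chains_def nonempty_def split: if_splits)
    then show ?thesis
    proof cases
      case 1
      then show ?thesis using \<open>x \<in> set b\<close> \<open>y \<in> set b\<close>
        by (intro bexI[of _ "root_chain (Node l r)"]) (auto simp: chains_def nonempty_def)
    next
      case 2
      then show ?thesis using \<open>x \<in> set b\<close> \<open>y \<in> set b\<close>
        by (intro bexI[of _ "map (sh GoL) b"]) (auto simp: chains_def nonempty_def)
    next
      case 3
      then show ?thesis using \<open>x \<in> set b\<close> \<open>y \<in> set b\<close>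
        by (intro bexI[of _ "map (sh GoL) b"]) (auto simp: chains_def)
    qed
  qed
  have lift': "\<exists>b\<in>set (chains (Node l r)). sh GoR x \<in> set b \<and> sh GoR y \<in> set b"
    if ex: "\<exists>b\<in>set (chains r). x \<in> set b \<and> y \<in> set b" for x y
  proof -
    obtain b where "b \<in> set (chains r)" "x \<in> set b" "y \<in> set b" using ex by auto
    then consider "b = root_chain r" "R (Node l r)" | "b = root_chain r" "\<not> R (Node l r)" "b \<noteq> []"
      | "b \<in> set (other_chains r)"
      by (auto simp: chains_def nonempty_def split: if_splits)
    then show ?thesis
    proof cases
      case 1
      then show ?thesis using \<open>x \<in> set b\<close> \<open>y \<in> set b\<close>
        by (intro bexI[of _ "root_chain (Node l r)"]) (auto simp: chains_def nonempty_def)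
    next
      case 2
      then show ?thesis using \<open>x \<in> set b\<close> \<open>y \<in> set b\<close>
        by (intro bexI[of _ "map (sh GoR) b"]) (auto simp: chains_def nonempty_def)
    next
      case 3
      then show ?thesis using \<open>x \<in> set b\<close> \<open>y \<in> set b\<close>
        by (intro bexI[of _ "map (sh GoR) b"]) (auto simp: chains_def)
    qed
  qed
  from Node.prems consider (l) x' y' where "x = sh GoL x'" "y = sh GoL y'" "linked l x' y'"
    | (r) x' y' where "x = sh GoR x'" "y = sh GoR y'" "linked r x' y'"
    | (L) "x = nm (Node l r)" "L (Node l r)" "root_chain l \<noteq> []" "y = sh GoL (hd (root_chain l))"
    | (R) "x = nm (Node l r)" "R (Node l r)" "root_chain r \<noteq> []" "y = sh GoR (hd (root_chain r))"
    by auto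
  then show ?case
  proof cases
    case l then show ?thesis using lift Node.IH(1) by auto
  next
    case r then show ?thesis using lift' Node.IH(2) by auto
  next
    case L then show ?thesis by (auto simp: chains_def nonempty_def)
  next
    case R then show ?thesis by (auto simp: chains_def nonempty_def)
  qed
qed simp

end

section \<open>Sizes of chains, equivalence classes and maximal sequences\<close>

definition nonzero :: "nat \<Rightarrow> nat multiset" where
  "nonzero k = (if k = 0 then {#} else {#k#})"

primrec root_size :: "(btree \<Rightarrow> bool) \<Rightarrow> (btree \<Rightarrow> bool) \<Rightarrow> btree \<Rightarrow> nat" where
  "root_size L R (Leaf a) = 0"
| "root_size L R (Node l r) = Suc ((if L (Node l r) then root_size L R l else 0) +
     (if R (Node l r) then root_size L R r else 0))"

primrec other_sizes :: "(btree \<Rightarrow> bool) \<Rightarrow> (btree \<Rightarrow> bool) \<Rightarrow> btree \<Rightarrow> nat multiset" where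
  "other_sizes L R (Leaf a) = {#}"
| "other_sizes L R (Node l r) =
    (if L (Node l r) then {#} else nonzero (root_size L R l)) + other_sizes L R l +
    (if R (Node l r) then {#} else nonzero (root_size L R r)) + other_sizes L R r"

definition chain_sizes :: "(btree \<Rightarrow> bool) \<Rightarrow> (btree \<Rightarrow> bool) \<Rightarrow> btree \<Rightarrow> nat multiset" where
  "chain_sizes L R t = nonzero (root_size L R t) + other_sizes L R t"

lemma length_root_chain: "length (root_chain L R nm sh t) = root_size L R t"
  by (induction t) auto

lemma mset_nonempty: "mset (map length (nonempty xs)) = nonzero (length xs)"
  by (auto simp: nonempty_def nonzero_def)

text \<open>The lengths do not depend on the names. This transfers the type of a tree, computed with
  paths, to its word, where nodes are letters.\<close>

lemma mset_chains: "mset (map length (chains L R nm sh t)) = chain_sizes L R t"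
proof -
  have cl: "map (length \<circ> map f) xs = map length xs" for f :: "'a \<Rightarrow> 'a" and xs
    by (simp add: comp_def)
  have "mset (map length (other_chains L R nm sh t)) = other_sizes L R t"
    by (induction t) (simp_all add: length_root_chain cl mset_nonempty del: mset_map)
  then show ?thesis
    by (simp add: chains_def chain_sizes_def mset_nonempty length_root_chain del: mset_map)
qed

lemma concat_nonempty [simp]: "concat (nonempty xs) = xs"
  by (simp add: nonempty_def)

lemma mset_concat_chains_Node:
  assumes "\<not> (L (Node l r) \<and> R (Node l r))"
  shows "mset (concat (chains L R nm sh (Node l r))) = add_mset (nm (Node l r))
    (mset (map (sh GoL) (concat (chains L R nm sh l))) + mset (map (sh GoR) (concat (chains L R nm sh r))))"
  using assms by (auto simp: chains_def map_concat)

text \<open>Links connect each list in \<open>bs\<close> and never lead from one list to another, so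
  the lists are the equivalence classes.\<close>

lemma block_sizes_chains:
  assumes "distinct (concat bs)" "set (concat bs) = A" "[] \<notin> set bs"
    and link: "\<And>b. b \<in> set bs \<Longrightarrow> successively R b"
    and closed: "\<And>x y. x \<in> A \<Longrightarrow> y \<in> A \<Longrightarrow> R x y \<Longrightarrow> \<exists>b\<in>set bs. x \<in> set b \<and> y \<in> set b"
  shows "block_sizes A R = mset (map length bs)"
proof -
  define R' where "R' x y \<longleftrightarrow> x \<in> A \<and> y \<in> A \<and> R x y" for x y
  have uniq: "b = b'" if "b \<in> set bs" "b' \<in> set bs" "x \<in> set b" "x \<in> set b'" for b b' x
    using assms(1) that unfolding distinct_concat_iff by blast
  have dist: "distinct bs"
    using assms(1,3) by (auto simp: distinct_concat_iff removeAll_id)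
  have within: "equivclp R' x y" if "b \<in> set bs" "x \<in> set b" "y \<in> set b" for b x y
  proof -
    have hd: "equivclp R' (hd b) x" if "successively R' b" "x \<in> set b" for b x
      using that
    proof (induction b)
      case (Cons a b)
      show ?case
      proof (cases "x = a")
        case False
        with Cons have "b \<noteq> []" "equivclp R' (hd b) x" "R' a (hd b)"
          by (cases b; auto)+
        then show ?thesis by (auto intro: equivclp_trans r_into_equivclp)
      qed simp
    qed simp
    have "successively R' b"
      using link[OF that(1)] that(1) assms(2)
      by (auto simp: R'_def intro: successively_cong[THEN iffD1, rotated -1])
    then show ?thesis using hd that by (meson equivclp_sym equivclp_trans)
  qed
  have stay: "y \<in> set b" if "equivclp R' x y" "x \<in> set b" "b \<in> set bs" for x y b
    using that(1,2)
  proof (induction rule: equivclp_induct)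
    case (step y z)
    then show ?case using closed[of y z] closed[of z y] uniq that(3) unfolding R'_def by blast
  qed
  have cls: "{(x, y). equivclp R' x y} `` {x} = set b" if "b \<in> set bs" "x \<in> set b" for b x
    using within[OF that] stay[OF _ that(2,1)] by auto
  have "A // {(x, y). equivclp R' x y} = set ` set bs"
  proof
    show "A // {(x, y). equivclp R' x y} \<subseteq> set ` set bs"
    proof
      fix X assume "X \<in> A // {(x, y). equivclp R' x y}"
      then obtain x where x: "x \<in> A" "X = {(x, y). equivclp R' x y} `` {x}"
        by (auto simp: quotient_def)
      then obtain b where "b \<in> set bs" "x \<in> set b" using assms(2) by auto
      with cls x show "X \<in> set ` set bs" by auto
    qed
    show "set ` set bs \<subseteq> A // {(x, y). equivclp R' x y}"
    proof
      fix X assume "X \<in> set ` set bs"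
      then obtain b where b: "b \<in> set bs" "X = set b" by auto
      with assms(3) obtain x where "x \<in> set b" by (metis list.set_intros(1) neq_Nil_conv)
      with cls[OF b(1) this] b assms(2) have "x \<in> A" "X = {(x, y). equivclp R' x y} `` {x}" by auto
      then show "X \<in> A // {(x, y). equivclp R' x y}"
        by (simp only: quotientI)
    qed
  qed
  moreover have "inj_on set (set bs)"
    using uniq assms(3) by (intro inj_onI) (metis list.set_intros(1) neq_Nil_conv)
  ultimately have "block_sizes A R = image_mset card (image_mset set (mset_set (set bs)))"
    unfolding block_sizes_def R'_def[symmetric] by (simp only: image_mset_mset_set)
  also have "\<dots> = image_mset length (mset_set (set bs))"
    using assms(1) by (auto simp: multiset.map_comp distinct_card distinct_concat_iff intro: image_mset_cong)
  finally have "block_sizes A R = image_mset length (mset_set (set bs))" .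
  then show ?thesis
    using dist by (simp add: mset_set_set)
qed

text \<open>A sequence of linked letters stays within one list of \<open>bs\<close>, and being
  increasing it is determined by its set of letters. Hence maximality, which is stated through
  inclusion of sets, singles out exactly the lists.\<close>

lemma max_pair_seqs_chains:
  assumes "distinct (concat bs)" "set (concat bs) = set \<theta>" "[] \<notin> set bs"
    and link: "\<And>b. b \<in> set bs \<Longrightarrow> successively (P \<theta>) b"
    and closed: "\<And>x y. P \<theta> x y \<Longrightarrow> \<exists>b\<in>set bs. x \<in> set b \<and> y \<in> set b"
    and asc: "\<And>x y. P \<theta> x y \<Longrightarrow> x < y"
  shows "image_mset length (mset_set {as. max_pair_seq P \<theta> as}) = mset (map length bs)"
proof -
  have uniq: "b = b'" if "b \<in> set bs" "b' \<in> set bs" "x \<in> set b" "x \<in> set b'" for b b' x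
    using assms(1) that unfolding distinct_concat_iff by blast
  have dist: "distinct bs"
    using assms(1,3) by (auto simp: distinct_concat_iff removeAll_id)
  have seq: "pair_seq P \<theta> b" if "b \<in> set bs" for b
    using that assms(2,3) link by (auto simp: pair_seq_def)
  have inside: "\<exists>b\<in>set bs. set as \<subseteq> set b" if "pair_seq P \<theta> as" for as
  proof -
    have "\<exists>b\<in>set bs. set as \<subseteq> set b" if "as \<noteq> []" "set as \<subseteq> set \<theta>" "successively (P \<theta>) as" for as
      using that
    proof (induction as rule: induct_list012)
      case (2 x)
      then show ?case using assms(2) by auto
    next
      case (3 x y zs)
      then obtain b where b: "b \<in> set bs" "set (y # zs) \<subseteq> set b" by auto
      from 3 obtain b' where b': "b' \<in> set bs" "x \<in> set b'" "y \<in> set b'" using closed[of x y] by auto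
      with b uniq[of b b' y] show ?case by auto
    qed simp
    then show ?thesis using that by (auto simp: pair_seq_def)
  qed
  have sorted: "sorted_wrt (<) as" if "successively (P \<theta>) as" for as
  proof -
    have "successively (<) as" using that asc by (rule successively_mono)
    then show ?thesis by (simp add: successively_iff_sorted_wrt_strong)
  qed
  have "{as. max_pair_seq P \<theta> as} = set bs"
  proof (intro equalityI subsetI)
    fix as assume "as \<in> {as. max_pair_seq P \<theta> as}"
    then have as: "pair_seq P \<theta> as" "\<And>cs. pair_seq P \<theta> cs \<Longrightarrow> set as \<subseteq> set cs \<Longrightarrow> cs = as"
      by (auto simp: max_pair_seq_def)
    from inside[OF as(1)] as(2) seq show "as \<in> set bs" by blast
  next
    fix b assume b: "b \<in> set bs"
    have "cs = b" if cs: "pair_seq P \<theta> cs" "set b \<subseteq> set cs" for cs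
    proof -
      from inside[OF cs(1)] obtain b' where b': "b' \<in> set bs" "set cs \<subseteq> set b'" by auto
      from b assms(3) obtain x where "x \<in> set b" by (metis list.set_intros(1) neq_Nil_conv)
      with b b' cs uniq[of b b' x] have "set cs = set b" by auto
      moreover have "sorted_wrt (<) cs" "sorted_wrt (<) b"
        using cs seq[OF b] by (auto simp: pair_seq_def intro: sorted)
      ultimately show ?thesis
        by (metis strict_sorted_equal strict_sorted_iff)
    qed
    with seq[OF b] show "b \<in> {as. max_pair_seq P \<theta> as}" by (auto simp: max_pair_seq_def)
  qed
  then show ?thesis using dist by (simp add: mset_set_set)
qed

abbreviation unlinked :: "btree \<Rightarrow> bool" where
  "unlinked \<equiv> \<lambda>t. False"

abbreviation always :: "btree \<Rightarrow> bool" where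
  "always \<equiv> \<lambda>t. True"

fun non_lyndon :: "btree \<Rightarrow> bool" where
  "non_lyndon (Node (Node ll lr) r) \<longleftrightarrow> \<not> vmin r < vmin lr"
| "non_lyndon t \<longleftrightarrow> False"

lemma root_chain_eq_Nil: "root_chain L R nm sh t = [] \<longleftrightarrow> (\<exists>a. t = Leaf a)"
  by (cases t) auto

lemma hd_root_chain: "root_chain L R nm sh t \<noteq> [] \<Longrightarrow> hd (root_chain L R nm sh t) = nm t"
  by (cases t) auto

section \<open>Chains of nodes named by paths\<close>

lemma linked_path:
  "linked L R (\<lambda>t. []) (#) t p q \<longleftrightarrow>
    (\<exists>l r. subtree t p = Some (Node l r) \<and> (L (Node l r) \<and> q = p @ [GoL] \<or> R (Node l r) \<and> q = p @ [GoR])) \<and>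
    q \<in> internal_nodes t"
proof (induction t arbitrary: p q)
  case (Node l r)
  have root: "[] \<in> internal_nodes s \<longleftrightarrow> \<not> (\<exists>a. s = Leaf a)" for s
    by (cases s) (auto simp: internal_nodes_Node)
  show ?case
  proof (cases p)
    case Nil
    then show ?thesis
      using root[of l] root[of r] hd_root_chain[of L R "\<lambda>t. []" "(#)" l] hd_root_chain[of L R "\<lambda>t. []" "(#)" r]
      by (auto simp: internal_nodes_Node root_chain_eq_Nil)
  next
    case (Cons d p')
    then show ?thesis
      by (cases d) (auto simp: internal_nodes_Node Node.IH)
  qed
qed (auto simp: subtree_Leaf)

lemma chains_path:
  assumes "\<And>t. \<not> (L t \<and> R t)"
  shows "distinct (concat (chains L R (\<lambda>t. []) (#) t)) \<and> set (concat (chains L R (\<lambda>t. []) (#) t)) = internal_nodes t"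
proof (induction t)
  case (Node l r)
  let ?C = "\<lambda>t. concat (chains L R (\<lambda>t. []) (#) t)"
  have m: "mset (?C (Node l r)) = mset ([] # map ((#) GoL) (?C l) @ map ((#) GoR) (?C r))"
    by (subst mset_concat_chains_Node) (use assms in auto)
  have "distinct ([] # map ((#) GoL) (?C l) @ map ((#) GoR) (?C r))"
    using Node by (auto simp: distinct_map)
  then show ?case
    using mset_eq_imp_distinct_iff[OF m] mset_eq_setD[OF m] Node by (auto simp: internal_nodes_Node)
qed (simp add: chains_def nonempty_def)

lemma block_sizes_paths:
  assumes "\<And>t. \<not> (L t \<and> R t)"
    and "\<And>p q. p \<in> internal_nodes t \<Longrightarrow> q \<in> internal_nodes t \<Longrightarrow> Q p q \<longleftrightarrow>
      (\<exists>l r. subtree t p = Some (Node l r) \<and> (L (Node l r) \<and> q = p @ [GoL] \<or> R (Node l r) \<and> q = p @ [GoR]))"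
  shows "block_sizes (internal_nodes t) Q = chain_sizes L R t"
proof -
  let ?bs = "chains L R (\<lambda>t. []) (#) t"
  have lk: "linked L R (\<lambda>t. []) (#) t p q \<longleftrightarrow> p \<in> internal_nodes t \<and> q \<in> internal_nodes t \<and> Q p q" for p q
    using assms(2)[of p q] unfolding linked_path by (auto simp: internal_nodes_def)
  have "block_sizes (internal_nodes t) Q = mset (map length ?bs)"
  proof (rule block_sizes_chains)
    show "distinct (concat ?bs)" "set (concat ?bs) = internal_nodes t"
      using chains_path[of L R t, OF assms(1)] by blast+
    show "[] \<notin> set ?bs" by (rule chains_nonempty)
    show "successively Q b" if "b \<in> set ?bs" for b
      using chains_linked[of L R, OF assms(1) that] by (rule successively_mono) (simp add: lk)
    show "\<exists>b\<in>set ?bs. x \<in> set b \<and> y \<in> set b"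
      if "x \<in> internal_nodes t" "y \<in> internal_nodes t" "Q x y" for x y
      using that by (intro linked_chains) (simp add: lk)
  qed
  then show ?thesis by (simp only: mset_chains)
qed

lemma lambda_Lyn_eq: "lambda_Lyn t = chain_sizes non_lyndon unlinked t"
  unfolding lambda_Lyn_def
proof (rule block_sizes_paths)
  have nl: "\<not> lyndon_node t p \<longleftrightarrow> non_lyndon (Node l r)" if "subtree t p = Some (Node l r)" for p l r
    using that by (cases l) (auto simp: lyndon_node_def)
  show "(\<not> lyndon_node t p \<and> q = p @ [GoL]) \<longleftrightarrow> (\<exists>l r. subtree t p = Some (Node l r) \<and>
      (non_lyndon (Node l r) \<and> q = p @ [GoL] \<or> False \<and> q = p @ [GoR]))"
    if "p \<in> internal_nodes t" for p q
    using that nl[of p] by (auto simp: internal_nodes_def)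
qed auto

lemma lambda_Comb_eq: "lambda_Comb t = chain_sizes unlinked always t"
  unfolding lambda_Comb_def by (rule block_sizes_paths) (auto simp: internal_nodes_def)

section \<open>Stirling permutations and normalized trees\<close>

text \<open>
  An internal node with right child \<open>r\<close> corresponds to the letter \<open>vmin r - 1\<close>: the minimum of a
  tree on \<open>{1..n}\<close> is never the minimum of a right child, and letters run from \<open>1\<close> to \<open>n - 1\<close>.
\<close>

primrec word :: "btree \<Rightarrow> nat list" where
  "word (Leaf a) = []"
| "word (Node l r) = word l @ (vmin r - 1) # word r @ [vmin r - 1]"

primrec letter :: "btree \<Rightarrow> nat" where
  "letter (Leaf a) = 0"
| "letter (Node l r) = vmin r - 1"

abbreviation same :: "dir \<Rightarrow> nat \<Rightarrow> nat" where
  "same \<equiv> \<lambda>d x. x"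

lemma word_eq_Nil [simp]: "word t = [] \<longleftrightarrow> (\<exists>a. t = Leaf a)"
  by (cases t) auto

lemma last_word: "word t \<noteq> [] \<Longrightarrow> last (word t) = letter t"
  by (cases t) auto

text \<open>Every label except the minimum of the tree is the minimum of the right subtree of some
  node. Labels are positive, so subtracting 1 loses nothing.\<close>

lemma set_word:
  assumes "nor t" "0 \<notin> set (leaf_labels t)"
  shows "set (word t) = {x. Suc x \<in> set (leaf_labels t) \<and> Suc x \<noteq> vmin t}"
  using assms
proof (induction t)
  case (Node l r)
  have v: "vmin (Node l r) = vmin l" "vmin r \<in> set (leaf_labels r)" "vmin l \<in> set (leaf_labels l)"
    using Node.prems by (auto simp: nor_vmin vmin_in)
  then obtain c where c: "vmin r = Suc c" using Node.prems by (cases "vmin r") auto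
  show ?case
    using Node v c by auto
qed auto

lemma word_Node_disjoint:
  assumes "nor (Node l r)" "0 \<notin> set (leaf_labels (Node l r))"
  shows "set (word l) \<inter> set (word r) = {}" "vmin r - 1 \<notin> set (word l)"
    "\<And>x. x \<in> set (word r) \<Longrightarrow> vmin r - 1 < x" "vmin r - 1 \<notin> set (word r)"
proof -
  have w: "set (word l) = {x. Suc x \<in> set (leaf_labels l) \<and> Suc x \<noteq> vmin l}"
    "set (word r) = {x. Suc x \<in> set (leaf_labels r) \<and> Suc x \<noteq> vmin r}"
    using assms by (auto intro!: set_word)
  obtain c where c: "vmin r = Suc c" using assms vmin_in[of r] by (cases "vmin r") auto
  show "set (word l) \<inter> set (word r) = {}" "vmin r - 1 \<notin> set (word l)"
    using assms c vmin_in[of r] by (auto simp: w)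
  show *: "vmin r - 1 < x" if "x \<in> set (word r)" for x
    using that vmin_le[of "Suc x" r] c by (auto simp: w)
  show "vmin r - 1 \<notin> set (word r)" using * by blast
qed

lemma chains_letter:
  assumes "\<And>t. \<not> (L t \<and> R t)" "nor t" "0 \<notin> set (leaf_labels t)"
  shows "distinct (concat (chains L R letter same t)) \<and> set (concat (chains L R letter same t)) = set (word t)"
  using assms(2,3)
proof (induction t)
  case (Node l r)
  let ?C = "\<lambda>t. concat (chains L R letter same t)"
  have m: "mset (?C (Node l r)) = mset ((vmin r - 1) # ?C l @ ?C r)"
    by (subst mset_concat_chains_Node) (use assms in auto)
  have "distinct ((vmin r - 1) # ?C l @ ?C r)"
    using Node word_Node_disjoint[OF Node.prems] by auto
  then show ?case
    using mset_eq_imp_distinct_iff[OF m] mset_eq_setD[OF m] Node by auto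
qed (simp add: chains_def nonempty_def)

section \<open>Positions of letters in the word of a tree\<close>

lemma occ_append:
  assumes "a \<in> set (xs @ ys)"
  shows "first_occ (xs @ ys) a = (if a \<in> set xs then first_occ xs a else length xs + first_occ ys a)"
    "second_occ (xs @ ys) a = (if a \<in> set ys then length xs + second_occ ys a else second_occ xs a)"
proof -
  let ?I = "\<lambda>xs. {i. i < length xs \<and> xs ! i = a}"
  have I: "?I (xs @ ys) = ?I xs \<union> (+) (length xs) ` ?I ys"
  proof (intro equalityI subsetI)
    fix i assume i: "i \<in> ?I (xs @ ys)"
    show "i \<in> ?I xs \<union> (+) (length xs) ` ?I ys"
    proof (cases "i < length xs")
      case False
      with i have "i - length xs \<in> ?I ys" "i = length xs + (i - length xs)"
        by (auto simp: nth_append)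
      then show ?thesis by blast
    qed (use i in \<open>auto simp: nth_append\<close>)
  qed (auto simp: nth_append)
  have fin: "finite (?I zs)" for zs by auto
  have ne: "?I zs \<noteq> {} \<longleftrightarrow> a \<in> set zs" for zs by (auto simp: in_set_conv_nth)
  have mono: "Min ((+) n ` A) = n + Min A" "Max ((+) n ` A) = n + Max A" if "finite A" "A \<noteq> {}" for n :: nat and A
    using that mono_Min_commute[of "(+) n" A] mono_Max_commute[of "(+) n" A] by (auto simp: mono_def)
  show "first_occ (xs @ ys) a = (if a \<in> set xs then first_occ xs a else length xs + first_occ ys a)"
  proof (cases "a \<in> set xs")
    case True
    have "Min (?I xs \<union> (+) (length xs) ` ?I ys) = Min (?I xs)"
    proof (rule Min_eqI)
      have "Min (?I xs) \<in> ?I xs" using True ne fin Min_in by blast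
      then show "Min (?I xs) \<in> ?I xs \<union> (+) (length xs) ` ?I ys" by blast
      fix y assume "y \<in> ?I xs \<union> (+) (length xs) ` ?I ys"
      then show "Min (?I xs) \<le> y"
        using \<open>Min (?I xs) \<in> ?I xs\<close> by (auto intro: Min_le)
    qed auto
    then show ?thesis unfolding first_occ_def I using True by simp
  next
    case False
    then have e: "?I xs = {}" "?I ys \<noteq> {}" using assms ne[of xs] ne[of ys] by auto
    have "Min (?I xs \<union> (+) (length xs) ` ?I ys) = length xs + Min (?I ys)"
      unfolding e(1) using mono(1)[OF fin e(2)] by (simp only: Un_empty_left)
    then show ?thesis unfolding first_occ_def I using False by simp
  qed
  show "second_occ (xs @ ys) a = (if a \<in> set ys then length xs + second_occ ys a else second_occ xs a)"
  proof (cases "a \<in> set ys")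
    case True
    have "Max (?I xs \<union> (+) (length xs) ` ?I ys) = length xs + Max (?I ys)"
    proof (rule Max_eqI)
      have m: "Max (?I ys) \<in> ?I ys" using True ne fin Max_in by blast
      then show "length xs + Max (?I ys) \<in> ?I xs \<union> (+) (length xs) ` ?I ys" by blast
      fix y assume "y \<in> ?I xs \<union> (+) (length xs) ` ?I ys"
      then show "y \<le> length xs + Max (?I ys)"
        using Max_ge[OF fin[of ys]] by auto
    qed auto
    then show ?thesis unfolding second_occ_def I using True by simp
  next
    case False
    then have e: "?I ys = {}" using ne[of ys] by auto
    have "Max (?I xs \<union> (+) (length xs) ` ?I ys) = Max (?I xs)"
      unfolding e by (simp only: image_empty Un_empty_right)
    then show ?thesis unfolding second_occ_def I using False by simp
  qed
qed

lemma occ_less: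
  assumes "a \<in> set xs"
  shows "first_occ xs a < length xs" "second_occ xs a < length xs"
proof -
  let ?I = "{i. i < length xs \<and> xs ! i = a}"
  have "finite ?I" "?I \<noteq> {}" using assms by (auto simp: in_set_conv_nth)
  from Min_in[OF this] Max_in[OF this] show "first_occ xs a < length xs" "second_occ xs a < length xs"
    by (auto simp: first_occ_def second_occ_def)
qed

lemma occ_single [simp]: "first_occ [a] a = 0" "second_occ [a] a = 0"
proof -
  have "{i. i < length [a] \<and> [a] ! i = a} = {0}" by auto
  then show "first_occ [a] a = 0" "second_occ [a] a = 0" by (simp_all only: first_occ_def second_occ_def Min_singleton Max_singleton)
qed

lemma second_occ_last:
  assumes "a \<in> set xs"
  shows "Suc (second_occ xs a) = length xs \<longleftrightarrow> a = last xs"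
proof -
  obtain ys b where xs: "xs = ys @ [b]" using assms by (cases xs rule: rev_cases) auto
  show ?thesis
    using assms occ_less(2)[of a ys] unfolding xs by (subst occ_append) auto
qed

lemma occ_word_Node:
  assumes "nor (Node l r)" "0 \<notin> set (leaf_labels (Node l r))"
  shows
    "x \<in> set (word l) \<Longrightarrow> first_occ (word (Node l r)) x = first_occ (word l) x \<and>
       second_occ (word (Node l r)) x = second_occ (word l) x"
    "x \<in> set (word r) \<Longrightarrow> first_occ (word (Node l r)) x = Suc (length (word l) + first_occ (word r) x) \<and>
       second_occ (word (Node l r)) x = Suc (length (word l) + second_occ (word r) x)"
    "first_occ (word (Node l r)) (vmin r - 1) = length (word l) \<and>
       second_occ (word (Node l r)) (vmin r - 1) = Suc (length (word l) + length (word r))"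
proof -
  note d = word_Node_disjoint[OF assms]
  let ?u = "word l" and ?c = "vmin r - 1" and ?v = "word r"
  have w: "word (Node l r) = ?u @ ?c # ?v @ [?c]" by simp
  have e: "x \<in> set (?u @ [?c] @ ?v @ [?c]) \<Longrightarrow>
      first_occ (?u @ [?c] @ ?v @ [?c]) x =
        (if x \<in> set ?u then first_occ ?u x else length ?u + first_occ ([?c] @ ?v @ [?c]) x) \<and>
      second_occ (?u @ [?c] @ ?v @ [?c]) x =
        (if x \<in> set ([?c] @ ?v @ [?c]) then length ?u + second_occ ([?c] @ ?v @ [?c]) x else second_occ ?u x)"
    "x \<in> set ([?c] @ ?v @ [?c]) \<Longrightarrow>
      first_occ ([?c] @ ?v @ [?c]) x =
        (if x \<in> set [?c] then first_occ [?c] x else length [?c] + first_occ (?v @ [?c]) x) \<and>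
      second_occ ([?c] @ ?v @ [?c]) x =
        (if x \<in> set (?v @ [?c]) then length [?c] + second_occ (?v @ [?c]) x else second_occ [?c] x)"
    "x \<in> set (?v @ [?c]) \<Longrightarrow>
      first_occ (?v @ [?c]) x = (if x \<in> set ?v then first_occ ?v x else length ?v + first_occ [?c] x) \<and>
      second_occ (?v @ [?c]) x = (if x \<in> set [?c] then length ?v + second_occ [?c] x else second_occ ?v x)" for x
    using occ_append by blast+
  show "first_occ (word (Node l r)) x = first_occ (word l) x \<and>
       second_occ (word (Node l r)) x = second_occ (word l) x" if "x \<in> set (word l)"
  proof -
    have "x \<noteq> ?c" "x \<notin> set ?v" using d that by auto
    then show ?thesis using e(1)[of x] that unfolding w by simp
  qed
  show "first_occ (word (Node l r)) x = Suc (length (word l) + first_occ (word r) x) \<and>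
       second_occ (word (Node l r)) x = Suc (length (word l) + second_occ (word r) x)" if "x \<in> set (word r)"
  proof -
    have "x \<noteq> ?c" "x \<notin> set ?u" using d that by auto
    then show ?thesis using e[of x] that unfolding w by simp
  qed
  show "first_occ (word (Node l r)) (vmin r - 1) = length (word l) \<and>
       second_occ (word (Node l r)) (vmin r - 1) = Suc (length (word l) + length (word r))"
    using e[of ?c] d(2,4) unfolding w by simp
qed

text \<open>The letter of a root is the last one of its word, so links to the children can be read
  off at the ends of the words of the subtrees.\<close>

lemma linked_letter:
  assumes "nor (Node l r)"
  shows "linked L R letter same (Node l r) x y \<longleftrightarrow>
    linked L R letter same l x y \<or> linked L R letter same r x y \<or>
    x = vmin r - 1 \<and> (L (Node l r) \<and> word l \<noteq> [] \<and> y = last (word l) \<or>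
                         R (Node l r) \<and> word r \<noteq> [] \<and> y = last (word r))"
  using hd_root_chain[of L R letter same l] hd_root_chain[of L R letter same r] last_word[of l] last_word[of r]
  by (auto simp: root_chain_eq_Nil)

text \<open>In \<open>u c v c\<close> the only new place where a second occurrence can meet a first
  one is between \<open>u\<close> and the first \<open>c\<close>. The pair ascends there iff the
  last letter of \<open>u\<close>, that of the left child, is below \<open>c\<close>, which says
  that the root is not Lyndon. The child comes first, hence the exchange of \<open>x\<close> and
  \<open>y\<close>.\<close>

lemma asc_adj_pair_word:
  assumes "nor t" "0 \<notin> set (leaf_labels t)"
  shows "asc_adj_pair (word t) x y \<longleftrightarrow> linked non_lyndon unlinked letter same t y x"
  using assms
proof (induction t arbitrary: x y)
  case (Leaf a)
  then show ?case by (simp add: asc_adj_pair_def)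
next
  case (Node l r)
  let ?w = "word (Node l r)" and ?u = "word l" and ?v = "word r" and ?c = "vmin r - 1"
  note d = word_Node_disjoint[OF Node.prems]
  note o = occ_word_Node[OF Node.prems]
  have set: "set ?w = insert ?c (set ?u \<union> set ?v)" by auto
  have IH: "asc_adj_pair ?u x y \<longleftrightarrow> linked non_lyndon unlinked letter same l y x"
    "asc_adj_pair ?v x y \<longleftrightarrow> linked non_lyndon unlinked letter same r y x"
    using Node by auto
  have nl: "non_lyndon (Node l r) \<longleftrightarrow> last ?u < ?c" if ne: "?u \<noteq> []"
  proof -
    obtain ll lr where l: "l = Node ll lr" using ne by (cases l) auto
    have "vmin lr \<noteq> vmin r" "vmin lr \<noteq> 0" "vmin r \<noteq> 0"
      using Node.prems vmin_in[of lr] vmin_in[of r] unfolding l by (auto simp: disjoint_iff)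
    then show ?thesis unfolding l by auto
  qed
  have "asc_adj_pair ?w x y \<longleftrightarrow> asc_adj_pair ?u x y \<or> asc_adj_pair ?v x y \<or>
      (?u \<noteq> [] \<and> x = last ?u \<and> y = ?c \<and> last ?u < ?c)"
  proof (cases "x \<in> set ?w \<and> y \<in> set ?w")
    case True
    then consider "x \<in> set ?u" "y \<in> set ?u" | "x \<in> set ?u" "y = ?c" | "x \<in> set ?u" "y \<in> set ?v"
      | "x = ?c" "y \<in> set ?w" | "x \<in> set ?v" "y \<in> set ?u" | "x \<in> set ?v" "y = ?c"
      | "x \<in> set ?v" "y \<in> set ?v"
      by (auto simp: set)
    then show ?thesis
    proof cases
      case 1
      then have "x \<notin> set ?v" "y \<noteq> ?c" using d by auto
      then show ?thesis using 1 True o(1)[of x] o(1)[of y] by (auto simp: asc_adj_pair_def)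
    next
      case 2
      then have "x \<notin> set ?v" "y \<notin> set ?u" "y \<notin> set ?v" "?u \<noteq> []" using d by auto
      then show ?thesis
        using 2 True o(1)[of x] o(3) second_occ_last[of x ?u] by (auto simp: asc_adj_pair_def simp del: word.simps)
    next
      case 3
      then have "x \<notin> set ?v" "y \<notin> set ?u" "y \<noteq> ?c" using d by auto
      then show ?thesis
        using 3 True o(1)[of x] o(2)[of y] occ_less[of x ?u] by (auto simp: asc_adj_pair_def simp del: word.simps)
    next
      case 4
      then have "x \<notin> set ?u" "x \<notin> set ?v" using d by auto
      moreover have "last ?u \<noteq> ?c \<or> ?u = []" using d(2) last_in_set by metis
      moreover have "first_occ ?w y < length ?w" using occ_less[OF 4(2)] by simp
      ultimately show ?thesis
        using 4 o(3) by (auto simp: asc_adj_pair_def)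
    next
      case 5
      then have "x \<notin> set ?u" "y \<notin> set ?v" "y \<noteq> ?c" using d by auto
      then show ?thesis
        using 5 True o(2)[of x] o(1)[of y] occ_less[of y ?u] by (auto simp: asc_adj_pair_def simp del: word.simps)
    next
      case 6
      then have "x \<notin> set ?u" "y \<notin> set ?u" "y \<notin> set ?v" using d by auto
      moreover from this have "?u = [] \<or> last ?u \<noteq> x" using last_in_set by metis
      ultimately show ?thesis
        using 6 True o(2)[of x] o(3) by (auto simp: asc_adj_pair_def simp del: word.simps)
    next
      case 7
      then have "x \<notin> set ?u" "y \<noteq> ?c" using d by auto
      then show ?thesis using 7 True o(2)[of x] o(2)[of y] by (auto simp: asc_adj_pair_def)
    qed
  next
    case False
    then show ?thesis using last_in_set[of ?u] by (auto simp: asc_adj_pair_def)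
  qed
  then show ?case
    unfolding linked_letter[OF Node.prems(1)] IH using nl by (auto simp del: word.simps)
qed

text \<open>In \<open>u c v c\<close> the only new pair of adjacent second occurrences is the end of
  \<open>v\<close> followed by the second \<open>c\<close>; it is always nested, since the letters
  of \<open>v\<close> exceed \<open>c\<close>.\<close>

lemma term_nested_pair_word:
  assumes "nor t" "0 \<notin> set (leaf_labels t)"
  shows "term_nested_pair (word t) x y \<longleftrightarrow> linked unlinked always letter same t x y"
  using assms
proof (induction t arbitrary: x y)
  case (Leaf a)
  then show ?case by (simp add: term_nested_pair_def)
next
  case (Node l r)
  let ?w = "word (Node l r)" and ?u = "word l" and ?v = "word r" and ?c = "vmin r - 1"
  note d = word_Node_disjoint[OF Node.prems]
  note o = occ_word_Node[OF Node.prems]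
  have set: "set ?w = insert ?c (set ?u \<union> set ?v)" by auto
  have IH: "term_nested_pair ?u x y \<longleftrightarrow> linked unlinked always letter same l x y"
    "term_nested_pair ?v x y \<longleftrightarrow> linked unlinked always letter same r x y"
    using Node by auto
  have "term_nested_pair ?w x y \<longleftrightarrow> term_nested_pair ?u x y \<or> term_nested_pair ?v x y \<or>
      (?v \<noteq> [] \<and> x = ?c \<and> y = last ?v)"
  proof (cases "x \<in> set ?w \<and> y \<in> set ?w")
    case True
    then consider "x \<in> set ?u" "y \<in> set ?u" | "x = ?c" "y \<in> set ?u" | "x = ?c" "y \<in> set ?v"
      | "x \<in> set ?w" "y = ?c" | "x \<in> set ?v" "y \<in> set ?u" | "x \<in> set ?u" "y \<in> set ?v"
      | "x \<in> set ?v" "y \<in> set ?v"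
      by (auto simp: set)
    then show ?thesis
    proof cases
      case 1
      then have "x \<notin> set ?v" "x \<noteq> ?c" using d by auto
      then show ?thesis using 1 True o(1)[of x] o(1)[of y] by (auto simp: term_nested_pair_def)
    next
      case 2
      then have "x \<notin> set ?v" "x \<notin> set ?u" "y \<notin> set ?v" "?v = [] \<or> y \<noteq> last ?v"
        using d last_in_set[of ?v] by auto
      then show ?thesis
        using 2 True o(1)[of y] o(3) occ_less[of y ?u] by (auto simp: term_nested_pair_def simp del: word.simps)
    next
      case 3
      then have "x \<notin> set ?v" "x \<notin> set ?u" "?v \<noteq> []" "x < y" using d by auto
      then show ?thesis
        using 3 True o(2)[of y] o(3) second_occ_last[of y ?v] by (auto simp: term_nested_pair_def simp del: word.simps)
    next
      case 4
      then have "y \<notin> set ?u" "y \<notin> set ?v" "?v = [] \<or> y \<noteq> last ?v" using d last_in_set[of ?v] by auto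
      moreover have "second_occ ?w x < length ?w" using occ_less[OF 4(1)] by simp
      ultimately show ?thesis
        using 4 o(3) by (auto simp: term_nested_pair_def)
    next
      case 5
      then have "x \<notin> set ?u" "y \<notin> set ?v" "x \<noteq> ?c" using d by auto
      then show ?thesis
        using 5 True o(2)[of x] o(1)[of y] occ_less[of y ?u] by (auto simp: term_nested_pair_def simp del: word.simps)
    next
      case 6
      then have "x \<notin> set ?v" "y \<notin> set ?u" "x \<noteq> ?c" using d by auto
      then show ?thesis
        using 6 True o(2)[of y] o(1)[of x] occ_less[of x ?u] by (auto simp: term_nested_pair_def simp del: word.simps)
    next
      case 7
      then have "x \<notin> set ?u" "x \<noteq> ?c" using d by auto
      then show ?thesis using 7 True o(2)[of x] o(2)[of y] by (auto simp: term_nested_pair_def)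
    qed
  next
    case False
    then show ?thesis using last_in_set[of ?v] by (auto simp: term_nested_pair_def)
  qed
  then show ?case
    unfolding linked_letter[OF Node.prems(1)] IH by (auto simp del: word.simps)
qed

lemma lambda_AA_word:
  assumes "nor t" "0 \<notin> set (leaf_labels t)"
  shows "lambda_AA (word t) = lambda_Lyn t"
proof -
  let ?bs = "chains non_lyndon unlinked letter same t"
  have c: "distinct (concat ?bs)" "set (concat ?bs) = set (word t)"
    using chains_letter[of non_lyndon unlinked, OF _ assms] by auto
  \<comment> \<open>Chains run from a node to its left child, whose letter is smaller, so ascending
    sequences are reversed chains.\<close>
  have "lambda_AA (word t) = mset (map length (map rev ?bs))"
    unfolding lambda_AA_def
  proof (rule max_pair_seqs_chains)
    have "mset (concat (map rev xs)) = mset (concat xs)" for xs :: "nat list list"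
      by (induction xs) auto
    from mset_eq_imp_distinct_iff[OF this] mset_eq_setD[OF this]
    show "distinct (concat (map rev ?bs))" "set (concat (map rev ?bs)) = set (word t)"
      using c by auto
    show "[] \<notin> set (map rev ?bs)"
      using chains_nonempty[of non_lyndon unlinked letter same t] by auto
    show "successively (asc_adj_pair (word t)) b" if b: "b \<in> set (map rev ?bs)" for b
    proof -
      obtain b' where b': "b = rev b'" "b' \<in> set ?bs" using b by auto
      from chains_linked[of non_lyndon unlinked, OF _ b'(2)]
      show ?thesis unfolding b'(1) by (simp add: asc_adj_pair_word[OF assms])
    qed
    show "\<exists>b\<in>set (map rev ?bs). x \<in> set b \<and> y \<in> set b" if "asc_adj_pair (word t) x y" for x y
      using linked_chains[OF that[unfolded asc_adj_pair_word[OF assms]]] by auto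
    show "x < y" if "asc_adj_pair (word t) x y" for x y
      using that by (simp add: asc_adj_pair_def)
  qed
  also have "map length (map rev ?bs) = map length ?bs"
    by (simp add: comp_def)
  finally show ?thesis by (simp only: mset_chains lambda_Lyn_eq)
qed

lemma lambda_TN_word:
  assumes "nor t" "0 \<notin> set (leaf_labels t)"
  shows "lambda_TN (word t) = lambda_Comb t"
proof -
  let ?bs = "chains unlinked always letter same t"
  have "lambda_TN (word t) = mset (map length ?bs)"
    unfolding lambda_TN_def
  proof (rule max_pair_seqs_chains)
    show "distinct (concat ?bs)" "set (concat ?bs) = set (word t)"
      using chains_letter[of unlinked always, OF _ assms] by auto
    show "[] \<notin> set ?bs" by (rule chains_nonempty)
    show "successively (term_nested_pair (word t)) b" if b: "b \<in> set ?bs" for b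
      using chains_linked[of unlinked always, OF _ b]
      by (rule successively_mono) (simp_all add: term_nested_pair_word[OF assms])
    show "\<exists>b\<in>set ?bs. x \<in> set b \<and> y \<in> set b" if "term_nested_pair (word t) x y" for x y
      using linked_chains[OF that[unfolded term_nested_pair_word[OF assms]]] by auto
    show "x < y" if "term_nested_pair (word t) x y" for x y
      using that by (simp add: term_nested_pair_def)
  qed
  then show ?thesis by (simp only: mset_chains lambda_Comb_eq)
qed

section \<open>Stirling permutations as words of trees\<close>

primrec nested :: "nat list \<Rightarrow> bool" where
  "nested [] \<longleftrightarrow> True"
| "nested (a # xs) \<longleftrightarrow> nested xs \<and> (\<forall>ys zs. xs = ys @ a # zs \<longrightarrow> (\<forall>y\<in>set ys. a < y))"

lemma nested_iff:
  "nested \<theta> \<longleftrightarrow> (\<forall>i j k. i < k \<and> k < j \<and> j < length \<theta> \<and> \<theta> ! i = \<theta> ! j \<longrightarrow> \<theta> ! k > \<theta> ! i)"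
proof (induction \<theta>)
  case (Cons a xs)
  let ?P = "\<lambda>xs. \<forall>i j k. i < k \<and> k < j \<and> j < length xs \<and> xs ! i = xs ! j \<longrightarrow> xs ! k > xs ! i"
  have "?P (a # xs) \<longleftrightarrow> ?P xs \<and> (\<forall>j k. k < j \<and> j < length xs \<and> a = xs ! j \<longrightarrow> xs ! k > a)"
  proof (intro iffI conjI allI impI)
    fix i j k assume P: "?P (a # xs)"
    show "xs ! k > xs ! i" if "i < k \<and> k < j \<and> j < length xs \<and> xs ! i = xs ! j"
      using P[rule_format, of "Suc i" "Suc k" "Suc j"] that by auto
    show "xs ! k > a" if "k < j \<and> j < length xs \<and> a = xs ! j"
      using P[rule_format, of 0 "Suc k" "Suc j"] that by auto
  next
    fix i j k assume P: "?P xs \<and> (\<forall>j k. k < j \<and> j < length xs \<and> a = xs ! j \<longrightarrow> xs ! k > a)"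
      and "i < k \<and> k < j \<and> j < length (a # xs) \<and> (a # xs) ! i = (a # xs) ! j"
    then show "(a # xs) ! k > (a # xs) ! i"
      by (cases i; cases j; cases k) auto
  qed
  also have "(\<forall>j k. k < j \<and> j < length xs \<and> a = xs ! j \<longrightarrow> xs ! k > a) \<longleftrightarrow>
    (\<forall>ys zs. xs = ys @ a # zs \<longrightarrow> (\<forall>y\<in>set ys. a < y))"
  proof (intro iffI allI impI ballI)
    fix ys zs y assume H: "\<forall>j k. k < j \<and> j < length xs \<and> a = xs ! j \<longrightarrow> xs ! k > a" and "xs = ys @ a # zs" "y \<in> set ys"
    then obtain i where "i < length ys" "y = ys ! i" by (auto simp: in_set_conv_nth)
    then show "a < y"
      using H[rule_format, of i "length ys"] \<open>xs = ys @ a # zs\<close> by (auto simp: nth_append)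
  next
    fix j k assume H: "\<forall>ys zs. xs = ys @ a # zs \<longrightarrow> (\<forall>y\<in>set ys. a < y)" and j: "k < j \<and> j < length xs \<and> a = xs ! j"
    then have "xs = take j xs @ a # drop (Suc j) xs" by (simp add: id_take_nth_drop)
    with H have "\<forall>y\<in>set (take j xs). a < y" by blast
    moreover have "xs ! k \<in> set (take j xs)" using j by (auto simp: in_set_conv_nth intro!: exI[of _ k])
    ultimately show "xs ! k > a" by blast
  qed
  finally show ?case using Cons.IH by simp
qed simp

lemma nested_append:
  assumes "set xs \<inter> set ys = {}"
  shows "nested (xs @ ys) \<longleftrightarrow> nested xs \<and> nested ys"
  using assms
proof (induction xs)
  case (Cons a xs)
  have "(\<forall>us zs. xs @ ys = us @ a # zs \<longrightarrow> (\<forall>y\<in>set us. a < y)) \<longleftrightarrow>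
    (\<forall>us zs. xs = us @ a # zs \<longrightarrow> (\<forall>y\<in>set us. a < y))"
  proof (intro iffI allI impI)
    fix us zs assume H: "\<forall>us zs. xs @ ys = us @ a # zs \<longrightarrow> (\<forall>y\<in>set us. a < y)" "xs = us @ a # zs"
    then have "xs @ ys = us @ a # (zs @ ys)" by simp
    with H(1) show "\<forall>y\<in>set us. a < y" by blast
  next
    fix us zs assume H: "\<forall>us zs. xs = us @ a # zs \<longrightarrow> (\<forall>y\<in>set us. a < y)" "xs @ ys = us @ a # zs"
    have "a \<notin> set ys" using Cons.prems by auto
    then have "\<exists>zs'. xs = us @ a # zs'"
      using H(2) by (auto simp: append_eq_append_conv2 append_eq_Cons_conv)
    with H(1) show "\<forall>y\<in>set us. a < y" by blast
  qed
  then show ?case using Cons by auto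
qed simp

lemma nested_between: "nested (ps @ a # qs @ a # zs) \<Longrightarrow> y \<in> set qs \<Longrightarrow> a < y"
  by (induction ps) auto

lemma nested_join:
  assumes "set u \<inter> set v = {}" "c \<notin> set u" "c \<notin> set v"
  shows "nested (u @ c # v @ [c]) \<longleftrightarrow> nested u \<and> nested v \<and> (\<forall>y\<in>set v. c < y)"
proof -
  have "(\<forall>ys zs. v @ [c] = ys @ c # zs \<longrightarrow> (\<forall>y\<in>set ys. c < y)) \<longleftrightarrow> (\<forall>y\<in>set v. c < y)"
  proof (intro iffI allI impI)
    fix ys zs assume "\<forall>y\<in>set v. c < y" "v @ [c] = ys @ c # zs"
    then show "\<forall>y\<in>set ys. c < y"
      by (cases zs rule: rev_cases) auto
  qed auto
  then show ?thesis
    using assms by (simp add: nested_append)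
qed

definition double :: "nat list \<Rightarrow> bool" where
  "double \<theta> \<longleftrightarrow> (\<forall>x\<in>set \<theta>. count (mset \<theta>) x = 2)"

lemma Stirling_perms_eq: "Stirling_perms m = {\<theta>. set \<theta> = {1..m} \<and> double \<theta> \<and> nested \<theta>}"
proof -
  have "mset \<theta> = mset_set A + mset_set A \<longleftrightarrow> set \<theta> = A \<and> double \<theta>" if "finite A" for \<theta> and A :: "nat set"
  proof
    assume m: "mset \<theta> = mset_set A + mset_set A"
    have "set \<theta> = A" using arg_cong[OF m, of set_mset] that by simp
    then show "set \<theta> = A \<and> double \<theta>" using that by (auto simp: double_def m)
  next
    assume "set \<theta> = A \<and> double \<theta>"
    then show "mset \<theta> = mset_set A + mset_set A"
      by (intro multiset_eqI) (auto simp: double_def count_mset_set' count_eq_zero_iff not_in_iff)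
  qed
  then show ?thesis by (auto simp: Stirling_perms_def nested_iff)
qed

lemma double_nested_word:
  assumes "nor t" "0 \<notin> set (leaf_labels t)"
  shows "double (word t) \<and> nested (word t)"
  using assms
proof (induction t)
  case (Node l r)
  note d = word_Node_disjoint[OF Node.prems]
  have "double (word l)" "double (word r)" "nested (word l)" "nested (word r)" using Node by auto
  moreover have "count (mset (word l)) x = 0" if "x \<notin> set (word l)" for x using that by (simp add: count_eq_zero_iff)
  moreover have "count (mset (word r)) x = 0" if "x \<notin> set (word r)" for x using that by (simp add: count_eq_zero_iff)
  ultimately show ?case
    using d nested_join[of "word l" "word r" "vmin r - 1"] by (auto simp: double_def)
qed (simp add: double_def)

text \<open>The last letter belongs to the root, and its other occurrence separates the words of the
  subtrees. The minimum is prescribed because every leaf has the empty word.\<close>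

lemma word_inject:
  assumes "nor s" "nor t" "0 \<notin> set (leaf_labels s)" "0 \<notin> set (leaf_labels t)"
    "vmin s = vmin t" "word s = word t"
  shows "s = t"
  using assms
proof (induction s arbitrary: t)
  case (Leaf a)
  then show ?case by (cases t) auto
next
  case (Node l r)
  then obtain l' r' where t: "t = Node l' r'" by (cases t) auto
  let ?c = "vmin r - 1" and ?c' = "vmin r' - 1"
  have "(word l @ ?c # word r) @ [?c] = (word l' @ ?c' # word r') @ [?c']"
    using Node.prems(6) by (simp only: t word.simps append_assoc append_Cons)
  then have c: "?c = ?c'" and w: "word l @ ?c # word r = word l' @ ?c' # word r'"
    unfolding append1_eq_conv by blast+
  have "?c \<notin> set (word l)" "?c \<notin> set (word r)" "?c' \<notin> set (word l')" "?c' \<notin> set (word r')"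
    using word_Node_disjoint[of l r] word_Node_disjoint[of l' r'] Node.prems t by auto
  with w c have "word l = word l'" "word r = word r'"
    by (auto simp: append_Cons_eq_iff)
  moreover have "vmin r = vmin r'"
    using c vmin_in[of r] vmin_in[of r'] Node.prems t by (cases "vmin r"; cases "vmin r'") auto
  moreover have "vmin l = vmin l'"
    using Node.prems unfolding t by (simp add: vmin_Node)
  ultimately show ?case using Node t by auto
qed

text \<open>The last letter becomes the root and its first occurrence cuts the word into the two
  subtrees. A letter \<open>x\<close> stands for the label \<open>x + 1\<close>, so
  \<open>m \<le> x\<close> keeps \<open>m\<close> strictly below all other labels.\<close>

lemma word_surj:
  assumes "double \<theta>" "nested \<theta>" "\<And>x. x \<in> set \<theta> \<Longrightarrow> m \<le> x"
  shows "\<exists>t. nor t \<and> set (leaf_labels t) = insert m (Suc ` set \<theta>) \<and> word t = \<theta>"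
  using assms
proof (induction "length \<theta>" arbitrary: \<theta> m rule: less_induct)
  case less
  show ?case
  proof (cases \<theta> rule: rev_cases)
    case Nil
    then show ?thesis by (intro exI[of _ "Leaf m"]) auto
  next
    case (snoc \<theta>' c)
    have "count (mset \<theta>) c = 2" using less.prems(1) snoc by (simp add: double_def)
    then have "count (mset \<theta>') c \<noteq> 0" using snoc by simp
    then have "c \<in> set \<theta>'" using count_inI by fastforce
    then obtain u v where \<theta>': "\<theta>' = u @ c # v" by (auto dest: split_list)
    have \<theta>: "\<theta> = u @ c # v @ [c]" by (simp add: snoc \<theta>')
    have "count (mset u) c = 0" "count (mset v) c = 0" using \<open>count (mset \<theta>) c = 2\<close> \<theta> by auto
    then have cu: "c \<notin> set u" "c \<notin> set v" by (simp_all add: count_eq_zero_iff)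
    \<comment> \<open>A letter \<open>b\<close> in both parts would enclose the first
      \<open>c\<close> and also lie between the two occurrences of \<open>c\<close>, whence
      \<open>b < c\<close> and \<open>c < b\<close>.\<close>
    have uv: "set u \<inter> set v = {}"
    proof (rule ccontr)
      assume "set u \<inter> set v \<noteq> {}"
      then obtain b where b: "b \<in> set u" "b \<in> set v" by auto
      then obtain u1 u2 v1 v2 where "u = u1 @ b # u2" "v = v1 @ b # v2" by (meson split_list)
      then have "nested (u1 @ b # (u2 @ c # v1) @ b # v2 @ [c])" "nested (u @ c # v @ c # [])"
        using less.prems(2) \<theta> by auto
      from nested_between[OF this(1), of c] nested_between[OF this(2) b(2)] show False by auto
    qed
    have n: "nested u" "nested v" "\<forall>y\<in>set v. c < y"
      using less.prems(2) nested_join[OF uv cu] \<theta> by auto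
    have du: "double u" unfolding double_def
    proof
      fix x assume x: "x \<in> set u"
      then have "count (mset v) x = 0" "x \<noteq> c" using uv cu by (auto simp: count_eq_zero_iff)
      moreover have "count (mset \<theta>) x = 2" using less.prems(1) x \<theta> by (simp add: double_def)
      moreover have "count (mset \<theta>) x = count (mset u) x + count (mset v) x" using \<open>x \<noteq> c\<close> \<theta> by simp
      ultimately show "count (mset u) x = 2" by linarith
    qed
    have dv: "double v" unfolding double_def
    proof
      fix x assume x: "x \<in> set v"
      then have "count (mset u) x = 0" "x \<noteq> c" using uv cu by (auto simp: count_eq_zero_iff)
      moreover have "count (mset \<theta>) x = 2" using less.prems(1) x \<theta> by (simp add: double_def)
      moreover have "count (mset \<theta>) x = count (mset u) x + count (mset v) x" using \<open>x \<noteq> c\<close> \<theta> by simp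
      ultimately show "count (mset v) x = 2" by linarith
    qed
    obtain l where l: "nor l" "set (leaf_labels l) = insert m (Suc ` set u)" "word l = u"
      using less.hyps[of u m] du n less.prems(3) \<theta> by auto
    \<comment> \<open>Nesting puts the letters of \<open>v\<close> above \<open>c\<close>, so
      \<open>Suc c\<close> is admissible as least label, and it gives the root the letter
      \<open>c\<close>.\<close>
    obtain r where r: "nor r" "set (leaf_labels r) = insert (Suc c) (Suc ` set v)" "word r = v"
      using less.hyps[of v "Suc c"] dv n \<theta> by (auto simp: Suc_le_eq)
    have "m \<le> c" using less.prems(3) \<theta> by auto
    have vr: "vmin r = Suc c"
      unfolding vmin_def r(2) using n(3) by (intro Min_eqI) auto
    have vl: "vmin l \<le> m" using l(2) by (intro vmin_le) auto
    have "m \<noteq> Suc x" if "x \<in> set v" for x using n(3) that \<open>m \<le> c\<close> by auto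
    then have "nor (Node l r)"
      using l r vl vr \<open>m \<le> c\<close> uv cu by auto
    then show ?thesis
      using l r vr \<theta> by (intro exI[of _ "Node l r"]) auto
  qed
qed

lemma word_bij:
  assumes "n \<ge> 1"
  shows "bij_betw word (Nor n) (Stirling_perms (n - 1))"
proof -
  have N: "nor t" "0 \<notin> set (leaf_labels t)" "vmin t = 1" if "t \<in> Nor n" for t
    using that assms vmin_le[of 1 t] vmin_in[of t] by (auto simp: Nor_eq)
  have "inj_on word (Nor n)"
    by (rule inj_onI) (use N word_inject in metis)
  moreover have "word ` Nor n = Stirling_perms (n - 1)"
  proof (intro equalityI subsetI)
    fix \<theta> assume "\<theta> \<in> word ` Nor n"
    then obtain t where t: "\<theta> = word t" "t \<in> Nor n" by auto
    have "set (word t) = {1..n - 1}"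
      unfolding set_word[OF N(1,2)[OF t(2)]] N(3)[OF t(2)] using t(2) assms by (auto simp: Nor_eq)
    then show "\<theta> \<in> Stirling_perms (n - 1)"
      using double_nested_word[OF N(1,2)[OF t(2)]] t by (simp add: Stirling_perms_eq)
  next
    fix \<theta> assume \<theta>: "\<theta> \<in> Stirling_perms (n - 1)"
    then obtain t where t: "nor t" "set (leaf_labels t) = insert 1 (Suc ` set \<theta>)" "word t = \<theta>"
      using word_surj[of \<theta> 1] by (auto simp: Stirling_perms_eq)
    have "insert 1 (Suc ` {1..n - 1}) = {1..n}" using assms by (auto simp: image_Suc_atLeastAtMost)
    then have "t \<in> Nor n" using t \<theta> by (simp add: Nor_eq Stirling_perms_eq)
    then show "\<theta> \<in> word ` Nor n" using t by auto
  qed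
  ultimately show ?thesis by (simp add: bij_betw_def)
qed

lemma sum_Stirling_perms:
  assumes "n \<ge> 1"
  shows "(\<Sum>\<theta>\<in>Stirling_perms (n - 1). f (lambda_AA \<theta>)) = (\<Sum>t\<in>Nor n. f (lambda_Lyn t))"
    "(\<Sum>\<theta>\<in>Stirling_perms (n - 1). f (lambda_TN \<theta>)) = (\<Sum>t\<in>Nor n. f (lambda_Comb t))"
proof -
  have "nor t" "0 \<notin> set (leaf_labels t)" if "t \<in> Nor n" for t
    using that by (auto simp: Nor_eq)
  then show "(\<Sum>\<theta>\<in>Stirling_perms (n - 1). f (lambda_AA \<theta>)) = (\<Sum>t\<in>Nor n. f (lambda_Lyn t))"
    "(\<Sum>\<theta>\<in>Stirling_perms (n - 1). f (lambda_TN \<theta>)) = (\<Sum>t\<in>Nor n. f (lambda_Comb t))"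
    by (subst sum.reindex_bij_betw[OF word_bij[OF assms], symmetric],
        simp add: lambda_AA_word lambda_TN_word)+
qed

section \<open>Products over set partitions\<close>

text \<open>The possible blocks of the least element when there are further blocks; equally, the
  label sets of left subtrees of normalized trees on \<open>A\<close>.\<close>

definition parts :: "nat set \<Rightarrow> nat set set" where
  "parts A = {B. B \<subset> A \<and> Min A \<in> B}"

text \<open>
  The sum of the products of the values of \<open>F\<close> on the blocks over all partitions of \<open>A\<close> into
  \<open>r + 1\<close> blocks with minima smaller than \<open>m\<close>. The recursion splits off the block with the least
  minimum in \<open>psum\<close> and that with the greatest minimum in \<open>psum'\<close>.
\<close>

primrec psum :: "(nat set \<Rightarrow> 'a::comm_ring_1) \<Rightarrow> nat \<Rightarrow> nat set \<Rightarrow> nat \<Rightarrow> 'a" where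
  "psum F 0 A m = (if Min A < m then F A else 0)"
| "psum F (Suc r) A m = (\<Sum>B\<in>parts A. F B * psum F r (A - B) m)"

primrec psum' :: "(nat set \<Rightarrow> 'a::comm_ring_1) \<Rightarrow> nat \<Rightarrow> nat set \<Rightarrow> nat \<Rightarrow> 'a" where
  "psum' F 0 A m = (if Min A < m then F A else 0)"
| "psum' F (Suc r) A m =
    (\<Sum>B\<in>parts A. if Min (A - B) < m then F (A - B) * psum' F r B (Min (A - B)) else 0)"

lemma finite_parts: "finite A \<Longrightarrow> finite (parts A)"
  by (rule finite_subset[of _ "Pow A"]) (auto simp: parts_def)

lemma partsD:
  assumes "finite A" "B \<in> parts A"
  shows "finite B" "B \<noteq> {}" "A - B \<noteq> {}" "finite (A - B)" "Min B = Min A" "Min A < Min (A - B)"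
    "card B < card A" "card (A - B) < card A" "B \<subset> A"
proof -
  show B: "finite B" "B \<noteq> {}" "A - B \<noteq> {}" "finite (A - B)" "B \<subset> A"
    using assms by (auto simp: parts_def intro: finite_subset)
  show "Min B = Min A"
    using assms B by (intro Min_eqI) (auto simp: parts_def)
  have "Min (A - B) \<in> A - B" using B by (intro Min_in)
  moreover from this have "Min A \<noteq> Min (A - B)" "Min A \<le> Min (A - B)" using assms by (auto simp: parts_def)
  ultimately show "Min A < Min (A - B)" by simp
  show "card B < card A" "card (A - B) < card A"
    using assms(1) B by (auto intro!: psubset_card_mono)
qed

lemma psum_eq_0:
  assumes "finite A" "A \<noteq> {}" "m \<le> Min A"
  shows "psum F r A m = 0"
  using assms
proof (induction r arbitrary: A)
  case (Suc r)
  have "psum F r (A - B) m = 0" if "B \<in> parts A" for B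
    using partsD[OF Suc.prems(1) that] Suc.prems by (intro Suc.IH) auto
  then show ?case by simp
next
  case 0
  then have "\<not> Min A < m" unfolding not_less by -
  then show ?case by (simp only: psum.simps if_False)
qed

text \<open>For three or more blocks the last block is split off, then the first block of the rest,
  and the two choices are interchanged. The induction is used for \<open>r - 1\<close> and
  \<open>r - 2\<close>.\<close>

lemma psum'_eq_psum:
  assumes "finite A" "A \<noteq> {}"
  shows "psum' F r A m = psum F r A m"
  using assms
proof (induction r arbitrary: A m rule: less_induct)
  case (less r)
  consider "r = 0" | "r = Suc 0" | r' where "r = Suc (Suc r')"
    by (metis not0_implies_Suc)
  then show ?case
  proof cases
    case 2
    then show ?thesis
      using partsD[OF less.prems(1)] by (auto intro!: sum.cong simp: mult.commute)
  next
    case 3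
    define h where "h C B = F (A - C) * (F B * psum F r' (C - B) (Min (A - C)))" for B C
    let ?S = "SIGMA C:{C \<in> parts A. Min (A - C) < m}. parts C"
    let ?T = "SIGMA B:parts A. {D \<in> parts (A - B). Min (A - B - D) < m}"
    have fin: "finite {C \<in> parts A. Min (A - C) < m}"
      using finite_parts[OF less.prems(1)] by simp
    have fin': "finite {D \<in> parts (A - B). Min (A - B - D) < m}" for B
      using finite_parts[of "A - B"] less.prems(1) by simp
    have "psum' F r A m = (\<Sum>C\<in>{C \<in> parts A. Min (A - C) < m}. F (A - C) * psum' F (Suc r') C (Min (A - C)))"
      using finite_parts[OF less.prems(1)] unfolding 3 by (simp add: sum.inter_filter del: psum'.simps(2)) simp
    also have "\<dots> = (\<Sum>C\<in>{C \<in> parts A. Min (A - C) < m}. F (A - C) * psum F (Suc r') C (Min (A - C)))"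
    proof (rule sum.cong[OF refl])
      fix C assume "C \<in> {C \<in> parts A. Min (A - C) < m}"
      then have "finite C" "C \<noteq> {}" using partsD(1,2)[OF less.prems(1), of C] by auto
      then have "psum' F (Suc r') C (Min (A - C)) = psum F (Suc r') C (Min (A - C))"
        by (intro less.IH) (simp_all add: 3)
      then show "F (A - C) * psum' F (Suc r') C (Min (A - C)) = F (A - C) * psum F (Suc r') C (Min (A - C))"
        by (simp only:)
    qed
    also have "\<dots> = (\<Sum>(C, B)\<in>?S. h C B)"
      using finite_parts partsD(1)[OF less.prems(1)]
      by (subst sum.Sigma[symmetric, OF fin]) (auto simp: h_def sum_distrib_left)
    \<comment> \<open>The middle part \<open>D = C - B\<close> belongs to
      \<open>parts (A - B)\<close> only if it contains \<open>Min (A - B)\<close>. Otherwise that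
      minimum lies in the last block, and the bound \<open>Min (A - C)\<close> makes the inner sum
      0; such pairs form \<open>S'\<close>.\<close>
    also have "\<dots> = (\<Sum>(B, D)\<in>?T. h (B \<union> D) B)"
    proof (rule sum.reindex_bij_witness_not_neutral[where
          i = "\<lambda>(B, D). (B \<union> D, B)" and j = "\<lambda>(C, B). (B, C - B)" and
          S' = "{(C, B) \<in> ?S. Min (A - B) \<notin> C}" and T' = "{}"])
      show "finite {(C, B) \<in> ?S. Min (A - B) \<notin> C}"
        by (rule finite_subset[of _ ?S]) (use fin finite_parts partsD(1)[OF less.prems(1)] in auto)
      fix x assume x: "x \<in> ?S - {(C, B) \<in> ?S. Min (A - B) \<notin> C}"
      then obtain C B where CB: "x = (C, B)" "C \<in> parts A" "Min (A - C) < m" "B \<in> parts C" "Min (A - B) \<in> C"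
        by auto
      note C = partsD[OF less.prems(1) CB(2)]
      note B = partsD[OF C(1) CB(4)]
      have e: "B \<union> (C - B) = C" "A - B - (C - B) = A - C" using B(9) by auto
      then show "(case (case x of (C, B) \<Rightarrow> (B, C - B)) of (B, D) \<Rightarrow> (B \<union> D, B)) = x"
        by (simp add: CB(1))
      have "Min (A - B) \<in> A - B" using B C less.prems by (intro Min_in) auto
      then have "C - B \<in> parts (A - B)"
        using CB(5) B(9) C(9) by (auto simp: parts_def)
      moreover have "B \<in> parts A"
        using CB(4) B(9) C(5,9) by (auto simp: parts_def)
      moreover have "Min (A - B - (C - B)) < m"
        unfolding e(2) by (rule CB(3))
      ultimately have "(B, C - B) \<in> ?T" by blast
      then show "(case x of (C, B) \<Rightarrow> (B, C - B)) \<in> ?T - {}" by (simp add: CB(1))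
    next
      fix x assume "x \<in> ?S"
      then obtain C B where CB: "x = (C, B)" "C \<in> parts A" "B \<in> parts C" by auto
      have "B \<subseteq> C" using CB(3) by (auto simp: parts_def)
      then have "B \<union> (C - B) = C" by auto
      then show "(case (case x of (C, B) \<Rightarrow> (B, C - B)) of (B, D) \<Rightarrow> h (B \<union> D) B) = (case x of (C, B) \<Rightarrow> h C B)"
        by (simp only: CB(1) prod.case)
    next
      fix y assume "y \<in> ?T - {}"
      then obtain B D where BD: "y = (B, D)" "B \<in> parts A" "D \<in> parts (A - B)" "Min (A - B - D) < m" by auto
      note B = partsD[OF less.prems(1) BD(2)]
      note D = partsD[OF B(4) BD(3)]
      have e: "B \<union> D - B = D" "A - (B \<union> D) = A - B - D" using D(9) by auto
      then show "(case (case y of (B, D) \<Rightarrow> (B \<union> D, B)) of (C, B) \<Rightarrow> (B, C - B)) = y"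
        by (simp add: BD(1))
      have C: "B \<union> D \<in> parts A" using B(9) D(9) BD(2) by (auto simp: parts_def)
      have "Min (A - (B \<union> D)) < m" unfolding e(2) by (rule BD(4))
      moreover have "B \<in> parts (B \<union> D)"
        using BD(2) D(2,9) unfolding parts_def partsD(5)[OF less.prems(1) C] by auto
      ultimately have "(B \<union> D, B) \<in> ?S"
        using C by blast
      moreover have "Min (A - B) \<in> D" using BD(3) by (simp add: parts_def)
      ultimately show "(case y of (B, D) \<Rightarrow> (B \<union> D, B)) \<in> ?S - {(C, B) \<in> ?S. Min (A - B) \<notin> C}"
        by (simp add: BD(1))
    next
      fix x assume "x \<in> {(C, B) \<in> ?S. Min (A - B) \<notin> C}"
      then obtain C B where CB: "x = (C, B)" "C \<in> parts A" "B \<in> parts C" "Min (A - B) \<notin> C" by auto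
      note C = partsD[OF less.prems(1) CB(2)]
      note B = partsD[OF C(1) CB(3)]
      have "Min (A - B) \<in> A - B" using B C less.prems by (intro Min_in) auto
      then have "Min (A - B) \<in> A - C" using CB(4) by auto
      then have "Min (A - C) \<le> Min (A - B)" using C by (intro Min_le) auto
      also have "\<dots> \<le> Min (C - B)" using B C less.prems(1) by (intro Min_antimono) auto
      finally have "psum F r' (C - B) (Min (A - C)) = 0" using B by (intro psum_eq_0)
      then show "(case x of (C, B) \<Rightarrow> h C B) = 0" by (simp add: CB(1) h_def)
    qed auto
    also have "\<dots> = (\<Sum>B\<in>parts A. \<Sum>D\<in>{D \<in> parts (A - B). Min (A - B - D) < m}. h (B \<union> D) B)"
      using finite_parts[OF less.prems(1)] fin' by (subst sum.Sigma) auto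
    also have "\<dots> = (\<Sum>B\<in>parts A. F B * psum' F (Suc r') (A - B) m)"
    proof (rule sum.cong[OF refl])
      fix B assume B: "B \<in> parts A"
      note B' = partsD[OF less.prems(1) B]
      have "(\<Sum>D\<in>{D \<in> parts (A - B). Min (A - B - D) < m}. h (B \<union> D) B) =
        (\<Sum>D\<in>{D \<in> parts (A - B). Min (A - B - D) < m}. F B * (F (A - B - D) * psum' F r' D (Min (A - B - D))))"
      proof (rule sum.cong[OF refl])
        fix D assume "D \<in> {D \<in> parts (A - B). Min (A - B - D) < m}"
        then have D: "D \<in> parts (A - B)" by simp
        note D' = partsD[OF B'(4) D]
        have "B \<union> D - B = D" "A - (B \<union> D) = A - B - D" using D'(9) by auto
        moreover have "psum' F r' D (Min (A - B - D)) = psum F r' D (Min (A - B - D))"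
          using D' 3 by (intro less.IH) auto
        ultimately show "h (B \<union> D) B = F B * (F (A - B - D) * psum' F r' D (Min (A - B - D)))"
          by (simp add: h_def mult.left_commute)
      qed
      then show "(\<Sum>D\<in>{D \<in> parts (A - B). Min (A - B - D) < m}. h (B \<union> D) B) = F B * psum' F (Suc r') (A - B) m"
        using finite_parts[OF B'(4)] by (simp add: sum.inter_filter sum_distrib_left if_distrib cong: if_cong)
    qed
    also have "\<dots> = psum F r A m"
      using partsD[OF less.prems(1)] unfolding 3 psum.simps(2)[of F "Suc r'"]
      by (intro sum.cong refl arg_cong2[where f = "(*)"] less.IH) (auto simp: 3)
    finally show ?thesis .
  qed simp
qed

lemma psum_cong:
  assumes "finite A" "\<And>B. B \<subseteq> A \<Longrightarrow> F B = F' B"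
  shows "psum F r A m = psum F' r A m"
  using assms
proof (induction r arbitrary: A)
  case (Suc r)
  have "F B * psum F r (A - B) m = F' B * psum F' r (A - B) m" if "B \<in> parts A" for B
  proof -
    have "psum F r (A - B) m = psum F' r (A - B) m"
      using Suc.prems by (intro Suc.IH) auto
    moreover have "F B = F' B" using that Suc.prems(2)[of B] by (auto simp: parts_def)
    ultimately show ?thesis by simp
  qed
  then show ?case by simp
qed auto

text \<open>Two or more blocks are proper subsets, so agreement on \<open>A\<close> itself is not
  assumed. This is what permits the induction on the label set.\<close>

lemma psum_Suc_cong:
  assumes "finite A" "\<And>B. B \<subset> A \<Longrightarrow> F B = F' B"
  shows "psum F (Suc r) A m = psum F' (Suc r) A m"
proof -
  have "F B * psum F r (A - B) m = F' B * psum F' r (A - B) m" if B: "B \<in> parts A" for B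
  proof -
    have "A - B \<subset> A" using partsD[OF assms(1) B] by auto
    then have "psum F r (A - B) m = psum F' r (A - B) m"
      using assms by (intro psum_cong) auto
    moreover have "F B = F' B" using B assms(2) by (auto simp: parts_def)
    ultimately show ?thesis by simp
  qed
  then show ?thesis by simp
qed

section \<open>The sums over Lyndon and comb types agree\<close>

definition nors :: "nat set \<Rightarrow> btree set" where
  "nors A = {t. nor t \<and> set (leaf_labels t) = A}"

lemma nor_distinct: "nor t \<Longrightarrow> distinct (leaf_labels t)"
  by (simp add: nor_iff)

lemma nors_length: "t \<in> nors A \<Longrightarrow> length (leaf_labels t) = card A"
  using nor_distinct distinct_card by (fastforce simp: nors_def)

lemma nors_vmin: "t \<in> nors A \<Longrightarrow> vmin t = Min A"
  by (auto simp: nors_def vmin_def)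

lemma finite_nors: "finite A \<Longrightarrow> finite (nors A)"
proof -
  assume A: "finite A"
  define X where "X N = {t. length (leaf_labels t) \<le> N \<and> set (leaf_labels t) \<subseteq> A}" for N
  have "finite (X N)" for N
  proof (induction N)
    case (Suc N)
    have "X (Suc N) \<subseteq> Leaf ` A \<union> (\<lambda>(l, r). Node l r) ` (X N \<times> X N)"
    proof
      fix t assume t: "t \<in> X (Suc N)"
      show "t \<in> Leaf ` A \<union> (\<lambda>(l, r). Node l r) ` (X N \<times> X N)"
      proof (cases t)
        case (Node l r)
        have "length (leaf_labels l) > 0" "length (leaf_labels r) > 0" by auto
        moreover have "length (leaf_labels l) + length (leaf_labels r) \<le> Suc N"
          using t Node by (simp add: X_def)
        ultimately have "length (leaf_labels l) \<le> N" "length (leaf_labels r) \<le> N" by linarith+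
        with t Node have "(l, r) \<in> X N \<times> X N" by (auto simp: X_def)
        then show ?thesis unfolding Node by force
      qed (use t in \<open>auto simp: X_def\<close>)
    qed
    then show ?case using Suc A by (auto intro: finite_subset)
  qed (simp add: X_def)
  moreover have "nors A \<subseteq> X (card A)"
    using nors_length by (auto simp: nors_def X_def)
  ultimately show "finite (nors A)" by (rule finite_subset[rotated])
qed

lemma sum_nors:
  fixes h :: "btree \<Rightarrow> 'a::comm_ring_1"
  assumes "finite A" "A \<noteq> {}"
  shows "(\<Sum>t\<in>nors A. h t) = (if A = {Min A} then h (Leaf (Min A)) else 0) +
    (\<Sum>B\<in>parts A. \<Sum>l\<in>nors B. \<Sum>r\<in>nors (A - B). h (Node l r))"
proof -
  let ?L = "if A = {Min A} then {Leaf (Min A)} else {}"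
  let ?S = "SIGMA B:parts A. nors B \<times> nors (A - B)"
  let ?N = "(\<lambda>(B, l, r). Node l r) ` ?S"
  have "nors A = ?L \<union> ?N"
  proof (intro equalityI subsetI)
    fix t assume t: "t \<in> nors A"
    show "t \<in> ?L \<union> ?N"
    proof (cases t)
      case (Leaf a)
      then show ?thesis using t by (auto simp: nors_def)
    next
      case (Node l r)
      let ?B = "set (leaf_labels l)"
      have "?B \<in> parts A"
      proof -
        have "vmin t = vmin l" using t Node by (auto simp: nors_def nor_vmin)
        then have "Min A \<in> ?B" using nors_vmin[OF t] vmin_in[of l] by simp
        moreover have "?B \<subset> A" using t Node vmin_in[of r] by (auto simp: nors_def)
        ultimately show ?thesis by (simp add: parts_def)
      qed
      moreover have "l \<in> nors ?B" "r \<in> nors (A - ?B)"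
        using t Node by (auto simp: nors_def)
      ultimately have "(?B, l, r) \<in> ?S" by auto
      then have "(\<lambda>(B, l, r). Node l r) (?B, l, r) \<in> ?N" by (rule imageI)
      then show ?thesis by (simp add: Node)
    qed
  next
    fix t assume "t \<in> ?L \<union> ?N"
    then consider "A = {Min A}" "t = Leaf (Min A)" | B l r where "B \<in> parts A" "l \<in> nors B" "r \<in> nors (A - B)" "t = Node l r"
      by (auto split: if_splits)
    then show "t \<in> nors A"
    proof cases
      case 1
      then show ?thesis by (auto simp: nors_def)
    next
      case 2
      have "vmin l < vmin r" using nors_vmin[OF 2(2)] nors_vmin[OF 2(3)] partsD[OF assms(1) 2(1)] by simp
      then show ?thesis using 2 partsD(9)[OF assms(1) 2(1)] by (auto simp: nors_def)
    qed
  qed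
  moreover have "?L \<inter> ?N = {}" by auto
  moreover have "inj_on (\<lambda>(B, l, r). Node l r) ?S"
    by (auto simp: inj_on_def nors_def)
  moreover have fin: "finite (nors B)" "finite (nors (A - B))" if "B \<in> parts A" for B
    using finite_nors partsD[OF assms(1) that] by auto
  moreover have "finite ?S" using finite_parts[OF assms(1)] fin by auto
  ultimately have "(\<Sum>t\<in>nors A. h t) = (\<Sum>t\<in>?L. h t) + (\<Sum>(B, l, r)\<in>?S. h (Node l r))"
    by (simp add: sum.union_disjoint sum.reindex case_prod_unfold)
  also have "(\<Sum>(B, l, r)\<in>?S. h (Node l r)) = (\<Sum>B\<in>parts A. \<Sum>(l, r)\<in>nors B \<times> nors (A - B). h (Node l r))"
    using finite_parts[OF assms(1)] fin by (subst sum.Sigma) auto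
  also have "\<dots> = (\<Sum>B\<in>parts A. \<Sum>l\<in>nors B. \<Sum>r\<in>nors (A - B). h (Node l r))"
    by (simp add: sum.cartesian_product)
  finally show ?thesis by auto
qed

section \<open>Weights of trees and removal of nodes from the root chain\<close>

context
  fixes e :: "nat \<Rightarrow> 'a::comm_ring_1"
  assumes e0: "e 0 = 1"
begin

definition rest_weight :: "(btree \<Rightarrow> bool) \<Rightarrow> (btree \<Rightarrow> bool) \<Rightarrow> btree \<Rightarrow> 'a" where
  "rest_weight L R t = (\<Prod>k\<in>#other_sizes L R t. e k)"

definition tree_weight :: "(btree \<Rightarrow> bool) \<Rightarrow> (btree \<Rightarrow> bool) \<Rightarrow> btree \<Rightarrow> 'a" where
  "tree_weight L R t = (\<Prod>k\<in>#chain_sizes L R t. e k)"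

definition weight_sum :: "(btree \<Rightarrow> bool) \<Rightarrow> (btree \<Rightarrow> bool) \<Rightarrow> nat set \<Rightarrow> 'a" where
  "weight_sum L R A = (\<Sum>t\<in>nors A. tree_weight L R t)"

text \<open>The sum of \<open>e_(s-r) N\<^sub>s\<close> over \<open>s \<ge> r\<close>, written tree
  by tree so that the root can be removed.\<close>

definition shifted_sum :: "(btree \<Rightarrow> bool) \<Rightarrow> (btree \<Rightarrow> bool) \<Rightarrow> nat \<Rightarrow> nat set \<Rightarrow> 'a" where
  "shifted_sum L R r A =
    (\<Sum>t\<in>nors A. if r \<le> root_size L R t then rest_weight L R t * e (root_size L R t - r) else 0)"

text \<open>A leaf has root size 0 and no root block; \<open>e 0 = 1\<close> spares this case
  distinction.\<close>

lemma prod_nonzero: "(\<Prod>k\<in>#nonzero k. e k) = e k"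
  by (simp add: nonzero_def e0)

lemma tree_weight_eq: "tree_weight L R t = rest_weight L R t * e (root_size L R t)"
  by (simp add: tree_weight_def rest_weight_def chain_sizes_def prod_nonzero mult.commute)

lemma rest_weight_Node:
  "rest_weight L R (Node l r) =
    (if L (Node l r) then rest_weight L R l else tree_weight L R l) *
    (if R (Node l r) then rest_weight L R r else tree_weight L R r)"
  by (simp add: tree_weight_eq rest_weight_def prod_nonzero mult_ac)

lemma shifted_sum_0: "shifted_sum L R 0 A = weight_sum L R A"
  by (simp add: shifted_sum_def weight_sum_def tree_weight_eq)

text \<open>Removing the root leaves a left tree of full weight and a right tree whose root chain is
  shorter by one. Normalization already orders the minima, and \<open>m\<close> exceeds all labels,
  so the bound always holds.\<close>

lemma shifted_sum_comb:
  assumes "finite A" "A \<noteq> {}" "\<And>x. x \<in> A \<Longrightarrow> x < m"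
  shows "shifted_sum unlinked always r A = psum (weight_sum unlinked always) r A m"
  using assms
proof (induction r arbitrary: A)
  case 0
  then show ?case by (simp add: shifted_sum_0)
next
  case (Suc r)
  have "shifted_sum unlinked always (Suc r) A =
    (\<Sum>B\<in>parts A. \<Sum>l\<in>nors B. \<Sum>u\<in>nors (A - B). tree_weight unlinked always l *
      (if r \<le> root_size unlinked always u then rest_weight unlinked always u * e (root_size unlinked always u - r) else 0))"
    unfolding shifted_sum_def sum_nors[OF Suc.prems(1,2)]
    by (auto intro!: sum.cong simp: rest_weight_Node mult.assoc)
  also have "\<dots> = (\<Sum>B\<in>parts A. weight_sum unlinked always B * shifted_sum unlinked always r (A - B))"
    by (simp add: weight_sum_def shifted_sum_def sum_product)
  also have "\<dots> = (\<Sum>B\<in>parts A. weight_sum unlinked always B * psum (weight_sum unlinked always) r (A - B) m)"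
    using partsD[OF Suc.prems(1)] Suc.prems(3) by (intro sum.cong refl arg_cong2[where f = "(*)"] Suc.IH) auto
  finally show ?case by simp
qed

primrec right_min :: "btree \<Rightarrow> nat" where
  "right_min (Leaf a) = a"
| "right_min (Node l r) = vmin r"

lemma right_min_in: "right_min t \<in> set (leaf_labels t)"
  using vmin_in by (cases t) auto

text \<open>In the recursion \<open>m\<close> is the minimum of the right subtree removed just
  above. While nodes remain to be removed (\<open>r > 0\<close>), the root must be linked to that
  parent, which is a condition on \<open>right_min\<close>; at \<open>r = 0\<close> the whole tree
  is the remaining block and only its minimum is compared.\<close>

definition bounded_sum :: "nat \<Rightarrow> nat set \<Rightarrow> nat \<Rightarrow> 'a" where
  "bounded_sum r A m = (\<Sum>t\<in>nors A.
    if r \<le> root_size non_lyndon unlinked t \<and> (if r = 0 then vmin t else right_min t) < m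
    then rest_weight non_lyndon unlinked t * e (root_size non_lyndon unlinked t - r) else 0)"

lemma bounded_sum_psum':
  assumes "finite A" "A \<noteq> {}"
  shows "bounded_sum r A m = psum' (weight_sum non_lyndon unlinked) r A m"
  using assms
proof (induction r arbitrary: A m)
  case 0
  have "bounded_sum 0 A m = (\<Sum>t\<in>nors A. if Min A < m then tree_weight non_lyndon unlinked t else 0)"
    unfolding bounded_sum_def by (intro sum.cong refl) (simp add: nors_vmin tree_weight_eq)
  then show ?case by (simp add: weight_sum_def)
next
  case (Suc r)
  let ?rs = "root_size non_lyndon unlinked" and ?f = "tree_weight non_lyndon unlinked"
    and ?W = "rest_weight non_lyndon unlinked"
  let ?h = "\<lambda>m t. if r \<le> ?rs t \<and> (if r = 0 then vmin t else right_min t) < m then ?W t * e (?rs t - r) else 0"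
  have node: "(if Suc r \<le> ?rs (Node l u) \<and> right_min (Node l u) < m
      then ?W (Node l u) * e (?rs (Node l u) - Suc r) else 0) =
      (if Min (A - B) < m then ?h (Min (A - B)) l * ?f u else 0)"
    if B: "B \<in> parts A" and l: "l \<in> nors B" and u: "u \<in> nors (A - B)" for B l u
  proof -
    have v: "vmin u = Min (A - B)" "vmin l < vmin u"
      using nors_vmin[OF l] nors_vmin[OF u] partsD[OF Suc.prems(1) B] by auto
    show ?thesis
    \<comment> \<open>For \<open>r = 0\<close> either case gives \<open>l\<close> its full weight:
      if linked, \<open>e\<close> of the rest of the chain completes it; if not, that factor is
      \<open>e 0 = 1\<close>. For \<open>r > 0\<close> the root must be linked to \<open>l\<close>,
      that is \<open>right_min l < vmin u\<close>; equality is excluded by disjoint labels.\<close>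
    proof (cases l)
      case (Leaf a)
      then show ?thesis using v by (auto simp: rest_weight_Node tree_weight_eq e0 mult_ac)
    next
      case (Node ll lr)
      have "vmin lr \<in> B" "vmin u \<in> A - B"
        using l u vmin_in[of lr] vmin_in[of u] Node by (auto simp: nors_def)
      then have "vmin lr \<noteq> vmin u" by auto
      then show ?thesis using v Node by (auto simp: rest_weight_Node tree_weight_eq e0 mult_ac)
    qed
  qed
  have "bounded_sum (Suc r) A m = (\<Sum>B\<in>parts A. \<Sum>l\<in>nors B. \<Sum>u\<in>nors (A - B).
      if Min (A - B) < m then ?h (Min (A - B)) l * ?f u else 0)"
    unfolding bounded_sum_def sum_nors[OF Suc.prems] using node
    by (auto intro!: sum.cong)
  also have "\<dots> = (\<Sum>B\<in>parts A. if Min (A - B) < m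
      then weight_sum non_lyndon unlinked (A - B) * bounded_sum r B (Min (A - B)) else 0)"
  proof (rule sum.cong[OF refl])
    fix B
    have "(\<Sum>l\<in>nors B. \<Sum>u\<in>nors (A - B). ?h (Min (A - B)) l * ?f u) =
      bounded_sum r B (Min (A - B)) * weight_sum non_lyndon unlinked (A - B)"
      unfolding bounded_sum_def weight_sum_def sum_product ..
    then show "(\<Sum>l\<in>nors B. \<Sum>u\<in>nors (A - B). if Min (A - B) < m then ?h (Min (A - B)) l * ?f u else 0) =
      (if Min (A - B) < m then weight_sum non_lyndon unlinked (A - B) * bounded_sum r B (Min (A - B)) else 0)"
      by (simp add: mult.commute)
  qed
  also have "\<dots> = psum' (weight_sum non_lyndon unlinked) (Suc r) A m"
    using partsD[OF Suc.prems(1)] by (auto intro!: sum.cong simp: Suc.IH)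
  finally show ?case .
qed

lemma shifted_sum_lyndon:
  assumes "finite A" "A \<noteq> {}" "\<And>x. x \<in> A \<Longrightarrow> x < m"
  shows "shifted_sum non_lyndon unlinked r A = psum (weight_sum non_lyndon unlinked) r A m"
proof -
  have "shifted_sum non_lyndon unlinked r A = bounded_sum r A m"
    unfolding shifted_sum_def bounded_sum_def
    using assms(3) right_min_in vmin_in by (intro sum.cong refl) (auto simp: nors_def)
  then show ?thesis
    by (simp add: bounded_sum_psum'[OF assms(1,2)] psum'_eq_psum[OF assms(1,2)])
qed

text \<open>This is \<open>N\<^sub>s\<close> for the labels \<open>A\<close>.\<close>

definition level_sum :: "(btree \<Rightarrow> bool) \<Rightarrow> (btree \<Rightarrow> bool) \<Rightarrow> nat set \<Rightarrow> nat \<Rightarrow> 'a" where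
  "level_sum L R A s = (\<Sum>t\<in>{t \<in> nors A. root_size L R t = s}. rest_weight L R t)"

lemma root_size_less:
  assumes "\<And>t. \<not> (L t \<and> R t)"
  shows "root_size L R t < length (leaf_labels t)"
proof (induction t)
  case (Node l r)
  have "length (leaf_labels l) > 0" "length (leaf_labels r) > 0" by auto
  then show ?case using Node assms[of "Node l r"] by auto
qed simp

lemma shifted_sum_level:
  assumes "\<And>t. \<not> (L t \<and> R t)" "finite A"
  shows "shifted_sum L R r A = (\<Sum>s\<in>{r..card A}. e (s - r) * level_sum L R A s)"
proof -
  have "shifted_sum L R r A = (\<Sum>t\<in>nors A. \<Sum>s\<in>{r..card A}. if root_size L R t = s then rest_weight L R t * e (s - r) else 0)"
    unfolding shifted_sum_def
  proof (rule sum.cong[OF refl])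
    fix t assume "t \<in> nors A"
    then have "root_size L R t \<le> card A"
      using root_size_less[of L R t, OF assms(1)] nors_length by fastforce
    then show "(if r \<le> root_size L R t then rest_weight L R t * e (root_size L R t - r) else 0) =
      (\<Sum>s\<in>{r..card A}. if root_size L R t = s then rest_weight L R t * e (s - r) else 0)"
      by (simp add: sum.delta')
  qed
  also have "\<dots> = (\<Sum>s\<in>{r..card A}. \<Sum>t\<in>nors A. if root_size L R t = s then rest_weight L R t * e (s - r) else 0)"
    by (rule sum.swap)
  also have "\<dots> = (\<Sum>s\<in>{r..card A}. e (s - r) * level_sum L R A s)"
    by (auto simp: level_sum_def sum_distrib_left sum.inter_filter[OF finite_nors[OF assms(2)]] mult.commute
        intro!: sum.cong)
  finally show ?thesis .
qed

text \<open>A triangular system with diagonal entries \<open>e 0 = 1\<close>, solved downwards from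
  \<open>r = K\<close>.\<close>

lemma level_unique:
  assumes "\<And>r. 1 \<le> r \<Longrightarrow> (\<Sum>s\<in>{r..K}. e (s - r) * x s) = (\<Sum>s\<in>{r..K}. e (s - r) * y s)"
  shows "1 \<le> r \<Longrightarrow> r \<le> K \<Longrightarrow> x r = y r"
proof (induction "K - r" arbitrary: r rule: less_induct)
  case less
  have split: "{r..K} = insert r {Suc r..K}" using less.prems by auto
  have "(\<Sum>s\<in>{Suc r..K}. e (s - r) * x s) = (\<Sum>s\<in>{Suc r..K}. e (s - r) * y s)"
    using less by (intro sum.cong refl) auto
  with assms[OF less.prems(1)] show ?case unfolding split by (simp add: e0)
qed

theorem weight_sum_lyndon_comb:
  assumes "finite A" "A \<noteq> {}"
  shows "weight_sum non_lyndon unlinked A = weight_sum unlinked always A"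
  using assms
proof (induction "card A" arbitrary: A rule: less_induct)
  case less
  let ?x = "level_sum non_lyndon unlinked A" and ?y = "level_sum unlinked always A"
  obtain m where m: "\<And>x. x \<in> A \<Longrightarrow> x < m"
    using less.prems(1) finite_nat_set_iff_bounded by auto
  have ne: "weight_sum non_lyndon unlinked B = weight_sum unlinked always B" if "B \<subset> A" for B
  proof (cases "B = {}")
    case True
    have "nors {} = {}" by (auto simp: nors_def)
    then show ?thesis by (simp add: True weight_sum_def)
  next
    case False
    then show ?thesis
      using that less.prems(1) psubset_card_mono[OF less.prems(1) that] by (intro less.hyps) (auto intro: finite_subset)
  qed
  have lev: "shifted_sum non_lyndon unlinked r A = (\<Sum>s\<in>{r..card A}. e (s - r) * ?x s)"
    "shifted_sum unlinked always r A = (\<Sum>s\<in>{r..card A}. e (s - r) * ?y s)" for r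
    using less.prems(1) by (auto intro!: shifted_sum_level)
  have eq: "?x r = ?y r" if "1 \<le> r" "r \<le> card A" for r
  proof (rule level_unique[OF _ that])
    fix r :: nat assume "1 \<le> r"
    then obtain r' where r: "r = Suc r'" by (cases r) auto
    have "shifted_sum non_lyndon unlinked r A = psum (weight_sum non_lyndon unlinked) r A m"
      using less.prems m by (rule shifted_sum_lyndon)
    also have "\<dots> = psum (weight_sum unlinked always) r A m"
      unfolding r using less.prems(1) ne by (rule psum_Suc_cong)
    also have "\<dots> = shifted_sum unlinked always r A"
      using less.prems m by (rule shifted_sum_comb[symmetric])
    finally have "shifted_sum non_lyndon unlinked r A = shifted_sum unlinked always r A" .
    then show "(\<Sum>s\<in>{r..card A}. e (s - r) * ?x s) = (\<Sum>s\<in>{r..card A}. e (s - r) * ?y s)"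
      by (simp only: lev)
  qed
  have rs0: "root_size L R t = 0 \<longleftrightarrow> (\<exists>a. t = Leaf a)" for L R t
    by (cases t) auto
  \<comment> \<open>The system is available only for \<open>r \<ge> 1\<close>, as
    \<open>r = 0\<close> is the total weight sought. Root size 0 means a leaf, whose rest weight is
    1 for both types.\<close>
  have "?x 0 = ?y 0"
    unfolding level_sum_def rs0 by (intro sum.cong) (auto simp: rest_weight_def)
  with eq have "?x s = ?y s" if "s \<le> card A" for s
    using that by (cases "s = 0") auto
  then show ?case
    unfolding shifted_sum_0[symmetric] lev by (intro sum.cong) auto
qed

end

lemma sum_Nor_lyndon_comb:
  fixes e :: "nat \<Rightarrow> 'a::comm_ring_1"
  assumes "e 0 = 1" "n \<ge> 1"
  shows "(\<Sum>t\<in>Nor n. \<Prod>k\<in>#lambda_Lyn t. e k) = (\<Sum>t\<in>Nor n. \<Prod>k\<in>#lambda_Comb t. e k)"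
proof -
  have "Nor n = nors {1..n}" by (simp add: Nor_eq nors_def)
  then show ?thesis
    using weight_sum_lyndon_comb[of e "{1..n}", OF assms(1)] assms(2)
    by (simp add: weight_sum_def[of e, OF assms(1)] tree_weight_def[of e, OF assms(1)] lambda_Lyn_eq lambda_Comb_eq)
qed

section \<open>Generating functions of combs\<close>

definition gf :: "'b set \<Rightarrow> ('b \<Rightarrow> (nat \<Rightarrow>\<^sub>0 nat)) \<Rightarrow> int mps" where
  "gf X f = Abs_mps (\<lambda>\<mu>. int (card {x \<in> X. f x = \<mu>}))"

text \<open>\<open>card\<close> is 0 on infinite sets, so \<open>gf\<close> counts correctly only if
  fibres are finite. The sets themselves may be infinite, as there are infinitely many bracket
  types.\<close>

definition finite_fibres :: "'b set \<Rightarrow> ('b \<Rightarrow> (nat \<Rightarrow>\<^sub>0 nat)) \<Rightarrow> bool" where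
  "finite_fibres X f \<longleftrightarrow> (\<forall>\<mu>. finite {x \<in> X. f x = \<mu>})"

lemma coeff_times: "mps_coeff (f * g) \<mu> = (\<Sum>(\<alpha>, \<beta>)\<in>splits \<mu>. mps_coeff f \<alpha> * mps_coeff g \<beta>)"
  by (simp add: times_mps_def)

lemma coeff_0 [simp]: "mps_coeff 0 \<mu> = 0"
  and coeff_add [simp]: "mps_coeff (f + g) \<mu> = mps_coeff f \<mu> + mps_coeff g \<mu>"
  by (simp_all add: zero_mps_def plus_mps_def)

lemma coeff_sum: "mps_coeff (\<Sum>x\<in>A. f x) \<mu> = (\<Sum>x\<in>A. mps_coeff (f x) \<mu>)"
  by (induction A rule: infinite_finite_induct) simp_all

lemma coeff_of_nat_times: "mps_coeff (of_nat k * f) \<mu> = of_nat k * mps_coeff f \<mu>"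
  by (induction k) (simp_all add: distrib_right)

lemma gf_Times:
  assumes "finite_fibres X f" "finite_fibres Y g"
  shows "finite_fibres (X \<times> Y) (\<lambda>(x, y). f x + g y)"
    "gf (X \<times> Y) (\<lambda>(x, y). f x + g y) = gf X f * gf Y g"
proof -
  let ?A = "\<lambda>\<alpha>. {x \<in> X. f x = \<alpha>}" and ?B = "\<lambda>\<beta>. {y \<in> Y. g y = \<beta>}"
  have fib: "{z \<in> X \<times> Y. (\<lambda>(x, y). f x + g y) z = \<mu>} = (\<Union>(\<alpha>, \<beta>)\<in>splits \<mu>. ?A \<alpha> \<times> ?B \<beta>)" for \<mu>
    by (auto simp: splits_def)
  have fin: "finite (?A \<alpha>)" "finite (?B \<alpha>)" for \<alpha>
    using assms by (auto simp: finite_fibres_def)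
  then show "finite_fibres (X \<times> Y) (\<lambda>(x, y). f x + g y)"
    unfolding finite_fibres_def fib by (auto simp: finite_splits)
  show "gf (X \<times> Y) (\<lambda>(x, y). f x + g y) = gf X f * gf Y g"
  proof (rule mps_eqI)
    fix \<mu>
    have "mps_coeff (gf (X \<times> Y) (\<lambda>(x, y). f x + g y)) \<mu> = int (card (\<Union>(\<alpha>, \<beta>)\<in>splits \<mu>. ?A \<alpha> \<times> ?B \<beta>))"
      by (simp only: gf_def mps_coeff_Abs fib)
    also have "card (\<Union>(\<alpha>, \<beta>)\<in>splits \<mu>. ?A \<alpha> \<times> ?B \<beta>) = (\<Sum>p\<in>splits \<mu>. card (case p of (\<alpha>, \<beta>) \<Rightarrow> ?A \<alpha> \<times> ?B \<beta>))"
      by (intro card_UN_disjoint) (auto simp: finite_splits fin)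
    also have "\<dots> = (\<Sum>(\<alpha>, \<beta>)\<in>splits \<mu>. card (?A \<alpha>) * card (?B \<beta>))"
      by (intro sum.cong refl) (auto simp: card_cartesian_product)
    finally show "mps_coeff (gf (X \<times> Y) (\<lambda>(x, y). f x + g y)) \<mu> = mps_coeff (gf X f * gf Y g) \<mu>"
      unfolding coeff_times by (simp add: gf_def case_prod_unfold)
  qed
qed

lemma gf_bij:
  assumes "bij_betw h X Y" "\<And>x. x \<in> X \<Longrightarrow> g (h x) = f x"
  shows "finite_fibres X f \<longleftrightarrow> finite_fibres Y g" "gf X f = gf Y g"
proof -
  have "bij_betw h {x \<in> X. f x = \<mu>} {y \<in> Y. g y = \<mu>}" for \<mu>
    using assms by (auto simp: bij_betw_def inj_on_def)
  then have "finite {x \<in> X. f x = \<mu>} \<longleftrightarrow> finite {y \<in> Y. g y = \<mu>}" "card {x \<in> X. f x = \<mu>} = card {y \<in> Y. g y = \<mu>}" for \<mu>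
    using bij_betw_finite bij_betw_same_card by blast+
  then show "finite_fibres X f \<longleftrightarrow> finite_fibres Y g" "gf X f = gf Y g"
    by (simp_all add: finite_fibres_def gf_def)
qed

section \<open>Monomials and elementary symmetric functions\<close>

definition monom :: "(nat \<Rightarrow>\<^sub>0 nat) \<Rightarrow> 'a::comm_ring_1 mps" where
  "monom \<alpha> = Abs_mps (\<lambda>\<mu>. if \<mu> = \<alpha> then 1 else 0)"

lemma coeff_monom [simp]: "mps_coeff (monom \<alpha>) \<mu> = (if \<mu> = \<alpha> then 1 else 0)"
  by (simp add: monom_def)

lemma monom_0: "monom 0 = 1"
  by (simp add: monom_def one_mps_def)

lemma monom_add: "monom (\<alpha> + \<beta>) = (monom \<alpha> * monom \<beta> :: 'a::comm_ring_1 mps)"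
proof (rule mps_eqI)
  fix \<mu>
  have "mps_coeff (monom \<alpha> * monom \<beta> :: 'a mps) \<mu> = (\<Sum>p\<in>splits \<mu>. if p = (\<alpha>, \<beta>) then 1 else 0)"
    unfolding coeff_times by (intro sum.cong) (auto split: if_splits)
  also have "\<dots> = (if (\<alpha>, \<beta>) \<in> splits \<mu> then 1 else 0)"
    by (simp add: finite_splits)
  finally show "mps_coeff (monom (\<alpha> + \<beta>)) \<mu> = mps_coeff (monom \<alpha> * monom \<beta> :: 'a mps) \<mu>"
    by (auto simp: splits_def)
qed

lemma monom_sum: "finite A \<Longrightarrow> monom (\<Sum>i\<in>A. f i) = (\<Prod>i\<in>A. monom (f i))"
  by (induction A rule: finite_induct) (simp_all add: monom_0 monom_add)

lemma mvar_eq: "mvar i = monom (Poly_Mapping.single i 1)"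
  by (simp add: mvar_def monom_def)

lemma mvar_power: "mvar i ^ k = monom (Poly_Mapping.single i k)"
  by (induction k) (simp_all add: monom_0 mvar_eq monom_add[symmetric] single_add[symmetric])

lemma mmonom_eq: "mmonom \<mu> = monom \<mu>"
proof -
  have "\<mu> = (\<Sum>i\<in>Poly_Mapping.keys \<mu>. Poly_Mapping.single i (Poly_Mapping.lookup \<mu> i))"
    by (rule poly_mapping_eqI) (auto simp: lookup_sum lookup_single when_def sum.delta not_in_keys_iff_lookup_eq_zero)
  then show ?thesis
    by (simp add: mmonom_def mvar_power monom_sum[symmetric])
qed

definition indicator_type :: "nat set \<Rightarrow> (nat \<Rightarrow>\<^sub>0 nat)" where
  "indicator_type K = (\<Sum>i\<in>K. Poly_Mapping.single i 1)"

lemma keys_indicator_type: "finite K \<Longrightarrow> Poly_Mapping.keys (indicator_type K) = K"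
  by (auto simp: indicator_type_def in_keys_iff lookup_sum lookup_single when_def split: if_splits)

text \<open>A finite set is recovered from its indicator as the set of keys, so each fibre has at
  most one element.\<close>

lemma elem_sym_gf:
  "finite_fibres {K. finite K \<and> card K = k} indicator_type"
  "elem_sym k = gf {K. finite K \<and> card K = k} indicator_type"
proof -
  have "{K \<in> {K. finite K \<and> card K = k}. indicator_type K = \<mu>} \<subseteq> {Poly_Mapping.keys \<mu>}" for \<mu>
    using keys_indicator_type by auto
  then show "finite_fibres {K. finite K \<and> card K = k} indicator_type"
    unfolding finite_fibres_def by (meson finite.emptyI finite_insert finite_subset)
  have coeff: "mps_coeff (\<Prod>i\<in>K. mvar i :: int mps) \<mu> = (if indicator_type K = \<mu> then 1 else 0)"
    if "finite K" for K \<mu>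
    using that by (auto simp: mvar_eq indicator_type_def monom_sum[symmetric])
  have "{K. K \<in> {S. finite S \<and> card S = k} \<and> mps_coeff (\<Prod>i\<in>K. mvar i :: int mps) \<mu> \<noteq> 0} =
      {K \<in> {K. finite K \<and> card K = k}. indicator_type K = \<mu>}" for \<mu>
    by (rule Collect_cong) (auto simp: coeff split: if_splits)
  moreover have "(\<Sum>K\<in>{K \<in> {K. finite K \<and> card K = k}. indicator_type K = \<mu>}. mps_coeff (\<Prod>i\<in>K. mvar i :: int mps) \<mu>) =
      (\<Sum>K\<in>{K \<in> {K. finite K \<and> card K = k}. indicator_type K = \<mu>}. 1)" for \<mu>
    by (rule sum.cong) (simp_all add: coeff)
  ultimately show "elem_sym k = gf {K. finite K \<and> card K = k} indicator_type"
    unfolding elem_sym_def formal_sum_def gf_def by simp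
qed

lemma elem_sym_0: "elem_sym 0 = (1 :: int mps)"
proof (rule mps_eqI)
  fix \<mu>
  have "{K \<in> {K. finite K \<and> card K = 0}. indicator_type K = \<mu>} = (if \<mu> = 0 then {{}} else {})"
    by (auto simp: indicator_type_def)
  then show "mps_coeff (elem_sym 0) \<mu> = mps_coeff (1 :: int mps) \<mu>"
    by (simp add: elem_sym_gf gf_def one_mps_def)
qed

section \<open>Combs of a given shape\<close>

primrec shape :: "lie_word \<Rightarrow> btree" where
  "shape (Gen a) = Leaf a"
| "shape (Brk j s t) = Node (shape s) (shape t)"

lemma leaf_labels_shape [simp]: "leaf_labels (shape w) = letters w"
  by (induction w) auto

lemma vmin_shape [simp]: "vmin (shape w) = wmin w"
  by (simp add: vmin_def wmin_def)

lemma nor_shape: "comb w \<Longrightarrow> nor (shape w)"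
  by (induction w) auto

definition shape_combs :: "btree \<Rightarrow> lie_word set" where
  "shape_combs t = {w. comb w \<and> shape w = t}"

text \<open>
  A comb is determined by its shape, the colours and the left children of the nodes on its
  rightmost path. The colours decrease along that path, so they form an arbitrary finite set.
\<close>

primrec spine_colours :: "lie_word \<Rightarrow> nat list" where
  "spine_colours (Gen a) = []"
| "spine_colours (Brk j s t) = j # spine_colours t"

primrec lefts :: "lie_word \<Rightarrow> lie_word list" where
  "lefts (Gen a) = []"
| "lefts (Brk j s t) = s # lefts t"

primrec left_combs :: "btree \<Rightarrow> lie_word list set" where
  "left_combs (Leaf a) = {[]}"
| "left_combs (Node l r) = (\<lambda>(s, ss). s # ss) ` (shape_combs l \<times> left_combs r)"

definition list_type :: "lie_word list \<Rightarrow> (nat \<Rightarrow>\<^sub>0 nat)" where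
  "list_type ss = (\<Sum>s\<leftarrow>ss. bracket_type s)"

lemma spine_colours_less:
  "comb t \<Longrightarrow> root_below j t \<Longrightarrow> c \<in> set (spine_colours t) \<Longrightarrow> c < j"
proof (induction t arbitrary: j)
  case (Brk k s t)
  then show ?case by (cases "c = k") (auto intro: less_trans)
qed simp

lemma bracket_type_spine:
  "comb w \<Longrightarrow> bracket_type w = indicator_type (set (spine_colours w)) + list_type (lefts w)"
proof (induction w)
  case (Brk j s t)
  have "j \<notin> set (spine_colours t)" using spine_colours_less[of t j j] Brk.prems by auto
  then show ?case using Brk by (simp add: indicator_type_def list_type_def ac_simps)
qed (simp add: indicator_type_def list_type_def)

lemma spine_bij:
  assumes "nor t"
  shows "bij_betw (\<lambda>w. (set (spine_colours w), lefts w)) (shape_combs t)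
    ({K. finite K \<and> card K = root_size unlinked always t} \<times> left_combs t)"
proof -
  have inj: "v = w" if "comb v" "comb w" "shape v = shape w"
    "set (spine_colours v) = set (spine_colours w)" "lefts v = lefts w" for v w
    using that
  proof (induction v arbitrary: w)
    case (Gen a)
    then show ?case by (cases w) auto
  next
    case (Brk j s v)
    then obtain j' w' where w: "w = Brk j' s w'" by (cases w) auto
    have lt: "\<And>c. c \<in> set (spine_colours v) \<Longrightarrow> c < j" "\<And>c. c \<in> set (spine_colours w') \<Longrightarrow> c < j'"
      using spine_colours_less Brk.prems w by auto
    have ins: "insert j (set (spine_colours v)) = insert j' (set (spine_colours w'))"
      using Brk.prems(4) w by simp
    \<comment> \<open>Both are the greatest element of the same set of colours.\<close>
    have "j = j'"
    proof (rule ccontr)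
      assume "j \<noteq> j'"
      have "j \<in> insert j' (set (spine_colours w'))" unfolding ins[symmetric] by simp
      moreover have "j' \<in> insert j (set (spine_colours v))" unfolding ins by simp
      ultimately have "j < j'" "j' < j" using lt \<open>j \<noteq> j'\<close> by auto
      then show False by simp
    qed
    moreover have "j \<notin> set (spine_colours v)" "j' \<notin> set (spine_colours w')" using lt by blast+
    ultimately have "set (spine_colours v) = set (spine_colours w')" using ins by auto
    then show ?case using Brk w \<open>j = j'\<close> by auto
  qed
  have img: "\<exists>w. comb w \<and> shape w = t \<and> set (spine_colours w) = K \<and> lefts w = ss"
    if "nor t" "finite K" "card K = root_size unlinked always t" "ss \<in> left_combs t" for t K ss
    using that
  proof (induction t arbitrary: K ss)
    case (Leaf a)
    then show ?case by (intro exI[of _ "Gen a"]) auto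
  next
    case (Node l r)
    from Node.prems(4) obtain s ss' where ss: "ss = s # ss'" "comb s" "shape s = l" "ss' \<in> left_combs r"
      by (auto simp: shape_combs_def)
    have K: "K \<noteq> {}" using Node.prems(3) by auto
    \<comment> \<open>Colours decrease strictly from the root downwards, so the root must take the
      greatest.\<close>
    let ?K = "K - {Max K}"
    have "card ?K = root_size unlinked always r" "finite ?K"
      using Node.prems(2,3) K by auto
    with Node.IH(2)[of ?K ss'] ss Node.prems(1) obtain w where
      w: "comb w" "shape w = r" "set (spine_colours w) = ?K" "lefts w = ss'" by auto
    have "root_below (Max K) w"
    proof (cases w)
      case (Brk k u v)
      then have "k \<in> ?K" using w(3) by auto
      then show ?thesis using Max_ge[OF Node.prems(2), of k] Brk by auto
    qed simp
    moreover have "set (letters s) \<inter> set (letters w) = {}" "wmin s < wmin w"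
      using Node.prems(1) ss(3) w(2) by auto
    ultimately have "comb (Brk (Max K) s w)" using ss w by simp
    moreover have "insert (Max K) ?K = K" using Max_in[OF Node.prems(2) K] by auto
    ultimately show ?case using ss w by (intro exI[of _ "Brk (Max K) s w"]) auto
  qed
  have into: "card (set (spine_colours w)) = root_size unlinked always (shape w) \<and> lefts w \<in> left_combs (shape w)"
    if "comb w" for w
    using that
  proof (induction w)
    case (Brk j s w)
    have "j \<notin> set (spine_colours w)" using spine_colours_less[of w j j] Brk.prems by auto
    then show ?case using Brk by (auto simp: shape_combs_def)
  qed simp
  show ?thesis
  proof (rule bij_betw_imageI)
    show "inj_on (\<lambda>w. (set (spine_colours w), lefts w)) (shape_combs t)"
      by (rule inj_onI) (use inj in \<open>auto simp: shape_combs_def\<close>)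
    show "(\<lambda>w. (set (spine_colours w), lefts w)) ` shape_combs t =
      {K :: nat set. finite K \<and> card K = root_size unlinked always t} \<times> left_combs t"
    proof (intro equalityI subsetI)
      fix x assume "x \<in> (\<lambda>w. (set (spine_colours w), lefts w)) ` shape_combs t"
      then show "x \<in> {K :: nat set. finite K \<and> card K = root_size unlinked always t} \<times> left_combs t"
        using into by (auto simp: shape_combs_def)
    next
      fix x assume "x \<in> {K :: nat set. finite K \<and> card K = root_size unlinked always t} \<times> left_combs t"
      then obtain K ss where x: "x = (K, ss)" "finite K" "card K = root_size unlinked always t" "ss \<in> left_combs t"
        by auto
      have "\<exists>w. comb w \<and> shape w = t \<and> set (spine_colours w) = K \<and> lefts w = ss"
        using assms x(2-4) by (rule img)
      then obtain w where "w \<in> shape_combs t" "x = (set (spine_colours w), lefts w)"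
        unfolding shape_combs_def x(1) by blast
      then show "x \<in> (\<lambda>w. (set (spine_colours w), lefts w)) ` shape_combs t" by (rule rev_image_eqI)
    qed
  qed
qed

text \<open>Both series are treated in one induction: at a node, the lists of left combs multiply
  the combs of the left subtree with the lists of the right one, and the free choice of the spine
  colours then adds the factor of the root block.\<close>

lemma gf_shape_combs:
  assumes "nor t"
  shows "finite_fibres (shape_combs t) bracket_type \<and> gf (shape_combs t) bracket_type = elem_sym_part (lambda_Comb t) \<and>
    finite_fibres (left_combs t) list_type \<and>
    gf (left_combs t) list_type = (\<Prod>k\<in>#other_sizes unlinked always t. elem_sym k)"
  using assms
proof (induction t)
  case (Leaf a)
  have sub: "{ss \<in> {[]}. list_type ss = \<mu>} = (if \<mu> = 0 then {[]} else {})" for \<mu>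
    by (auto simp: list_type_def)
  have "finite_fibres (left_combs (Leaf a)) list_type" by (simp add: finite_fibres_def)
  moreover have "gf (left_combs (Leaf a)) list_type = 1"
    unfolding left_combs.simps by (rule mps_eqI) (simp only: gf_def mps_coeff_Abs sub one_mps_def, simp)
  moreover have "shape_combs (Leaf a) = {Gen a}"
  proof -
    have "w = Gen a" if "shape w = Leaf a" for w using that by (cases w) auto
    then show ?thesis by (auto simp: shape_combs_def)
  qed
  moreover have "finite_fibres {Gen a} bracket_type" by (simp add: finite_fibres_def)
  moreover have "gf {Gen a} bracket_type = 1"
  proof (rule mps_eqI)
    fix \<mu>
    have "{w \<in> {Gen a}. bracket_type w = \<mu>} = (if \<mu> = 0 then {Gen a} else {})" by auto
    then show "mps_coeff (gf {Gen a} bracket_type) \<mu> = mps_coeff 1 \<mu>" by (simp add: gf_def one_mps_def)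
  qed
  ultimately show ?case
    by (simp add: elem_sym_part_def lambda_Comb_eq chain_sizes_def nonzero_def)
next
  case (Node l r)
  have l: "finite_fibres (shape_combs l) bracket_type" "gf (shape_combs l) bracket_type = elem_sym_part (lambda_Comb l)"
    and r: "finite_fibres (left_combs r) list_type"
      "gf (left_combs r) list_type = (\<Prod>k\<in>#other_sizes unlinked always r. elem_sym k)"
    using Node by auto
  have bij: "bij_betw (\<lambda>(s, ss). s # ss) (shape_combs l \<times> left_combs r) (left_combs (Node l r))"
    by (auto simp: bij_betw_def inj_on_def)
  have type: "list_type ((\<lambda>(s, ss). s # ss) x) = (\<lambda>(s, ss). bracket_type s + list_type ss) x" for x
    by (cases x) (simp add: list_type_def)
  have "finite_fibres (shape_combs l \<times> left_combs r) (\<lambda>(s, ss). bracket_type s + list_type ss) \<longleftrightarrow>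
      finite_fibres (left_combs (Node l r)) list_type"
    "gf (shape_combs l \<times> left_combs r) (\<lambda>(s, ss). bracket_type s + list_type ss) =
      gf (left_combs (Node l r)) list_type"
    by (rule gf_bij[OF bij], rule type)+
  note g = this gf_Times[OF l(1) r(1)]
  have L: "finite_fibres (left_combs (Node l r)) list_type"
    "gf (left_combs (Node l r)) list_type = (\<Prod>k\<in>#other_sizes unlinked always (Node l r). elem_sym k)"
    using g l(2) r(2) by (simp_all add: elem_sym_part_def lambda_Comb_eq chain_sizes_def)
  let ?t = "Node l r"
  let ?S = "{K. finite K \<and> card K = root_size unlinked always ?t}"
  have type': "(\<lambda>(K, ss). indicator_type K + list_type ss) (set (spine_colours w), lefts w) = bracket_type w"
    if "w \<in> shape_combs ?t" for w
    using that bracket_type_spine by (simp add: shape_combs_def)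
  have "finite_fibres (shape_combs ?t) bracket_type \<longleftrightarrow>
      finite_fibres (?S \<times> left_combs ?t) (\<lambda>(K, ss). indicator_type K + list_type ss)"
    "gf (shape_combs ?t) bracket_type = gf (?S \<times> left_combs ?t) (\<lambda>(K, ss). indicator_type K + list_type ss)"
    by (rule gf_bij[OF spine_bij[OF Node.prems]], erule type')+
  note g' = this gf_Times[OF elem_sym_gf(1) L(1)]
  have "finite_fibres (shape_combs ?t) bracket_type" using g' by simp
  moreover have "gf (shape_combs ?t) bracket_type = elem_sym (root_size unlinked always ?t) * gf (left_combs ?t) list_type"
    using g' by (simp add: elem_sym_gf(2))
  ultimately show ?case
    using L by (simp add: elem_sym_part_def lambda_Comb_eq chain_sizes_def nonzero_def)
qed

lemma card_combs:
  "int (card (combs n \<mu>)) = mps_coeff (\<Sum>t\<in>Nor n. elem_sym_part (lambda_Comb t)) \<mu>"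
proof -
  have nor: "nor t" if "t \<in> Nor n" for t using that by (simp add: Nor_eq)
  have fin: "finite (Nor n)"
    using finite_nors[of "{1..n}"] by (simp add: Nor_eq nors_def)
  have "combs n \<mu> = (\<Union>t\<in>Nor n. {w \<in> shape_combs t. bracket_type w = \<mu>})"
    using nor_shape by (auto simp: combs_def shape_combs_def Nor_eq)
  moreover have "finite {w \<in> shape_combs t. bracket_type w = \<mu>}" if "t \<in> Nor n" for t
    using gf_shape_combs[OF nor[OF that]] by (simp add: finite_fibres_def)
  ultimately have "card (combs n \<mu>) = (\<Sum>t\<in>Nor n. card {w \<in> shape_combs t. bracket_type w = \<mu>})"
    using fin by (simp add: card_UN_disjoint shape_combs_def disjoint_iff)
  also have "int \<dots> = (\<Sum>t\<in>Nor n. mps_coeff (elem_sym_part (lambda_Comb t)) \<mu>)"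
    unfolding of_nat_sum
  proof (rule sum.cong[OF refl])
    fix t assume "t \<in> Nor n"
    from gf_shape_combs[OF nor[OF this]]
    have "elem_sym_part (lambda_Comb t) = gf (shape_combs t) bracket_type" by simp
    then show "int (card {w \<in> shape_combs t. bracket_type w = \<mu>}) = mps_coeff (elem_sym_part (lambda_Comb t)) \<mu>"
      by (simp add: gf_def)
  qed
  finally show ?thesis by (simp add: coeff_sum)
qed

section \<open>Weights of bracket types and comparison of coefficients\<close>

lemma weight_on: "finite A \<Longrightarrow> Poly_Mapping.keys \<mu> \<subseteq> A \<Longrightarrow> weight \<mu> = (\<Sum>i\<in>A. Poly_Mapping.lookup \<mu> i)"
  unfolding weight_def by (rule sum.mono_neutral_left) (auto simp: not_in_keys_iff_lookup_eq_zero)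

lemma weight_add: "weight (\<mu> + \<nu>) = weight \<mu> + weight \<nu>"
proof -
  let ?A = "Poly_Mapping.keys \<mu> \<union> Poly_Mapping.keys \<nu>"
  have "Poly_Mapping.keys (\<mu> + \<nu>) \<subseteq> ?A" by (rule Poly_Mapping.keys_add)
  then show ?thesis by (simp add: weight_on[of ?A] lookup_add sum.distrib)
qed

lemma weight_bracket_type: "Suc (weight (bracket_type w)) = length (letters w)"
proof (induction w)
  case (Brk j s t)
  have "weight (Poly_Mapping.single j 1) = 1" by (simp add: weight_def)
  then show ?case using Brk by (simp add: weight_add)
qed (simp add: weight_def)

lemma combs_weight:
  assumes "weight \<mu> \<noteq> n - 1"
  shows "combs n \<mu> = {}"
proof -
  have "weight (bracket_type w) = n - 1" if "comb w" "set (letters w) = {1..n}" for w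
    using weight_bracket_type[of w] distinct_card[OF comb_distinct[OF that(1)]] that(2) by simp
  then show ?thesis using assms by (auto simp: combs_def)
qed

lemma formal_sum_dim_Lie:
  "formal_sum (WComp (n - 1)) (\<lambda>\<mu>. of_nat (dim_Lie TYPE('k::field) n \<mu>) * mmonom \<mu>) =
    (\<Sum>t\<in>Nor n. elem_sym_part (lambda_Comb t) :: int mps)"
proof (rule mps_eqI)
  fix \<nu>
  let ?d = "\<lambda>\<mu>. card (combs n \<mu>)"
  have c: "mps_coeff (of_nat (?d \<mu>) * mmonom \<mu> :: int mps) \<nu> = (if \<mu> = \<nu> then int (?d \<nu>) else 0)" for \<mu>
    by (auto simp: coeff_of_nat_times mmonom_eq)
  \<comment> \<open>Restriction to \<open>WComp (n - 1)\<close> loses no term: a nonzero coefficient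
    at \<open>\<nu>\<close> requires a comb on \<open>n\<close> letters, which has
    \<open>n - 1\<close> brackets.\<close>
  have "{\<mu> \<in> WComp (n - 1). (if \<mu> = \<nu> then int (?d \<nu>) else 0) \<noteq> 0} = (if ?d \<nu> = 0 then {} else {\<nu>})"
  proof (cases "?d \<nu> = 0")
    case False
    then have "weight \<nu> = n - 1" using combs_weight[of \<nu> n] by (metis card.empty)
    then show ?thesis using False by (auto simp: WComp_def)
  qed simp
  then have "mps_coeff (formal_sum (WComp (n - 1)) (\<lambda>\<mu>. of_nat (?d \<mu>) * mmonom \<mu> :: int mps)) \<nu> = int (?d \<nu>)"
    by (simp add: formal_sum_def c)
  then show "mps_coeff (formal_sum (WComp (n - 1)) (\<lambda>\<mu>. of_nat (dim_Lie TYPE('k) n \<mu>) * mmonom \<mu>)) \<nu> =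
    mps_coeff (\<Sum>t\<in>Nor n. elem_sym_part (lambda_Comb t) :: int mps) \<nu>"
    by (simp add: dim_Lie_combs card_combs)
qed

theorem theorem4p8:
  fixes n :: nat
  assumes "n \<ge> 1"
  shows "formal_sum (WComp (n - 1))
           (\<lambda>\<mu>. of_nat (dim_Lie TYPE('k::field) n \<mu>) * mmonom \<mu>)
         = (\<Sum>\<Upsilon>\<in>Nor n. elem_sym_part (lambda_Lyn \<Upsilon>) :: int mps)
       \<and> (\<Sum>\<Upsilon>\<in>Nor n. elem_sym_part (lambda_Lyn \<Upsilon>) :: int mps)
         = (\<Sum>\<theta>\<in>Stirling_perms (n - 1). elem_sym_part (lambda_AA \<theta>))
       \<and> (\<Sum>\<theta>\<in>Stirling_perms (n - 1). elem_sym_part (lambda_AA \<theta>) :: int mps)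
         = (\<Sum>\<theta>\<in>Stirling_perms (n - 1). elem_sym_part (lambda_TN \<theta>))
       \<and> (\<Sum>\<theta>\<in>Stirling_perms (n - 1). elem_sym_part (lambda_TN \<theta>) :: int mps)
         = (\<Sum>\<Upsilon>\<in>Nor n. elem_sym_part (lambda_Comb \<Upsilon>))"
proof -
  \<comment> \<open>The dimension series equals the comb sum, and \<open>word\<close> matches each
    sum over Stirling permutations with one over trees, so this single equality links all five
    expressions.\<close>
  have "(\<Sum>\<Upsilon>\<in>Nor n. elem_sym_part (lambda_Lyn \<Upsilon>) :: int mps) = (\<Sum>\<Upsilon>\<in>Nor n. elem_sym_part (lambda_Comb \<Upsilon>))"
    unfolding elem_sym_part_def by (rule sum_Nor_lyndon_comb[of elem_sym, OF elem_sym_0 assms])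
  then show ?thesis
    by (simp only: formal_sum_dim_Lie sum_Stirling_perms[OF assms])
qed

end
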